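(* Let $1<p<+\infty$, let $B$ be any ball in $\mathbb{R}^d$, and for $q>0$ define $$m_{p,q}=\inf\{F_{p,q}(\Omega) : \Omega\subset\mathbb{R}^d\text{ open, convex, bounded}\}\ \ (q\le1),\qquad M_{p,q}=\sup\{F_{p,q}(\Omega) : \Omega\subset\mathbb{R}^d\text{ open, convex, bounded}\}\ \ (q\ge1).$$ Then $$m_{p,q}\ge \frac{m_{p,1}\,T_p(B)^{q-1}}{|B|^{(d(p-1)+p)(q-1)/d}}\quad\text{if }0<q<1,\qquad M_{p,q}\le \frac{M_{p,1}\,T_p(B)^{q-1}}{|B|^{(d(p-1)+p)(q-1)/d}}\quad\text{if }q>1.$$ Moreover, if $0<q<1$ there exists a bounded open convex set $\Omega^m_{p,q}\subset\mathbb{R}^d$ such that $F_{p,q}(\Omega^m_{p,q})=m_{p,q}$, and if $q>1$ there exists a bounded open convex set $\Omega^M_{p,q}\subset\mathbb{R}^d$ such that $F_{p,q}(\Omega^M_{p,q})=M_{p,q}$.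
   Context: The sets $\Omega$ are nonempty; $|\Omega|$ is the Lebesgue measure. For $\Omega\subset\mathbb{R}^d$ open with $0<|\Omega|<\infty$ and $1<p<\infty$, $W^{1,p}_0(\Omega)$ is the completion of $C_c^\infty(\Omega)$ with respect to the norm $\|\nabla u\|_{L^p(\Omega)}$. The $p$-torsional rigidity is $$T_p(\Omega)=\max\Big\{\Big[\int_\Omega|u|\,dx\Big]^p\Big[\int_\Omega|\nabla u|^p\,dx\Big]^{-1} : u\in W^{1,p}_0(\Omega),\ u\neq0\Big\},$$ and the $p$-principal eigenvalue is $$\lambda_p(\Omega)=\min\Big\{\Big[\int_\Omega|\nabla u|^p\,dx\Big]\Big[\int_\Omega|u|^p\,dx\Big]^{-1} : u\in W^{1,p}_0(\Omega),\ u\neq0\Big\}.$$ For $q>0$ the scaling invariant functional $F_{p,q}$ is $$F_{p,q}(\Omega)=\frac{\lambda_p(\Omega)\,T_p(\Omega)^q}{|\Omega|^{\alpha(p,q,d)}},\qquad \alpha(p,q,d)=q(p-1)+\frac{p(q-1)}{d}.$$ *)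

theory Defs
  imports "HOL-Analysis.Analysis"
begin

text \<open>A function is \<open>C\<^sup>k\<close> on the whole space if its iterated directional derivatives up to
  order \<open>k\<close> exist and are continuous.\<close>

primrec C_k :: "nat \<Rightarrow> ('a::euclidean_space \<Rightarrow> real) \<Rightarrow> bool" where
  "C_k 0 f \<longleftrightarrow> continuous_on UNIV f"
| "C_k (Suc k) f \<longleftrightarrow>
     (\<forall>x. f differentiable (at x)) \<and> (\<forall>v. C_k k (\<lambda>x. frechet_derivative f (at x) v))"

definition Cc_infinity :: "'a::euclidean_space set \<Rightarrow> ('a \<Rightarrow> real) set" where
  "Cc_infinity \<Omega> =
     {\<phi>. (\<forall>k. C_k k \<phi>) \<and> compact (closure {x. \<phi> x \<noteq> 0}) \<and> closure {x. \<phi> x \<noteq> 0} \<subseteq> \<Omega>}"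

definition grad :: "('a::euclidean_space \<Rightarrow> real) \<Rightarrow> 'a \<Rightarrow> 'a" where
  "grad f x = (\<Sum>b\<in>Basis. frechet_derivative f (at x) b *\<^sub>R b)"

definition Lp_on ::
    "real \<Rightarrow> 'a::euclidean_space set \<Rightarrow> ('a \<Rightarrow> 'b::euclidean_space) \<Rightarrow> bool" where
  "Lp_on p \<Omega> f \<longleftrightarrow>
     set_borel_measurable lebesgue \<Omega> f \<and> set_integrable lebesgue \<Omega> (\<lambda>x. norm (f x) powr p)"

text \<open>The completion of \<open>C\<^sub>c\<^sup>\<infinity>(\<Omega>)\<close> with respect to the \<open>L\<^sup>p\<close>-norm of the gradient, realised as a
  space of functions: \<open>(u, g)\<close> belongs to \<open>W0 p \<Omega>\<close> iff \<open>u \<in> W\<^sub>0\<^sup>1\<^sup>,\<^sup>p(\<Omega>)\<close> and \<open>g = \<nabla>u\<close>.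
  When \<open>\<Omega>\<close> is open of finite measure, the Poincare inequality makes every sequence of test
  functions that is Cauchy in the gradient norm converge in \<open>L\<^sup>p\<close>, so each element of the
  completion is represented by such a pair.  The pair is unique up to null sets, because an \<open>L\<^sup>p\<close>-limit of
  gradients is the weak gradient of the \<open>L\<^sup>p\<close>-limit of the functions.\<close>

definition W0 :: "real \<Rightarrow> 'a::euclidean_space set \<Rightarrow> (('a \<Rightarrow> real) \<times> ('a \<Rightarrow> 'a)) set" where
  "W0 p \<Omega> = {(u, g). Lp_on p \<Omega> u \<and> Lp_on p \<Omega> g \<and>
     (\<exists>\<phi>. (\<forall>n::nat. \<phi> n \<in> Cc_infinity \<Omega>) \<and>
       (\<lambda>n. LINT x:\<Omega>|lebesgue. \<bar>\<phi> n x - u x\<bar> powr p) \<longlonglongrightarrow> 0 \<and>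
       (\<lambda>n. LINT x:\<Omega>|lebesgue. norm (grad (\<phi> n) x - g x) powr p) \<longlonglongrightarrow> 0)}"

definition W0_nonzero ::
    "real \<Rightarrow> 'a::euclidean_space set \<Rightarrow> (('a \<Rightarrow> real) \<times> ('a \<Rightarrow> 'a)) set" where
  "W0_nonzero p \<Omega> = {(u, g) \<in> W0 p \<Omega>. \<not> (AE x in lebesgue. x \<in> \<Omega> \<longrightarrow> u x = 0)}"

text \<open>Maximum and minimum are rendered as supremum and infimum; for open \<open>\<Omega>\<close> with
  \<open>0 < |\<Omega>| < \<infinity>\<close> and \<open>1 < p\<close> both are finite and attained.\<close>

definition torsion :: "real \<Rightarrow> 'a::euclidean_space set \<Rightarrow> real" where
  "torsion p \<Omega> = (SUP (u, g)\<in>W0_nonzero p \<Omega>.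
     (LINT x:\<Omega>|lebesgue. \<bar>u x\<bar>) powr p / (LINT x:\<Omega>|lebesgue. norm (g x) powr p))"

definition eigenvalue :: "real \<Rightarrow> 'a::euclidean_space set \<Rightarrow> real" where
  "eigenvalue p \<Omega> = (INF (u, g)\<in>W0_nonzero p \<Omega>.
     (LINT x:\<Omega>|lebesgue. norm (g x) powr p) / (LINT x:\<Omega>|lebesgue. \<bar>u x\<bar> powr p))"

definition scaling_exponent :: "real \<Rightarrow> real \<Rightarrow> nat \<Rightarrow> real" where
  "scaling_exponent p q d = q * (p - 1) + p * (q - 1) / real d"

definition F :: "real \<Rightarrow> real \<Rightarrow> 'a::euclidean_space set \<Rightarrow> real" where
  "F p q \<Omega> = eigenvalue p \<Omega> * torsion p \<Omega> powr q
     / measure lebesgue \<Omega> powr scaling_exponent p q DIM('a)"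

definition convex_domains :: "'a::euclidean_space set set" where
  "convex_domains = {\<Omega>. \<Omega> \<noteq> {} \<and> open \<Omega> \<and> convex \<Omega> \<and> bounded \<Omega>}"

text \<open>The extrema are taken in the extended reals, so that an upper bound on the supremum
  includes its finiteness.  The argument of type \<open>'a itself\<close> fixes the ambient space.\<close>

definition m_inf :: "'a::euclidean_space itself \<Rightarrow> real \<Rightarrow> real \<Rightarrow> ereal" where
  "m_inf _ p q = (INF \<Omega>\<in>(convex_domains :: 'a set set). ereal (F p q \<Omega>))"

definition M_sup :: "'a::euclidean_space itself \<Rightarrow> real \<Rightarrow> real \<Rightarrow> ereal" where
  "M_sup _ p q = (SUP \<Omega>\<in>(convex_domains :: 'a set set). ereal (F p q \<Omega>))"

end

theory Submission
  imports Defs "HOL-Complex_Analysis.Great_Picard" "HOL-Real_Asymp.Real_Asymp"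
begin

text \<open>
  With \<open>k = p - 1 + p / d\<close> one has
  \<open>F p q \<Omega> = F p 1 \<Omega> * (torsion p \<Omega> / |\<Omega>| powr k) powr (q - 1)\<close>, so both inequalities follow from the
  Saint-Venant inequality: balls maximise \<open>torsion p \<Omega> / |\<Omega>| powr k\<close>.  The latter is obtained without
  rearrangement.  The Brunn--Minkowski inequality in dimension \<open>d + 1\<close> is applied to the hypograph
  \<open>A\<close> of \<open>|u|\<close> and to \<open>t\<close> times the hypograph \<open>C\<close> of the torsion function
  \<open>(R\<^sup>p\<^sup>' - |y|\<^sup>p\<^sup>') / p'\<close> of a ball with the same volume as \<open>\<Omega>\<close>, where \<open>p' = p / (p - 1)\<close>.
  By Young's inequality \<open>A + t C\<close> lies, up to \<open>o(t)\<close>, below the graph of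
  \<open>|u| + t (|\<nabla>u|\<^sup>p / p + R\<^sup>p\<^sup>' / p')\<close>, and differentiation at \<open>t = 0\<close> gives the sharp inequality.

  For the existence part let \<open>\<rho>\<close> be the radius of a ball inscribed in \<open>\<Omega>\<close> such that \<open>\<Omega>\<close> lies in a
  slab of width comparable to \<open>\<rho>\<close>.  Then \<open>eigenvalue p \<Omega> \<ge> c \<rho> powr (- p)\<close> and
  \<open>torsion p \<Omega> \<ge> c \<rho> powr p * |\<Omega>| powr (p - 1)\<close>, while
  \<open>eigenvalue p \<Omega> * torsion p \<Omega> \<le> |\<Omega>| powr (p - 1)\<close>; hence optimising sequences cannot degenerate.
  After normalisation their gauges converge uniformly along a subsequence, and \<open>F p q\<close> is continuous
  under this convergence by monotonicity and scaling.
\<close>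

subsection \<open>Smooth functions\<close>

text \<open>Torsion and eigenvalue are treated as best constants of inequalities between integrals
  of test functions, through \<open>torsion_least\<close> with \<open>torsion_bound\<close> and
  \<open>eigenvalue_greatest\<close> with \<open>eigenvalue_bound\<close>. Sobolev functions enter
  only there; monotonicity, scaling and continuity follow from these four facts. Sharpness in the
  Saint-Venant inequality comes from giving \<open>A\<close> and \<open>C\<close> the same volume K,
  which only costs a constant factor in u. Brunn--Minkowski then yields (1 + t)^(d+1) K for the
  volume of A + t C, which is exact when \<open>A = C\<close>, since the torsion function of a ball
  is concave. The region below the envelope has volume K + t (...) + o(t), so only the coefficients
  of t are compared. Existence is decided by two exponents: on normalised domains F is at least a
  multiple of |\<Omega>|^(p(1-q)/d) if q < 1, and at most a multiple of |\<Omega>|^(-p(q-1)/d) if q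
  > 1. Either estimate bounds the volume along an optimising sequence. At q = 1 both exponents
  vanish and this control is lost.\<close>

lemma frechet_eqI: "(f has_derivative D) (at x) \<Longrightarrow> frechet_derivative f (at x) = D"
  using frechet_derivative_at by metis

lemma C_k_continuous: "C_k k f \<Longrightarrow> continuous_on UNIV f"
  by (cases k)
    (simp_all add: continuous_at_imp_continuous_on differentiable_imp_continuous_within)

text \<open>Lets a derivative be supplied by the usual calculus rules instead of as
  \<open>frechet_derivative\<close>.\<close>

lemma C_k_SucI:
  assumes "\<And>x. (f has_derivative D x) (at x)" "\<And>v. C_k k (\<lambda>x. D x v)"
  shows "C_k (Suc k) f"
proof -
  have "frechet_derivative f (at x) = D x" for x using frechet_eqI assms(1) by blast
  moreover have "f differentiable at x" for x using assms(1) differentiable_def by blast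
  ultimately show ?thesis using assms(2) by simp
qed

lemma C_k_SucD:
  assumes "C_k (Suc k) f"
  shows "(f has_derivative frechet_derivative f (at x)) (at x)"
    "C_k k (\<lambda>x. frechet_derivative f (at x) v)"
  using assms frechet_derivative_works by auto

lemma C_k_const: "C_k k (\<lambda>x. c)"
proof (induction k arbitrary: c)
  case (Suc k)
  show ?case by (rule C_k_SucI[where D="\<lambda>x v. 0"]) (auto simp: Suc)
qed auto

lemma C_k_bounded_linear: "bounded_linear f \<Longrightarrow> C_k k f"
  by (cases k)
    (simp_all add: linear_continuous_on C_k_SucI[OF bounded_linear_imp_has_derivative] C_k_const
      del: C_k.simps(2))

lemma C_k_add: "C_k k f \<Longrightarrow> C_k k g \<Longrightarrow> C_k k (\<lambda>x. f x + g x)"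
proof (induction k arbitrary: f g)
  case (Suc k)
  note D = Suc.prems[THEN C_k_SucD(1)] Suc.prems[THEN C_k_SucD(2)]
  show ?case by (rule C_k_SucI[OF has_derivative_add[OF D(1,2)]]) (intro Suc.IH D)
qed (auto intro: continuous_on_add)

lemma C_k_lower: "C_k (Suc k) f \<Longrightarrow> C_k k f"
proof (induction k arbitrary: f)
  case 0
  then show ?case using C_k_continuous C_k.simps(1) by blast
next
  case (Suc k)
  from C_k_SucI[OF C_k_SucD(1)[OF Suc.prems] Suc.IH[OF C_k_SucD(2)[OF Suc.prems]]]
  show ?case .
qed

lemma C_k_mult: "C_k k f \<Longrightarrow> C_k k g \<Longrightarrow> C_k k (\<lambda>x. f x * g x)"
proof (induction k arbitrary: f g)
  case (Suc k)
  note D = Suc.prems[THEN C_k_SucD(1)] Suc.prems[THEN C_k_SucD(2)]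
  show ?case
    by (rule C_k_SucI[OF has_derivative_mult[OF D(1,2)]])
       (intro Suc.IH D C_k_add Suc.prems[THEN C_k_lower])
qed (auto intro: continuous_on_mult)

lemma C_k_cmult: "C_k k f \<Longrightarrow> C_k k (\<lambda>x. c * f x)"
  by (intro C_k_mult C_k_const)

lemma C_k_diff: "C_k k f \<Longrightarrow> C_k k g \<Longrightarrow> C_k k (\<lambda>x. f x - g x)"
  using C_k_add[of k f "\<lambda>x. (-1) * g x"] C_k_cmult[of k g "-1"] by simp

lemma C_k_sum: "finite I \<Longrightarrow> (\<And>i. i \<in> I \<Longrightarrow> C_k k (f i)) \<Longrightarrow> C_k k (\<lambda>x. \<Sum>i\<in>I. f i x)"
  by (induction I rule: finite_induct) (auto intro: C_k_const C_k_add)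

lemma C_k_compose:
  fixes h :: "real \<Rightarrow> real"
  shows "C_k k h \<Longrightarrow> C_k k g \<Longrightarrow> C_k k (\<lambda>x. h (g x))"
proof (induction k arbitrary: g h)
  case (Suc k)
  note D = Suc.prems[THEN C_k_SucD(1)] Suc.prems[THEN C_k_SucD(2)]
  \<comment> \<open>A linear map on the reals is multiplication by its value at 1. This writes the
    chain rule as a product of scalar functions, to which \<open>C_k_mult\<close> and the induction
    hypothesis apply.\<close>
  have lin: "frechet_derivative h (at y) z = frechet_derivative h (at y) 1 * z" for y z
    using linear_cmul[OF has_derivative_linear[OF D(1)[of y]], of z 1] by simp
  have "((\<lambda>x. h (g x)) has_derivative
      (\<lambda>v. frechet_derivative h (at (g x)) 1 * frechet_derivative g (at x) v)) (at x)" for x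
    using has_derivative_compose[OF D(2), of h, OF D(1), of x]
    unfolding lin[of "g x" "frechet_derivative g (at x) _"] .
  then show ?case
    by (rule C_k_SucI) (intro C_k_mult Suc.IH[OF D(3)] D Suc.prems(2)[THEN C_k_lower])
qed (auto intro: continuous_on_compose2)

text \<open>Differentiation lowers the exponent by one, so the induction keeps \<open>a\<close>
  arbitrary; positivity of the base keeps all these powers differentiable.\<close>

lemma C_k_powr: "C_k k g \<Longrightarrow> (\<And>x. 0 < g x) \<Longrightarrow> C_k k (\<lambda>x. g x powr a)"
proof (induction k arbitrary: a)
  case (Suc k)
  note D = Suc.prems(1)[THEN C_k_SucD(1)] Suc.prems(1)[THEN C_k_SucD(2)]
  have "((\<lambda>x. g x powr a) has_derivative
      (\<lambda>v. a * (g x powr (a - 1) * frechet_derivative g (at x) v))) (at x)" for x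
  proof -
    have "g x powr a * (a / g x) = a * g x powr (a - 1)"
      using Suc.prems(2)[of x] by (simp add: powr_diff field_simps)
    then show ?thesis
      using Suc.prems(2)[of x]
      by (auto intro!: derivative_eq_intros D(1) ext simp: field_simps powr_diff)
  qed
  then show ?case
    by (rule C_k_SucI) (intro C_k_mult C_k_const Suc.IH D Suc.prems C_k_lower)
next
  case 0
  then have "g x \<noteq> 0" for x by (metis less_irrefl)
  with 0 show ?case by (auto intro!: continuous_intros)
qed

lemma C_k_inner: "C_k k (\<lambda>x. x \<bullet> v)"
  by (intro C_k_bounded_linear bounded_linear_inner_left)

lemma C_k_norm_square: "C_k k (\<lambda>x. (norm (x::'a::euclidean_space))\<^sup>2)"
proof -
  have "(norm x)\<^sup>2 = (\<Sum>b\<in>Basis. (x \<bullet> b) * (x \<bullet> b))" for x :: 'a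
    unfolding power2_norm_eq_inner by (rule euclidean_inner)
  then show ?thesis
    by (simp only:) (intro C_k_sum C_k_mult C_k_inner finite_Basis)
qed

lemma C_k_affine:
  fixes f :: "'a::euclidean_space \<Rightarrow> real"
  shows "C_k k f \<Longrightarrow> C_k k (\<lambda>x. f (a *\<^sub>R x + b))"
proof (induction k arbitrary: f)
  case (Suc k)
  note D = Suc.prems[THEN C_k_SucD(1)] Suc.prems[THEN C_k_SucD(2)]
  have "((\<lambda>x. a *\<^sub>R x + b) has_derivative (\<lambda>v. a *\<^sub>R v)) (at x)" for x
    by (auto intro!: derivative_eq_intros)
  from has_derivative_compose[OF this, of f, OF D(1)]
  show ?case
    by (rule C_k_SucI) (rule Suc.IH[OF D(2)])
next
  case 0
  then have "continuous_on UNIV f" by simp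
  then have "continuous_on UNIV (\<lambda>x. f (a *\<^sub>R x + b))"
    by (rule continuous_on_compose2) (auto intro!: continuous_intros)
  then show ?case by simp
qed

text \<open>For \<open>a = 0\<close> this is the classical function exp(-1/t), flat at 0. The power
  in front makes the linear span of the family closed under differentiation, so smoothness follows
  by one induction over all \<open>a\<close>.\<close>

definition flat_exp :: "real \<Rightarrow> real \<Rightarrow> real" where
  "flat_exp a t = (if 0 < t then t powr a * exp (- (1 / t)) else 0)"

lemma flat_exp_deriv:
  "(flat_exp a has_real_derivative (a * flat_exp (a - 1) t + flat_exp (a - 2) t)) (at t)"
proof -
  consider "t > 0" | "t < 0" | "t = 0" by linarith
  then show ?thesis
  proof cases
    case 1
    have "((\<lambda>t. t powr a * exp (- (1 / t))) has_real_derivative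
        (a * flat_exp (a - 1) t + flat_exp (a - 2) t)) (at t)"
      using 1 by (auto intro!: derivative_eq_intros simp: flat_exp_def powr_diff field_simps power2_eq_square)
    then show ?thesis
      by (rule DERIV_cong_ev[THEN iffD1, rotated 3])
         (use 1 in \<open>auto simp: flat_exp_def intro!: eventually_mono[OF eventually_nhds_in_open[of "{0<..}" t]]\<close>)
  next
    case 2
    have "((\<lambda>t. 0) has_real_derivative (a * flat_exp (a - 1) t + flat_exp (a - 2) t)) (at t)"
      using 2 by (auto simp: flat_exp_def)
    then show ?thesis
      by (rule DERIV_cong_ev[THEN iffD1, rotated 3])
         (use 2 in \<open>auto simp: flat_exp_def intro!: eventually_mono[OF eventually_nhds_in_open[of "{..<0}" t]]\<close>)
  next
    case 3
    \<comment> \<open>From the right the difference quotient at 0 is a power of t times exp(-1/t),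
      and the exponential beats every power.\<close>
    have "((\<lambda>t::real. t powr a * exp (- (1 / t)) / t) \<longlongrightarrow> 0) (at_right 0)"
      by real_asymp
    then have "((\<lambda>t. flat_exp a t / t) \<longlongrightarrow> 0) (at_right 0)"
      by (rule Lim_transform_eventually)
         (auto simp: flat_exp_def eventually_at_right_less intro!: eventually_at_rightI[of 0 1])
    moreover have "((\<lambda>t. flat_exp a t / t) \<longlongrightarrow> 0) (at_left 0)"
      by (rule tendsto_eventually)
         (auto simp: flat_exp_def intro!: eventually_at_leftI[of "-1" 0])
    ultimately have "((\<lambda>t. flat_exp a t / t) \<longlongrightarrow> 0) (at 0)"
      by (simp add: filterlim_split_at)
    then show ?thesis using 3
      by (simp add: DERIV_def flat_exp_def)
  qed
qed

lemma C_k_flat_exp: "C_k k (flat_exp a)"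
proof (induction k arbitrary: a)
  case 0
  then show ?case using flat_exp_deriv
    by (metis C_k.simps(1) DERIV_isCont continuous_at_imp_continuous_on)
next
  case (Suc k)
  show ?case
    by (rule C_k_SucI[OF flat_exp_deriv[unfolded has_field_derivative_def]])
       (intro C_k_mult C_k_add C_k_const Suc)
qed

subsection \<open>Test functions and convergence in mean\<close>

text \<open>\<open>Lp_mass\<close> and \<open>Dir\<close> integrate over the whole space: a test
  function vanishes outside its domain, so its integrals are the same for every domain containing
  its support. Comparing two domains thus becomes an inclusion of test spaces.\<close>

definition Lp_mass :: "real \<Rightarrow> ('a::euclidean_space \<Rightarrow> real) \<Rightarrow> real" where
  "Lp_mass p f = (LINT x|lborel. \<bar>f x\<bar> powr p)"

definition Dir :: "real \<Rightarrow> ('a::euclidean_space \<Rightarrow> real) \<Rightarrow> real" where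
  "Dir p f = (LINT x|lborel. norm (grad f x) powr p)"

lemma Lp_mass_nonneg: "0 \<le> Lp_mass p f"
  and Dir_nonneg: "0 \<le> Dir p f"
  by (simp_all add: Lp_mass_def Dir_def)

lemma grad_inner_Basis: "b \<in> Basis \<Longrightarrow> grad f x \<bullet> b = frechet_derivative f (at x) b"
  by (simp add: grad_def inner_sum_left inner_Basis if_distrib cong: if_cong)

lemma has_derivative_grad:
  assumes "f differentiable (at x)"
  shows "(f has_derivative (\<lambda>v. grad f x \<bullet> v)) (at x)"
proof -
  have d: "(f has_derivative frechet_derivative f (at x)) (at x)"
    using assms frechet_derivative_works by blast
  then have lin: "linear (frechet_derivative f (at x))" by (rule has_derivative_linear)
  have "frechet_derivative f (at x) v = grad f x \<bullet> v" for v
  proof -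
    have "frechet_derivative f (at x) v = frechet_derivative f (at x) (\<Sum>b\<in>Basis. (v \<bullet> b) *\<^sub>R b)"
      by (simp add: euclidean_representation)
    also have "\<dots> = (\<Sum>b\<in>Basis. (v \<bullet> b) * (grad f x \<bullet> b))"
      by (simp add: linear_sum[OF lin] linear_cmul[OF lin] grad_inner_Basis)
    also have "\<dots> = grad f x \<bullet> v"
      by (subst euclidean_inner) (simp add: mult.commute)
    finally show ?thesis .
  qed
  then show ?thesis using d by (metis has_derivative_transform UNIV_I ext)
qed

lemma grad_eqI:
  assumes "(f has_derivative (\<lambda>v. g \<bullet> v)) (at x)"
  shows "grad f x = g"
  by (rule euclidean_eqI) (simp add: grad_inner_Basis frechet_eqI[OF assms])

lemma Cc_infinityD:
  assumes "\<phi> \<in> Cc_infinity \<Omega>"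
  shows "C_k k \<phi>" "continuous_on UNIV \<phi>" "(\<phi> has_derivative (\<lambda>v. grad \<phi> x \<bullet> v)) (at x)"
    "continuous_on UNIV (grad \<phi>)"
proof -
  have C: "C_k k \<phi>" for k using assms by (auto simp: Cc_infinity_def)
  then show "C_k k \<phi>" "continuous_on UNIV \<phi>" using C_k_continuous by blast+
  have "\<phi> differentiable (at x)" for x using C[of 1] by simp
  then show "(\<phi> has_derivative (\<lambda>v. grad \<phi> x \<bullet> v)) (at x)" by (rule has_derivative_grad)
  have "continuous_on UNIV (\<lambda>x. frechet_derivative \<phi> (at x) b)" for b
    using C[of 1] by simp
  then show "continuous_on UNIV (grad \<phi>)"
    unfolding grad_def by (intro continuous_intros)
qed

lemma Cc_infinity_support:
  assumes "\<phi> \<in> Cc_infinity \<Omega>"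
  obtains K where "compact K" "K \<subseteq> \<Omega>" "\<And>x. x \<notin> K \<Longrightarrow> \<phi> x = 0" "\<And>x. x \<notin> K \<Longrightarrow> grad \<phi> x = 0"
proof
  let ?K = "closure {x. \<phi> x \<noteq> 0}"
  show "compact ?K" "?K \<subseteq> \<Omega>" using assms by (auto simp: Cc_infinity_def)
  show z: "\<phi> x = 0" if "x \<notin> ?K" for x using that closure_subset[of "{x. \<phi> x \<noteq> 0}"] by auto
  show "grad \<phi> x = 0" if "x \<notin> ?K" for x
  proof (rule grad_eqI)
    have "((\<lambda>x. 0) has_derivative (\<lambda>v. 0 \<bullet> v)) (at x)" by simp
    then show "(\<phi> has_derivative (\<lambda>v. 0 \<bullet> v)) (at x)"
    proof (rule has_derivative_transform_within_open[where s="- ?K"])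
      show "open (- ?K)" by (rule open_Compl[OF closed_closure])
      show "x \<in> - ?K" using that by blast
      show "0 = \<phi> y" if "y \<in> - ?K" for y using z[of y] that by simp
    qed
  qed
qed

lemma Cc_infinityI:
  assumes "\<And>k. C_k k \<phi>" "compact K" "K \<subseteq> \<Omega>" "\<And>x. x \<notin> K \<Longrightarrow> \<phi> x = 0"
  shows "\<phi> \<in> Cc_infinity \<Omega>"
proof -
  have "closure {x. \<phi> x \<noteq> 0} \<subseteq> K"
    using assms(2,4) by (intro closure_minimal compact_imp_closed) auto
  then have "compact (closure {x. \<phi> x \<noteq> 0})"
    using assms(2) by (metis compact_Int_closed closed_closure inf.absorb2)
  with \<open>closure _ \<subseteq> K\<close> show ?thesis using assms by (auto simp: Cc_infinity_def)
qed

lemma Cc_infinity_mono: "\<Omega> \<subseteq> \<Omega>' \<Longrightarrow> \<phi> \<in> Cc_infinity \<Omega> \<Longrightarrow> \<phi> \<in> Cc_infinity \<Omega>'"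
  by (auto simp: Cc_infinity_def)

lemma Cc_infinity_cmult:
  assumes "\<phi> \<in> Cc_infinity \<Omega>" shows "(\<lambda>x. c * \<phi> x) \<in> Cc_infinity \<Omega>"
proof -
  obtain K where K: "compact K" "K \<subseteq> \<Omega>" "\<And>x. x \<notin> K \<Longrightarrow> \<phi> x = 0"
    using Cc_infinity_support[OF assms] by metis
  show ?thesis
    by (rule Cc_infinityI[of _ K]) (use K Cc_infinityD(1)[OF assms] in \<open>auto intro: C_k_cmult\<close>)
qed

lemma Cc_infinity_affine:
  assumes "\<phi> \<in> Cc_infinity \<Omega>" and a: "a \<noteq> 0" and \<Omega>: "\<Omega> \<subseteq> (\<lambda>x. a *\<^sub>R x + b) ` \<Omega>'"
  shows "(\<lambda>x. \<phi> (a *\<^sub>R x + b)) \<in> Cc_infinity \<Omega>'"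
proof -
  obtain K where K: "compact K" "K \<subseteq> \<Omega>" "\<And>x. x \<notin> K \<Longrightarrow> \<phi> x = 0"
    using Cc_infinity_support[OF assms(1)] by metis
  let ?f = "\<lambda>y. inverse a *\<^sub>R (y - b)"
  have inv: "?f (a *\<^sub>R x + b) = x" "a *\<^sub>R ?f x + b = x" for x using a by auto
  show ?thesis
  proof (rule Cc_infinityI[of _ "?f ` K"])
    show "compact (?f ` K)" by (intro compact_continuous_image K continuous_intros)
    show "?f ` K \<subseteq> \<Omega>'" using K(2) \<Omega> inv by fastforce
    show "\<phi> (a *\<^sub>R x + b) = 0" if "x \<notin> ?f ` K" for x
      using that K(3) inv by (metis image_eqI)
    show "C_k k (\<lambda>x. \<phi> (a *\<^sub>R x + b))" for k
      by (intro C_k_affine Cc_infinityD[OF assms(1)])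
  qed
qed

lemma grad_cmult: "\<phi> \<in> Cc_infinity \<Omega> \<Longrightarrow> grad (\<lambda>x. c * \<phi> x) x = c *\<^sub>R grad \<phi> x"
  by (rule grad_eqI) (auto intro!: derivative_eq_intros Cc_infinityD(3))

lemma grad_affine:
  assumes "\<phi> \<in> Cc_infinity \<Omega>"
  shows "grad (\<lambda>x. \<phi> (a *\<^sub>R x + b)) x = a *\<^sub>R grad \<phi> (a *\<^sub>R x + b)"
proof (rule grad_eqI)
  have "((\<lambda>x. a *\<^sub>R x + b) has_derivative (\<lambda>v. a *\<^sub>R v)) (at x)"
    by (auto intro!: derivative_eq_intros)
  from has_derivative_compose[OF this Cc_infinityD(3)[OF assms]]
  show "((\<lambda>x. \<phi> (a *\<^sub>R x + b)) has_derivative (\<lambda>v. (a *\<^sub>R grad \<phi> (a *\<^sub>R x + b)) \<bullet> v)) (at x)"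
    by simp
qed

lemma integrable_compact_support:
  fixes f :: "'a::euclidean_space \<Rightarrow> 'b::euclidean_space"
  assumes "continuous_on UNIV f" "compact K" "\<And>x. x \<notin> K \<Longrightarrow> f x = 0"
  shows "integrable lborel f"
proof -
  have "integrable lborel (\<lambda>x. indicator K x *\<^sub>R f x)"
    using assms(1,2) by (intro borel_integrable_compact) (auto intro: continuous_on_subset)
  moreover have "(\<lambda>x. indicator K x *\<^sub>R f x) = f"
    using assms(3) by (auto simp: indicator_def)
  ultimately show ?thesis by simp
qed

lemma Cc_integrable:
  assumes "\<phi> \<in> Cc_infinity \<Omega>" "0 < p"
  shows "integrable lborel (\<lambda>x. \<bar>\<phi> x\<bar> powr p)" "integrable lborel (\<lambda>x. norm (grad \<phi> x) powr p)"
    "integrable lborel \<phi>"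
proof -
  obtain K where K: "compact K" "\<And>x. x \<notin> K \<Longrightarrow> \<phi> x = 0" "\<And>x. x \<notin> K \<Longrightarrow> grad \<phi> x = 0"
    using Cc_infinity_support[OF assms(1)] by metis
  show "integrable lborel (\<lambda>x. \<bar>\<phi> x\<bar> powr p)"
    using assms K Cc_infinityD[OF assms(1)]
    by (intro integrable_compact_support[OF _ K(1)] continuous_on_powr') (auto intro!: continuous_intros)
  show "integrable lborel (\<lambda>x. norm (grad \<phi> x) powr p)"
    using assms K Cc_infinityD[OF assms(1)]
    by (intro integrable_compact_support[OF _ K(1)] continuous_on_powr') (auto intro!: continuous_intros)
  show "integrable lborel \<phi>"
    using K Cc_infinityD[OF assms(1)] by (intro integrable_compact_support[OF _ K(1)]) auto
qed

lemma set_integral_lborel: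
  fixes f :: "'a::euclidean_space \<Rightarrow> real"
  assumes "f \<in> borel_measurable borel" "\<And>x. x \<notin> \<Omega> \<Longrightarrow> f x = 0"
  shows "(LINT x:\<Omega>|lebesgue. f x) = (LINT x|lborel. f x)"
proof -
  have "(\<lambda>x. indicator \<Omega> x *\<^sub>R f x) = f" using assms(2) by (auto simp: fun_eq_iff split: split_indicator)
  then show ?thesis using assms(1) by (simp add: set_lebesgue_integral_def integral_completion)
qed

lemma Cc_set_integrals:
  assumes "\<phi> \<in> Cc_infinity \<Omega>" "0 < p"
  shows "(LINT x:\<Omega>|lebesgue. \<bar>\<phi> x\<bar> powr p) = Lp_mass p \<phi>"
    "(LINT x:\<Omega>|lebesgue. \<bar>\<phi> x\<bar>) = Lp_mass 1 \<phi>"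
    "(LINT x:\<Omega>|lebesgue. norm (grad \<phi> x) powr p) = Dir p \<phi>"
proof -
  obtain K where K: "K \<subseteq> \<Omega>" "\<And>x. x \<notin> K \<Longrightarrow> \<phi> x = 0" "\<And>x. x \<notin> K \<Longrightarrow> grad \<phi> x = 0"
    using Cc_infinity_support[OF assms(1)] by metis
  then have z: "\<phi> x = 0" "grad \<phi> x = 0" if "x \<notin> \<Omega>" for x using that by auto
  have [measurable]: "\<phi> \<in> borel_measurable borel" "grad \<phi> \<in> borel_measurable borel"
    using Cc_infinityD[OF assms(1)] by (auto intro: borel_measurable_continuous_onI)
  show "(LINT x:\<Omega>|lebesgue. \<bar>\<phi> x\<bar> powr p) = Lp_mass p \<phi>"
    "(LINT x:\<Omega>|lebesgue. \<bar>\<phi> x\<bar>) = Lp_mass 1 \<phi>"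
    "(LINT x:\<Omega>|lebesgue. norm (grad \<phi> x) powr p) = Dir p \<phi>"
    unfolding Lp_mass_def Dir_def using z assms(2)
    by (subst set_integral_lborel; auto)+
qed

text \<open>Handles error bounds whose constant \<open>C\<close> may blow up as \<epsilon> shrinks:
  \<epsilon> is fixed first, then \<open>n\<close> is taken large.\<close>

lemma tendsto_by_modulus:
  fixes A D :: "nat \<Rightarrow> real"
  assumes "D \<longlonglongrightarrow> 0" "0 \<le> K"
    "\<And>\<epsilon>. 0 < \<epsilon> \<Longrightarrow> \<exists>C\<ge>0. \<forall>n. \<bar>A n - a\<bar> \<le> \<epsilon> * K + C * D n"
  shows "A \<longlonglongrightarrow> a"
proof (rule LIMSEQ_I)
  fix r :: real assume "0 < r"
  \<comment> \<open>\<open>K + 1\<close> in place of \<open>K\<close> also covers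
    \<open>K = 0\<close>.\<close>
  define \<epsilon> where "\<epsilon> = r / (2 * (K + 1))"
  have "\<epsilon> * (K + 1) = r / 2" using \<open>0 \<le> K\<close> by (simp add: \<epsilon>_def field_simps)
  moreover have e0: "0 < \<epsilon>" using \<open>0 < r\<close> \<open>0 \<le> K\<close> by (simp add: \<epsilon>_def)
  ultimately have e: "0 < \<epsilon>" "\<epsilon> * K < r / 2 + r / 4" using \<open>0 < r\<close> by (simp_all add: algebra_simps)
  obtain C where C: "C \<ge> 0" "\<And>n. \<bar>A n - a\<bar> \<le> \<epsilon> * K + C * D n" using assms(3)[OF e(1)] by blast
  have "(\<lambda>n. C * D n) \<longlonglongrightarrow> C * 0" by (intro tendsto_intros assms)
  then have "\<forall>\<^sub>F n in sequentially. C * D n < r / 4"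
    using \<open>0 < r\<close> by (intro order_tendstoD(2)) auto
  then show "\<exists>no. \<forall>n\<ge>no. norm (A n - a) < r"
    unfolding eventually_sequentially
  proof (elim exE, intro exI allI impI)
    fix N n assume "\<forall>n\<ge>N. C * D n < r / 4" "N \<le> n"
    then have "C * D n < r / 4" by blast
    then show "norm (A n - a) < r" using C(2)[of n] e(2) by simp
  qed
qed

text \<open>Either \<delta> is at most a small multiple of b, and (b + \<delta>)^p is close to b^p,
  or b is dominated by \<delta>. The estimate is pointwise, so convergence of integrals of p-th
  powers follows by integrating it.\<close>

lemma powr_modulus:
  fixes p \<epsilon> :: real
  assumes "1 \<le> p" "0 < \<epsilon>"
  obtains C where "0 \<le> C"
    "\<And>a b \<delta>. 0 \<le> a \<Longrightarrow> 0 \<le> b \<Longrightarrow> 0 \<le> \<delta> \<Longrightarrow> a \<le> b + \<delta> \<Longrightarrow> a powr p \<le> (1 + \<epsilon>) * b powr p + C * \<delta> powr p"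
proof -
  \<comment> \<open>The relative error with (1 + \<eta>)^p = 1 + \<epsilon>, the loss allowed in the
    first case.\<close>
  define \<eta> where "\<eta> = (1 + \<epsilon>) powr (1 / p) - 1"
  have "1 powr (1 / p) < (1 + \<epsilon>) powr (1 / p)" using assms by (intro powr_less_mono2) auto
  then have \<eta>: "0 < \<eta>" "(1 + \<eta>) powr p = 1 + \<epsilon>" using assms by (auto simp: \<eta>_def powr_powr)
  show thesis
  proof
    show "0 \<le> (1 / \<eta> + 1) powr p" by simp
    fix a b \<delta> :: real assume *: "0 \<le> a" "0 \<le> b" "0 \<le> \<delta>" "a \<le> b + \<delta>"
    show "a powr p \<le> (1 + \<epsilon>) * b powr p + (1 / \<eta> + 1) powr p * \<delta> powr p"
    proof (cases "\<delta> \<le> \<eta> * b")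
      case True
      then have "a \<le> (1 + \<eta>) * b" using * by (simp add: algebra_simps)
      then have "a powr p \<le> ((1 + \<eta>) * b) powr p" using * assms by (intro powr_mono2) auto
      also have "\<dots> = (1 + \<epsilon>) * b powr p" using * \<eta> by (simp add: powr_mult)
      finally show ?thesis by (smt (verit) mult_nonneg_nonneg powr_ge_zero)
    next
      case False
      then have "b \<le> \<delta> / \<eta>" using \<eta> by (simp add: field_simps)
      then have "a \<le> (1 / \<eta> + 1) * \<delta>" using * by (simp add: algebra_simps)
      then have "a powr p \<le> ((1 / \<eta> + 1) * \<delta>) powr p" using * assms by (intro powr_mono2) auto
      also have "\<dots> = (1 / \<eta> + 1) powr p * \<delta> powr p" using * \<eta> by (simp add: powr_mult)
      finally show ?thesis using assms by (smt (verit) mult_nonneg_nonneg powr_ge_zero)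
    qed
  qed
qed

lemma integrable_powr_diff:
  fixes f g :: "'x \<Rightarrow> 'b::euclidean_space"
  assumes p: "1 \<le> p" and [measurable]: "f \<in> borel_measurable M" "g \<in> borel_measurable M"
    and int: "integrable M (\<lambda>x. norm (f x) powr p)" "integrable M (\<lambda>x. norm (g x) powr p)"
  shows "integrable M (\<lambda>x. norm (f x - g x) powr p)"
proof -
  obtain C where C: "0 \<le> C" "\<And>a b \<delta>. 0 \<le> a \<Longrightarrow> 0 \<le> b \<Longrightarrow> 0 \<le> \<delta> \<Longrightarrow> a \<le> b + \<delta> \<Longrightarrow>
      a powr p \<le> (1 + 1) * b powr p + C * \<delta> powr p"
    using powr_modulus[OF p, of 1] by auto
  have "integrable M (\<lambda>x. (1 + 1) * norm (f x) powr p + C * norm (g x) powr p)"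
    by (intro Bochner_Integration.integrable_add integrable_mult_right int)
  then show ?thesis
  proof (rule Bochner_Integration.integrable_bound)
    show "AE x in M. norm (norm (f x - g x) powr p) \<le> norm ((1 + 1) * norm (f x) powr p + C * norm (g x) powr p)"
    proof (rule AE_I2)
      fix x
      have "norm (f x - g x) powr p \<le> (1 + 1) * norm (f x) powr p + C * norm (g x) powr p"
        by (intro C(2) norm_triangle_ineq4) auto
      then show "norm (norm (f x - g x) powr p) \<le> norm ((1 + 1) * norm (f x) powr p + C * norm (g x) powr p)"
        by simp
    qed
  qed simp
qed

lemma Lp_norm_convergence:
  fixes f :: "nat \<Rightarrow> 'x \<Rightarrow> 'b::euclidean_space"
  assumes p: "1 \<le> p"
    and [measurable]: "\<And>n. f n \<in> borel_measurable M" "g \<in> borel_measurable M"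
    and int: "\<And>n. integrable M (\<lambda>x. norm (f n x) powr p)" "integrable M (\<lambda>x. norm (g x) powr p)"
    and lim: "(\<lambda>n. LINT x|M. norm (f n x - g x) powr p) \<longlonglongrightarrow> 0"
  shows "(\<lambda>n. LINT x|M. norm (f n x) powr p) \<longlonglongrightarrow> (LINT x|M. norm (g x) powr p)"
proof (rule tendsto_by_modulus[OF lim])
  show "0 \<le> (LINT x|M. norm (g x) powr p)" by simp
  fix \<epsilon> :: real assume e: "0 < \<epsilon>"
  obtain C where C: "0 \<le> C" "\<And>a b \<delta>. 0 \<le> a \<Longrightarrow> 0 \<le> b \<Longrightarrow> 0 \<le> \<delta> \<Longrightarrow> a \<le> b + \<delta> \<Longrightarrow>
      a powr p \<le> (1 + \<epsilon>) * b powr p + C * \<delta> powr p"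
    using powr_modulus[OF p e] by auto
  note dint = integrable_powr_diff[OF p _ _ int]
  have "\<bar>(LINT x|M. norm (f n x) powr p) - (LINT x|M. norm (g x) powr p)\<bar>
      \<le> \<epsilon> * (LINT x|M. norm (g x) powr p) + C * (LINT x|M. norm (f n x - g x) powr p)" for n
  proof -
    let ?A = "LINT x|M. norm (f n x) powr p" and ?B = "LINT x|M. norm (g x) powr p"
      and ?D = "LINT x|M. norm (f n x - g x) powr p"
    have "?A \<le> (LINT x|M. (1 + \<epsilon>) * norm (g x) powr p + C * norm (f n x - g x) powr p)"
      by (intro integral_mono Bochner_Integration.integrable_add integrable_mult_right int dint C(2))
        (auto intro: norm_triangle_sub)
    also have "\<dots> = (1 + \<epsilon>) * ?B + C * ?D"
      using int dint by simp
    finally have 1: "?A \<le> (1 + \<epsilon>) * ?B + C * ?D" .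
    have "?B \<le> (LINT x|M. (1 + \<epsilon>) * norm (f n x) powr p + C * norm (f n x - g x) powr p)"
      by (intro integral_mono Bochner_Integration.integrable_add integrable_mult_right int dint C(2))
        (auto simp: norm_minus_commute intro: norm_triangle_sub)
    also have "\<dots> = (1 + \<epsilon>) * ?A + C * ?D"
      using int dint by simp
    finally have 2: "?B \<le> (1 + \<epsilon>) * ?A + C * ?D" .
    have nn: "0 \<le> ?A" "0 \<le> ?B" "0 \<le> C * ?D" using C(1) by auto
    \<comment> \<open>Inequality 2 has \<open>?A\<close> in its error term. If
      \<open>?A \<le> ?B\<close>, it may be replaced by \<open>?B\<close>; otherwise the left side
      is negative.\<close>
    have "?B - ?A \<le> \<epsilon> * ?B + C * ?D"
    proof (cases "?A \<le> ?B")
      case True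
      then have "\<epsilon> * ?A \<le> \<epsilon> * ?B" using e by simp
      then show ?thesis using 2 by (simp add: algebra_simps)
    next
      case False
      then show ?thesis using nn e by (smt (verit) mult_nonneg_nonneg)
    qed
    then show ?thesis using 1 by (simp add: algebra_simps abs_if)
  qed
  then show "\<exists>C\<ge>0. \<forall>n. \<bar>(LINT x|M. norm (f n x) powr p) - (LINT x|M. norm (g x) powr p)\<bar>
      \<le> \<epsilon> * (LINT x|M. norm (g x) powr p) + C * (LINT x|M. norm (f n x - g x) powr p)"
    using C(1) by blast
qed

subsection \<open>The Poincare inequality in a slab\<close>

text \<open>Translation invariance makes the integral of every difference quotient vanish; dominated
  convergence passes to the derivative.\<close>

lemma integral_derivative_compact_support:
  fixes \<psi> :: "'a::euclidean_space \<Rightarrow> real"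
  assumes der: "\<And>x. (\<psi> has_derivative D x) (at x)" and cont: "continuous_on UNIV (\<lambda>x. D x e)"
    and K: "compact K" "\<And>x. x \<notin> K \<Longrightarrow> \<psi> x = 0" "\<And>x. x \<notin> K \<Longrightarrow> D x e = 0" and e: "norm e = 1"
  shows "(LINT x|lborel. D x e) = 0"
proof -
  obtain r where r: "K \<subseteq> ball 0 r" using K(1) compact_imp_bounded bounded_subset_ballD by blast
  have cpsi: "continuous_on UNIV \<psi>"
    using der by (intro continuous_at_imp_continuous_on) (auto intro: has_derivative_continuous)
  note [measurable] = borel_measurable_continuous_onI[OF cpsi] borel_measurable_continuous_onI[OF cont]
  have intpsi: "integrable lborel \<psi>" using integrable_compact_support[OF cpsi K(1,2)] .
  have "bounded ((\<lambda>x. D x e) ` K)"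
    using K(1) cont by (intro compact_imp_bounded compact_continuous_image) (auto intro: continuous_on_subset)
  then obtain M where "\<forall>y\<in>(\<lambda>x. D x e) ` K. norm y \<le> M" using bounded_iff by blast
  then have M: "\<bar>D x e\<bar> \<le> \<bar>M\<bar>" for x using K(3)[of x] by (cases "x \<in> K") force+
  let ?q = "\<lambda>(n::nat) x. (\<psi> (inverse (real (Suc n)) *\<^sub>R e + x) - \<psi> x) / inverse (real (Suc n))"
  have line: "((\<lambda>t. \<psi> (t *\<^sub>R e + x)) has_real_derivative D (t *\<^sub>R e + x) e) (at t)" for t x
  proof -
    have "((\<lambda>t. t *\<^sub>R e + x) has_derivative (\<lambda>v. v *\<^sub>R e)) (at t)"
      by (auto intro!: derivative_eq_intros)
    from has_derivative_compose[OF this der]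
    have "((\<lambda>t. \<psi> (t *\<^sub>R e + x)) has_derivative (\<lambda>v. D (t *\<^sub>R e + x) (v *\<^sub>R e))) (at t)" .
    moreover have "D (t *\<^sub>R e + x) (v *\<^sub>R e) = D (t *\<^sub>R e + x) e * v" for v
      using linear_cmul[OF has_derivative_linear[OF der]] by simp
    ultimately show ?thesis by (simp add: has_field_derivative_def)
  qed
  \<comment> \<open>By the mean value theorem the quotients inherit the bound on the derivative. The
    steps have length at most 1, so all quotients vanish outside the ball of radius
    \<open>r + 1\<close>.\<close>
  have bound: "\<bar>?q n x\<bar> \<le> \<bar>M\<bar> * indicator (cball 0 (r + 1)) x" for n x
  proof (cases "x \<in> cball 0 (r + 1)")
    case True
    let ?h = "inverse (real (Suc n))"
    have "\<exists>z>0. z < ?h \<and> \<psi> (?h *\<^sub>R e + x) - \<psi> (0 *\<^sub>R e + x) = (?h - 0) * D (z *\<^sub>R e + x) e"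
      by (intro MVT2 line) simp
    then obtain z where "\<psi> (?h *\<^sub>R e + x) - \<psi> x = ?h * D (z *\<^sub>R e + x) e" by auto
    then have "?q n x = D (z *\<^sub>R e + x) e" by simp
    then show ?thesis using True M[of "z *\<^sub>R e + x"] by simp
  next
    case False
    have "norm (inverse (real (Suc n)) *\<^sub>R e) \<le> 1" using e by (simp add: field_simps)
    then have "r \<le> norm (inverse (real (Suc n)) *\<^sub>R e + x)"
      using False norm_triangle_ineq2[of x "- (inverse (real (Suc n)) *\<^sub>R e)"] by (simp add: add.commute)
    then have "inverse (real (Suc n)) *\<^sub>R e + x \<notin> K" "x \<notin> K" using r False by auto
    then show ?thesis using K(2) by simp
  qed
  have "(\<lambda>n. LINT x|lborel. ?q n x) \<longlonglongrightarrow> (LINT x|lborel. D x e)"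
  proof (rule integral_dominated_convergence[where w="\<lambda>x. \<bar>M\<bar> * indicator (cball 0 (r + 1)) x"])
    show "integrable lborel (\<lambda>x. \<bar>M\<bar> * indicator (cball 0 (r + 1)) (x::'a))"
      using emeasure_bounded_finite[OF bounded_cball, of "0::'a" "r + 1"]
      by (intro integrable_mult_right integrable_real_indicator) auto
    show "AE x in lborel. (\<lambda>n. ?q n x) \<longlonglongrightarrow> D x e"
    proof (rule AE_I2)
      fix x
      have "((\<lambda>h. (\<psi> ((0 + h) *\<^sub>R e + x) - \<psi> (0 *\<^sub>R e + x)) / h) \<longlongrightarrow> D (0 *\<^sub>R e + x) e) (at 0)"
        using line[of x 0] unfolding DERIV_def .
      moreover have "filterlim (\<lambda>n. inverse (real (Suc n))) (at 0) sequentially"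
        using LIMSEQ_inverse_real_of_nat by (auto simp: filterlim_at)
      ultimately have "((\<lambda>n. (\<psi> ((0 + inverse (real (Suc n))) *\<^sub>R e + x) - \<psi> (0 *\<^sub>R e + x)) / inverse (real (Suc n))) \<longlongrightarrow> D (0 *\<^sub>R e + x) e) sequentially"
        by (rule filterlim_compose)
      then show "(\<lambda>n. ?q n x) \<longlonglongrightarrow> D x e" by (simp del: of_nat_Suc)
    qed
  qed (use bound in \<open>auto simp del: of_nat_Suc\<close>)
  moreover have "(LINT x|lborel. ?q n x) = 0" for n
  proof -
    have t: "distr lborel borel (\<lambda>x. a + x) = lborel" for a :: 'a
      using lborel_distr_plus[of a] by simp
    let ?a = "inverse (real (Suc n)) *\<^sub>R e"
    have "integrable (distr lborel borel (\<lambda>x. ?a + x)) \<psi>" unfolding t by (rule intpsi)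
    then have i: "integrable lborel (\<lambda>x. \<psi> (?a + x))" by (subst (asm) integrable_distr_eq) auto
    have "(LINT x|lborel. \<psi> x) = (LINT x|distr lborel borel (\<lambda>x. ?a + x). \<psi> x)" unfolding t ..
    also have "\<dots> = (LINT x|lborel. \<psi> (?a + x))" by (subst integral_distr) auto
    finally show ?thesis using i intpsi by simp
  qed
  ultimately show ?thesis by (simp add: LIMSEQ_const_iff del: of_nat_Suc)
qed

lemma DERIV_abs_powr:
  fixes p :: real
  assumes "1 < p"
  shows "((\<lambda>t::real. \<bar>t\<bar> powr p) has_real_derivative p * \<bar>t\<bar> powr (p - 1) * sgn t) (at t)"
proof -
  consider "t > 0" | "t < 0" | "t = 0" by linarith
  then show ?thesis
  proof cases
    case 1
    have "((\<lambda>t. t powr p) has_real_derivative p * \<bar>t\<bar> powr (p - 1) * sgn t) (at t)"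
      using 1 by (auto intro!: derivative_eq_intros simp: powr_diff field_simps)
    then show ?thesis
      by (rule DERIV_cong_ev[THEN iffD1, rotated 3])
         (use 1 in \<open>auto intro!: eventually_mono[OF eventually_nhds_in_open[of "{0<..}" t]]\<close>)
  next
    case 2
    have "((\<lambda>t. (- t) powr p) has_real_derivative p * \<bar>t\<bar> powr (p - 1) * sgn t) (at t)"
      using 2 by (auto intro!: derivative_eq_intros simp: powr_diff field_simps)
    then show ?thesis
      by (rule DERIV_cong_ev[THEN iffD1, rotated 3])
         (use 2 in \<open>auto intro!: eventually_mono[OF eventually_nhds_in_open[of "{..<0}" t]]\<close>)
  next
    case 3
    have "((\<lambda>h::real. \<bar>h\<bar> powr (p - 1)) \<longlongrightarrow> 0) (at 0)"
      using assms by (auto intro!: tendsto_eq_intros tendsto_zero_powrI)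
    then have "((\<lambda>h::real. \<bar>h\<bar> powr p / h) \<longlongrightarrow> 0) (at 0)"
      by (rule Lim_null_comparison[rotated])
        (auto simp: powr_diff intro!: eventually_mono[OF eventually_at_ball[of 1]])
    then show ?thesis using 3 by (simp add: DERIV_def)
  qed
qed

text \<open>Integrate the derivative of \<open>((x - x0) \<bullet> e) |\<phi>|\<^sup>p\<close> in the direction \<open>e\<close>.\<close>

lemma Poincare_slab:
  fixes \<phi> :: "'a::euclidean_space \<Rightarrow> real"
  assumes \<phi>: "\<phi> \<in> Cc_infinity \<Omega>" and p: "1 < p" and e: "norm e = 1"
    and L: "\<And>x. x \<in> \<Omega> \<Longrightarrow> \<bar>(x - x0) \<bullet> e\<bar> \<le> L"
  shows "Lp_mass p \<phi> \<le> (2 * p * L) powr p * Dir p \<phi>"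
proof -
  obtain K where K: "compact K" "K \<subseteq> \<Omega>" "\<And>x. x \<notin> K \<Longrightarrow> \<phi> x = 0" "\<And>x. x \<notin> K \<Longrightarrow> grad \<phi> x = 0"
    using Cc_infinity_support[OF \<phi>] by metis
  note C = Cc_infinityD(2-4)[OF \<phi>]
  note I = Cc_integrable(1,2)[OF \<phi>, of p]
  let ?D = "\<lambda>x v. (v \<bullet> e) * \<bar>\<phi> x\<bar> powr p
      + ((x - x0) \<bullet> e) * (p * \<bar>\<phi> x\<bar> powr (p - 1) * sgn (\<phi> x) * (grad \<phi> x \<bullet> v))"
  have der: "((\<lambda>x. ((x - x0) \<bullet> e) * \<bar>\<phi> x\<bar> powr p) has_derivative ?D x) (at x)" for x
  proof -
    have 1: "((\<lambda>x. \<bar>\<phi> x\<bar> powr p) has_derivative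
        (\<lambda>v. p * \<bar>\<phi> x\<bar> powr (p - 1) * sgn (\<phi> x) * (grad \<phi> x \<bullet> v))) (at x)"
      using has_derivative_compose[OF C(2) DERIV_abs_powr[OF p, unfolded has_field_derivative_def]]
      by simp
    have 2: "((\<lambda>x. (x - x0) \<bullet> e) has_derivative (\<lambda>v. v \<bullet> e)) (at x)"
      by (auto intro!: derivative_eq_intros)
    from has_derivative_mult[OF 2 1] show ?thesis by (simp add: add.commute)
  qed

  have csgn: "continuous_on UNIV (\<lambda>t::real. p * \<bar>t\<bar> powr (p - 1) * sgn t)"
  proof (rule continuous_at_imp_continuous_on, rule ballI)
    fix t :: real
    show "isCont (\<lambda>t::real. p * \<bar>t\<bar> powr (p - 1) * sgn t) t"
    proof (cases "t = 0")
      case True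
      have "((\<lambda>h::real. p * \<bar>h\<bar> powr (p - 1)) \<longlongrightarrow> 0) (at 0)"
        using p by (auto intro!: tendsto_eq_intros tendsto_zero_powrI)
      then have "((\<lambda>h::real. p * \<bar>h\<bar> powr (p - 1) * sgn h) \<longlongrightarrow> 0) (at 0)"
        by (rule Lim_null_comparison[rotated])
          (use p in \<open>auto simp: abs_mult sgn_real_def intro!: eventually_mono[OF eventually_at_ball[of 1]]\<close>)
      then show ?thesis using True by (simp add: isCont_def)
    qed (auto intro!: continuous_intros isCont_sgn)
  qed
  have cD: "continuous_on UNIV (\<lambda>x. ?D x e)"
    using C p by (intro continuous_intros continuous_on_powr' continuous_on_compose2[OF csgn]) auto
  have zero: "(LINT x|lborel. ?D x e) = 0"
    by (rule integral_derivative_compact_support[OF der cD K(1) _ _ e]) (use K p in auto)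
  have ee: "e \<bullet> e = 1" using e by (simp add: norm_eq_1)
  let ?a = "\<lambda>x. \<bar>\<phi> x\<bar>" and ?b = "\<lambda>x. norm (grad \<phi> x)"
  \<comment> \<open>Young's inequality with explicit constants: whichever of a and 2 p L b is larger
    bounds the product. The factor 1/2 in front of a^p allows this term to be absorbed
    later.\<close>
  have young: "p * L * (a powr (p - 1) * b) \<le> a powr p / 2 + (2 * p * L) powr p * b powr p / 2"
    if "0 \<le> a" "0 \<le> b" "0 \<le> L" for a b :: real
  proof (cases "2 * p * L * b \<le> a")
    case True
    have "p * L * (a powr (p - 1) * b) = (2 * p * L * b) * a powr (p - 1) / 2" by simp
    also have "\<dots> \<le> a * a powr (p - 1) / 2" using True by (intro divide_right_mono mult_right_mono) auto
    also have "a * a powr (p - 1) = a powr p" using that by (cases "a = 0") (auto simp: powr_diff)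
    finally show ?thesis by (smt (verit) divide_nonneg_nonneg mult_nonneg_nonneg powr_ge_zero)
  next
    case False
    let ?c = "2 * p * L * b"
    have c: "0 \<le> ?c" using that p by simp
    have "p * L * (a powr (p - 1) * b) = ?c * a powr (p - 1) / 2" by simp
    also have "\<dots> \<le> ?c * ?c powr (p - 1) / 2"
      using False that p c by (intro divide_right_mono mult_left_mono powr_mono2) auto
    also have "?c * ?c powr (p - 1) = ?c powr p" using c by (cases "?c = 0") (auto simp: powr_diff)
    also have "?c powr p = (2 * p * L) powr p * b powr p" using that p by (simp add: powr_mult)
    finally show ?thesis by (smt (verit) divide_nonneg_nonneg mult_nonneg_nonneg powr_ge_zero)
  qed
  have pw: "?a x powr p - ?D x e \<le> ?a x powr p / 2 + (2 * p * L) powr p * ?b x powr p / 2" for x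
  proof (cases "x \<in> K")
    case True
    then have L': "\<bar>(x - x0) \<bullet> e\<bar> \<le> L" using K(2) L by blast
    have "?a x powr p - ?D x e = - (((x - x0) \<bullet> e) * (p * ?a x powr (p - 1) * sgn (\<phi> x) * (grad \<phi> x \<bullet> e)))"
      using ee by simp
    also have "\<dots> \<le> \<bar>((x - x0) \<bullet> e) * (p * ?a x powr (p - 1) * sgn (\<phi> x) * (grad \<phi> x \<bullet> e))\<bar>" by simp
    also have "\<dots> = \<bar>(x - x0) \<bullet> e\<bar> * (p * ?a x powr (p - 1) * \<bar>sgn (\<phi> x)\<bar> * \<bar>grad \<phi> x \<bullet> e\<bar>)"
      using p by (simp add: abs_mult)
    also have "\<dots> \<le> L * (p * ?a x powr (p - 1) * 1 * ?b x)"
      using p L' e Cauchy_Schwarz_ineq2[of "grad \<phi> x" e]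
      by (intro mult_mono mult_nonneg_nonneg) (auto simp: sgn_real_def)
    also have "\<dots> = p * L * (?a x powr (p - 1) * ?b x)" by simp
    also have "\<dots> \<le> ?a x powr p / 2 + (2 * p * L) powr p * ?b x powr p / 2"
      using L' by (intro young) auto
    finally show ?thesis .
  next
    case False
    then show ?thesis using K by simp
  qed
  have Dint: "integrable lborel (\<lambda>x. ?D x e)"
    by (rule integrable_compact_support[OF cD K(1)]) (use K p in auto)
  \<comment> \<open>As e is a unit vector, the first term of \<open>?D x e\<close> is |\<phi>|^p
    itself. Subtracting the vanishing integral leaves only the gradient term, and half of the mass
    is then absorbed on the left.\<close>
  have "Lp_mass p \<phi> = (LINT x|lborel. ?a x powr p - ?D x e)"
    using zero I(1) p Dint by (simp add: Lp_mass_def)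
  also have "\<dots> \<le> (LINT x|lborel. ?a x powr p / 2 + (2 * p * L) powr p * ?b x powr p / 2)"
    using I p Dint pw by (intro integral_mono) auto
  also have "\<dots> = Lp_mass p \<phi> / 2 + (2 * p * L) powr p * Dir p \<phi> / 2"
    using I p by (simp add: Lp_mass_def Dir_def)
  finally show ?thesis by simp
qed

subsection \<open>Approximation of Sobolev functions by test functions\<close>

lemma convex_domainsD:
  assumes "\<Omega> \<in> convex_domains"
  shows "\<Omega> \<noteq> {}" "open \<Omega>" "convex \<Omega>" "bounded \<Omega>" "\<Omega> \<in> lmeasurable" "0 < measure lebesgue \<Omega>"
    "emeasure lborel \<Omega> < \<infinity>" "measure lebesgue \<Omega> = measure lborel \<Omega>"
proof -
  show *: "\<Omega> \<noteq> {}" "open \<Omega>" "convex \<Omega>" "bounded \<Omega>" using assms by (auto simp: convex_domains_def)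
  show "\<Omega> \<in> lmeasurable" using * lmeasurable_open by blast
  show "emeasure lborel \<Omega> < \<infinity>" using * emeasure_bounded_finite by blast
  show "measure lebesgue \<Omega> = measure lborel \<Omega>" using * by simp
  show "0 < measure lebesgue \<Omega>"
    using * \<open>\<Omega> \<in> lmeasurable\<close> open_not_negligible
    by (metis less_eq_real_def measure_nonneg negligible_iff_measure0)
qed

text \<open>The standard mollifier profile exp(-1/(1 - |x|^2)), extended by 0; squaring the norm
  keeps it smooth at the origin.\<close>

definition bump :: "'a::euclidean_space \<Rightarrow> real" where
  "bump x = flat_exp 0 (1 - (norm x)\<^sup>2)"

lemma bump_nonneg: "0 \<le> bump x"
  and bump_pos: "norm x < 1 \<Longrightarrow> 0 < bump x"
  using abs_square_less_1[of "norm x"] by (auto simp: bump_def flat_exp_def)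

lemma bump_Cc:
  assumes "cball 0 1 \<subseteq> \<Omega>"
  shows "bump \<in> Cc_infinity \<Omega>"
proof (rule Cc_infinityI[OF _ compact_cball assms])
  show "C_k k bump" for k
    unfolding bump_def by (intro C_k_compose[OF C_k_flat_exp] C_k_diff C_k_const C_k_norm_square)
  show "bump x = 0" if "x \<notin> cball 0 1" for x :: 'a
  proof -
    have "1 < (norm x)\<^sup>2" using that by (simp add: one_less_power)
    then show ?thesis by (simp add: bump_def flat_exp_def)
  qed
qed

lemma continuous_AE_zero:
  fixes f :: "'a::euclidean_space \<Rightarrow> real"
  assumes "continuous_on UNIV f" "AE x in lebesgue. f x = 0"
  shows "f x = 0"
proof (rule ccontr)
  assume "f x \<noteq> 0"
  have o: "open {x. f x \<noteq> 0}"
    using assms(1) by (simp add: open_Collect_neq)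
  have "negligible {x. f x \<noteq> 0}"
    unfolding negligible_iff_null_sets
  proof (rule AE_iff_null_sets[THEN iffD2])
    show "{x. f x \<noteq> 0} \<in> sets lebesgue" using o by (simp add: borel_open)
    show "AE x in lebesgue. x \<notin> {x. f x \<noteq> 0}" using assms(2) by simp
  qed
  then show False using open_not_negligible[OF o] \<open>f x \<noteq> 0\<close> by blast
qed

lemma Lp_mass_pos:
  assumes "\<phi> \<in> Cc_infinity \<Omega>" "0 < p" "\<phi> x \<noteq> 0"
  shows "0 < Lp_mass p \<phi>"
proof (rule ccontr)
  assume "\<not> ?thesis"
  then have "Lp_mass p \<phi> = 0" using Lp_mass_nonneg[of p \<phi>] by simp
  then have "AE x in lborel. \<bar>\<phi> x\<bar> powr p = 0"
    using integral_nonneg_eq_0_iff_AE[OF Cc_integrable(1)[OF assms(1,2)]] by (simp add: Lp_mass_def)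
  then have "AE x in lebesgue. \<phi> x = 0" using AE_completion by fastforce
  then show False using continuous_AE_zero Cc_infinityD(2)[OF assms(1)] assms(3) by blast
qed

text \<open>Supplies a member of the index sets of \<open>torsion\<close> and
  \<open>eigenvalue\<close>, since \<open>SUP\<close> and \<open>INF\<close> of reals say nothing
  about an empty set.\<close>

lemma exists_Cc_pos:
  fixes \<Omega> :: "'a::euclidean_space set"
  assumes "open \<Omega>" "\<Omega> \<noteq> {}"
  obtains \<phi> x where "\<phi> \<in> Cc_infinity \<Omega>" "\<phi> x \<noteq> 0"
proof -
  obtain x r where r: "0 < r" "cball x r \<subseteq> \<Omega>"
    using assms open_contains_cball by (metis all_not_in_conv)
  let ?\<phi> = "\<lambda>y. bump (inverse r *\<^sub>R y + (- (inverse r *\<^sub>R x)))"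
  have "cball (0::'a) 1 \<subseteq> (\<lambda>y. inverse r *\<^sub>R y + - (inverse r *\<^sub>R x)) ` \<Omega>"
  proof
    fix z :: 'a assume "z \<in> cball 0 1"
    then have "x + r *\<^sub>R z \<in> \<Omega>" using r by (auto simp: dist_norm)
    moreover have "z = inverse r *\<^sub>R (x + r *\<^sub>R z) + - (inverse r *\<^sub>R x)" using r by (simp add: algebra_simps)
    ultimately show "z \<in> (\<lambda>y. inverse r *\<^sub>R y + - (inverse r *\<^sub>R x)) ` \<Omega>" by blast
  qed
  then have "?\<phi> \<in> Cc_infinity \<Omega>"
    using r by (intro Cc_infinity_affine[OF bump_Cc[OF subset_refl]]) auto
  moreover have "?\<phi> x \<noteq> 0" using bump_pos[of "0::'a"] by simp
  ultimately show thesis using that by blast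
qed

text \<open>One sequence of test functions approximates all three integrals in the definitions of
  \<open>torsion\<close> and \<open>eigenvalue\<close>, so inequalities between them pass from test
  functions to \<open>W0\<close>. The L^1 integral converges because \<Omega> has finite
  measure.\<close>

lemma W0_limits:
  fixes \<Omega> :: "'a::euclidean_space set"
  assumes ug: "(u, g) \<in> W0 p \<Omega>" and p: "1 < p" and \<Omega>: "\<Omega> \<in> convex_domains"
  obtains \<phi> :: "nat \<Rightarrow> 'a \<Rightarrow> real" where "\<And>n. \<phi> n \<in> Cc_infinity \<Omega>"
    "(\<lambda>n. Lp_mass p (\<phi> n)) \<longlonglongrightarrow> (LINT x:\<Omega>|lebesgue. \<bar>u x\<bar> powr p)"
    "(\<lambda>n. Lp_mass 1 (\<phi> n)) \<longlonglongrightarrow> (LINT x:\<Omega>|lebesgue. \<bar>u x\<bar>)"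
    "(\<lambda>n. Dir p (\<phi> n)) \<longlonglongrightarrow> (LINT x:\<Omega>|lebesgue. norm (g x) powr p)"
proof -
  obtain \<phi> where \<phi>: "\<And>n::nat. \<phi> n \<in> Cc_infinity \<Omega>"
    and l1: "(\<lambda>n. LINT x:\<Omega>|lebesgue. \<bar>\<phi> n x - u x\<bar> powr p) \<longlonglongrightarrow> 0"
    and l2: "(\<lambda>n. LINT x:\<Omega>|lebesgue. norm (grad (\<phi> n) x - g x) powr p) \<longlonglongrightarrow> 0"
    and Lu: "Lp_on p \<Omega> u" and Lg: "Lp_on p \<Omega> g"
    using ug by (auto simp: W0_def)
  have meas[measurable]: "\<Omega> \<in> sets lebesgue" using convex_domainsD(5)[OF \<Omega>] by auto
  have bm[measurable]: "\<phi> n \<in> borel_measurable lebesgue" "grad (\<phi> n) \<in> borel_measurable lebesgue" for n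
    using Cc_infinityD[OF \<phi>[of n]]
    by (auto intro!: measurable_completion borel_measurable_continuous_onI)
  have [measurable]: "(\<lambda>x. indicator \<Omega> x *\<^sub>R u x) \<in> borel_measurable lebesgue"
    "(\<lambda>x. indicator \<Omega> x *\<^sub>R g x) \<in> borel_measurable lebesgue"
    using Lu Lg by (auto simp: Lp_on_def set_borel_measurable_def)
  have nrm: "norm (indicator \<Omega> x *\<^sub>R w) powr s = indicator \<Omega> x *\<^sub>R (norm w powr s)" for s x and w :: "'b::real_normed_vector"
    by (auto simp: indicator_def)
  have sub: "indicator \<Omega> x *\<^sub>R v - indicator \<Omega> x *\<^sub>R w = indicator \<Omega> x *\<^sub>R (v - w)" for x and v w :: "'b::real_normed_vector"
    by (simp add: scaleR_diff_right)
  have si: "set_integrable lebesgue \<Omega> (\<lambda>x. \<bar>\<phi> n x\<bar> powr s)" "set_integrable lebesgue \<Omega> (\<lambda>x. norm (grad (\<phi> n) x) powr s)"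
    if "0 < s" for n s
  proof -
    have "integrable lebesgue (\<lambda>x. \<bar>\<phi> n x\<bar> powr s)" "integrable lebesgue (\<lambda>x. norm (grad (\<phi> n) x) powr s)"
      using Cc_integrable(1,2)[OF \<phi> that] integrable_completion by blast+
    from this[THEN integrable_mult_indicator[OF meas]]
    show "set_integrable lebesgue \<Omega> (\<lambda>x. \<bar>\<phi> n x\<bar> powr s)" "set_integrable lebesgue \<Omega> (\<lambda>x. norm (grad (\<phi> n) x) powr s)"
      unfolding set_integrable_def .
  qed
  have siu: "set_integrable lebesgue \<Omega> (\<lambda>x. \<bar>u x\<bar> powr p)" "set_integrable lebesgue \<Omega> (\<lambda>x. norm (g x) powr p)"
    using Lu Lg by (auto simp: Lp_on_def)
  have "(\<lambda>n. LINT x|lebesgue. norm (indicator \<Omega> x *\<^sub>R \<phi> n x) powr p)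
      \<longlonglongrightarrow> (LINT x|lebesgue. norm (indicator \<Omega> x *\<^sub>R u x) powr p)"
  proof (rule Lp_norm_convergence)
    show "1 \<le> p" using p by simp
    show "integrable lebesgue (\<lambda>x. norm (indicator \<Omega> x *\<^sub>R \<phi> n x) powr p)" for n
      using si(1)[of p n] p unfolding nrm set_integrable_def by simp
    show "integrable lebesgue (\<lambda>x. norm (indicator \<Omega> x *\<^sub>R u x) powr p)"
      using siu(1) unfolding nrm set_integrable_def by simp
    show "(\<lambda>n. LINT x|lebesgue. norm (indicator \<Omega> x *\<^sub>R \<phi> n x - indicator \<Omega> x *\<^sub>R u x) powr p) \<longlonglongrightarrow> 0"
      using l1 unfolding sub nrm set_lebesgue_integral_def by simp
  qed measurable
  then have 1: "(\<lambda>n. Lp_mass p (\<phi> n)) \<longlonglongrightarrow> (LINT x:\<Omega>|lebesgue. \<bar>u x\<bar> powr p)"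
    using Cc_set_integrals(1)[OF \<phi>] p unfolding nrm set_lebesgue_integral_def by simp
  have "(\<lambda>n. LINT x|lebesgue. norm (indicator \<Omega> x *\<^sub>R grad (\<phi> n) x) powr p)
      \<longlonglongrightarrow> (LINT x|lebesgue. norm (indicator \<Omega> x *\<^sub>R g x) powr p)"
  proof (rule Lp_norm_convergence)
    show "1 \<le> p" using p by simp
    show "integrable lebesgue (\<lambda>x. norm (indicator \<Omega> x *\<^sub>R grad (\<phi> n) x) powr p)" for n
      using si(2)[of p n] p unfolding nrm set_integrable_def by simp
    show "integrable lebesgue (\<lambda>x. norm (indicator \<Omega> x *\<^sub>R g x) powr p)"
      using siu(2) unfolding nrm set_integrable_def by simp
    show "(\<lambda>n. LINT x|lebesgue. norm (indicator \<Omega> x *\<^sub>R grad (\<phi> n) x - indicator \<Omega> x *\<^sub>R g x) powr p) \<longlonglongrightarrow> 0"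
      using l2 unfolding sub nrm set_lebesgue_integral_def by simp
  qed measurable
  then have 2: "(\<lambda>n. Dir p (\<phi> n)) \<longlonglongrightarrow> (LINT x:\<Omega>|lebesgue. norm (g x) powr p)"
    using Cc_set_integrals(3)[OF \<phi>] p unfolding nrm set_lebesgue_integral_def by simp
  \<comment> \<open>Trades L^1 for L^p: values up to \<epsilon> cost at most \<epsilon> times the
    measure of \<Omega>, larger values are controlled by their p-th power.\<close>
  have young: "t \<le> \<epsilon> + \<epsilon> powr (1 - p) * t powr p" if "0 \<le> t" "0 < \<epsilon>" for t \<epsilon> :: real
  proof (cases "t \<le> \<epsilon>")
    case False
    have "1 \<le> (t / \<epsilon>) powr (p - 1)" using False that p by (intro ge_one_powr_ge_zero) auto
    then have "t * 1 \<le> t * (t / \<epsilon>) powr (p - 1)" using that by (intro mult_left_mono) auto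
    also have "\<dots> = \<epsilon> powr (1 - p) * t powr p"
      using False that by (simp add: powr_divide powr_diff field_simps)
    finally show ?thesis using that by simp
  qed (use that in \<open>auto intro: add_increasing2\<close>)
  have ind: "integrable lebesgue (indicator \<Omega> :: 'a \<Rightarrow> real)"
    using convex_domainsD(5)[OF \<Omega>] by (simp add: fmeasurable_def integrable_real_indicator)
  have siu1: "integrable lebesgue (\<lambda>x. norm (indicator \<Omega> x *\<^sub>R u x))"
  proof (rule Bochner_Integration.integrable_bound)
    show "integrable lebesgue (\<lambda>x. indicator \<Omega> x + indicator \<Omega> x *\<^sub>R \<bar>u x\<bar> powr p)"
      using siu(1) ind unfolding set_integrable_def by (intro Bochner_Integration.integrable_add) auto
    show "AE x in lebesgue. norm (norm (indicator \<Omega> x *\<^sub>R u x)) \<le> norm (indicator \<Omega> x + indicator \<Omega> x *\<^sub>R \<bar>u x\<bar> powr p)"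
      using young[of _ 1] by (intro AE_I2) (auto simp: indicator_def)
  qed measurable
  have dint: "integrable lebesgue (\<lambda>x. norm (indicator \<Omega> x *\<^sub>R \<phi> n x - indicator \<Omega> x *\<^sub>R u x) powr p)" for n
  proof (rule integrable_powr_diff)
    show "1 \<le> p" using p by simp
    show "integrable lebesgue (\<lambda>x. norm (indicator \<Omega> x *\<^sub>R \<phi> n x) powr p)"
      using si(1)[of p n] p unfolding nrm set_integrable_def by simp
    show "integrable lebesgue (\<lambda>x. norm (indicator \<Omega> x *\<^sub>R u x) powr p)"
      using siu(1) unfolding nrm set_integrable_def by simp
  qed measurable
  have s1: "integrable lebesgue (\<lambda>x. norm (indicator \<Omega> x *\<^sub>R \<phi> n x))" for n
    using si(1)[of 1 n] unfolding set_integrable_def by (simp add: abs_mult)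
  have l3: "(\<lambda>n. LINT x|lebesgue. norm (indicator \<Omega> x *\<^sub>R \<phi> n x - indicator \<Omega> x *\<^sub>R u x) powr 1) \<longlonglongrightarrow> 0"
  proof (rule tendsto_by_modulus)
    show "(\<lambda>n. LINT x|lebesgue. norm (indicator \<Omega> x *\<^sub>R \<phi> n x - indicator \<Omega> x *\<^sub>R u x) powr p) \<longlonglongrightarrow> 0"
      using l1 unfolding sub nrm set_lebesgue_integral_def by simp
    show "0 \<le> measure lebesgue \<Omega>" by simp
    fix \<epsilon> :: real assume e: "0 < \<epsilon>"
    have "(LINT x|lebesgue. norm (indicator \<Omega> x *\<^sub>R \<phi> n x - indicator \<Omega> x *\<^sub>R u x) powr 1)
        \<le> \<epsilon> * measure lebesgue \<Omega> + \<epsilon> powr (1 - p) * (LINT x|lebesgue. norm (indicator \<Omega> x *\<^sub>R \<phi> n x - indicator \<Omega> x *\<^sub>R u x) powr p)" for n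
    proof -
      have "(LINT x|lebesgue. norm (indicator \<Omega> x *\<^sub>R \<phi> n x - indicator \<Omega> x *\<^sub>R u x) powr 1)
        \<le> (LINT x|lebesgue. \<epsilon> * indicator \<Omega> x + \<epsilon> powr (1 - p) * norm (indicator \<Omega> x *\<^sub>R \<phi> n x - indicator \<Omega> x *\<^sub>R u x) powr p)"
      proof (rule integral_mono)
        show "integrable lebesgue (\<lambda>x. norm (indicator \<Omega> x *\<^sub>R \<phi> n x - indicator \<Omega> x *\<^sub>R u x) powr 1)"
        proof (rule integrable_powr_diff)
          show "integrable lebesgue (\<lambda>x. norm (indicator \<Omega> x *\<^sub>R \<phi> n x) powr 1)"
            using s1 by simp
          show "integrable lebesgue (\<lambda>x. norm (indicator \<Omega> x *\<^sub>R u x) powr 1)"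
            using siu1 by simp
        qed (simp, measurable)
        show "integrable lebesgue (\<lambda>x. \<epsilon> * indicator \<Omega> x + \<epsilon> powr (1 - p) * norm (indicator \<Omega> x *\<^sub>R \<phi> n x - indicator \<Omega> x *\<^sub>R u x) powr p)"
          by (intro Bochner_Integration.integrable_add integrable_mult_right dint ind)
        show "norm (indicator \<Omega> x *\<^sub>R \<phi> n x - indicator \<Omega> x *\<^sub>R u x) powr 1 \<le> \<epsilon> * indicator \<Omega> x + \<epsilon> powr (1 - p) * norm (indicator \<Omega> x *\<^sub>R \<phi> n x - indicator \<Omega> x *\<^sub>R u x) powr p" for x
          using young[OF _ e, of "\<bar>\<phi> n x - u x\<bar>"] by (auto simp: indicator_def)
      qed
      also have "\<dots> = \<epsilon> * measure lebesgue \<Omega> + \<epsilon> powr (1 - p) * (LINT x|lebesgue. norm (indicator \<Omega> x *\<^sub>R \<phi> n x - indicator \<Omega> x *\<^sub>R u x) powr p)"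
        using dint[of n] ind by simp
      finally show ?thesis .
    qed
    then show "\<exists>C\<ge>0. \<forall>n. \<bar>(LINT x|lebesgue. norm (indicator \<Omega> x *\<^sub>R \<phi> n x - indicator \<Omega> x *\<^sub>R u x) powr 1) - 0\<bar>
       \<le> \<epsilon> * measure lebesgue \<Omega> + C * (LINT x|lebesgue. norm (indicator \<Omega> x *\<^sub>R \<phi> n x - indicator \<Omega> x *\<^sub>R u x) powr p)"
      by (intro exI[of _ "\<epsilon> powr (1 - p)"]) simp
  qed
  have "(\<lambda>n. LINT x|lebesgue. norm (indicator \<Omega> x *\<^sub>R \<phi> n x) powr 1)
      \<longlonglongrightarrow> (LINT x|lebesgue. norm (indicator \<Omega> x *\<^sub>R u x) powr 1)"
  proof (rule Lp_norm_convergence[OF _ _ _ _ _ l3])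
    show "integrable lebesgue (\<lambda>x. norm (indicator \<Omega> x *\<^sub>R \<phi> n x) powr 1)" for n
      using s1 by simp
    show "integrable lebesgue (\<lambda>x. norm (indicator \<Omega> x *\<^sub>R u x) powr 1)"
      using siu1 by simp
  qed (simp, measurable)
  then have 3: "(\<lambda>n. Lp_mass 1 (\<phi> n)) \<longlonglongrightarrow> (LINT x:\<Omega>|lebesgue. \<bar>u x\<bar>)"
    using Cc_set_integrals(2)[OF \<phi>, of 1] unfolding set_lebesgue_integral_def by (simp add: abs_mult)
  show thesis using that[OF \<phi> 1 3 2] .
qed

subsection \<open>Torsional rigidity and principal eigenvalue through test functions\<close>

lemma convex_domain_slab:
  fixes \<Omega> :: "'a::euclidean_space set"
  assumes "\<Omega> \<in> convex_domains"
  obtains e :: 'a and L where "norm e = 1" "0 < L" "\<And>x. x \<in> \<Omega> \<Longrightarrow> \<bar>(x - 0) \<bullet> e\<bar> \<le> L"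
proof -
  obtain L where L: "0 < L" "\<And>x. x \<in> \<Omega> \<Longrightarrow> norm x \<le> L"
    using convex_domainsD(4)[OF assms] bounded_pos by metis
  obtain e :: 'a where e: "e \<in> Basis" using nonempty_Basis by blast
  show thesis
    using that[of e L] e L Basis_le_norm[OF e] by (force intro: order_trans)
qed

text \<open>The graph of t^p lies above its tangent at the mean value m of |\<phi>|. This tangent
  inequality is Young's inequality for a and m^(p-1); it is integrated over \<Omega>.\<close>

lemma Lp_mass_Jensen:
  assumes \<phi>: "\<phi> \<in> Cc_infinity \<Omega>" and p: "1 < p" and \<Omega>: "\<Omega> \<in> convex_domains"
  shows "Lp_mass 1 \<phi> powr p \<le> measure lebesgue \<Omega> powr (p - 1) * Lp_mass p \<phi>"
proof -
  let ?V = "measure lebesgue \<Omega>"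
  note \<Omega>D = convex_domainsD[OF \<Omega>]
  define m where "m = Lp_mass 1 \<phi> / ?V"
  have m: "0 \<le> m" "Lp_mass 1 \<phi> = m * ?V" using \<Omega>D(6) by (auto simp: m_def Lp_mass_nonneg)
  obtain K where K: "K \<subseteq> \<Omega>" "\<And>x. x \<notin> K \<Longrightarrow> \<phi> x = 0"
    using Cc_infinity_support[OF \<phi>] by metis
  have ind: "integrable lborel (indicator \<Omega> :: 'a \<Rightarrow> real)"
    using \<Omega>D(2,7) by (intro integrable_real_indicator) auto
  have young: "p * m powr (p - 1) * a \<le> a powr p + (p - 1) * m powr p" if "0 \<le> a" for a
  proof -
    have "1 / p + 1 / (p / (p - 1)) = 1" "1 < p / (p - 1)" using p by (auto simp: field_simps)
    from Youngs_inequality[OF p this(2,1) that, of "m powr (p - 1)"]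
    have "a * m powr (p - 1) \<le> a powr p / p + m powr p * (p - 1) / p"
      using p by (simp add: powr_powr)
    then have "p * (a * m powr (p - 1)) \<le> p * (a powr p / p + m powr p * (p - 1) / p)"
      using p by (intro mult_left_mono) auto
    also have "\<dots> = a powr p + (p - 1) * m powr p" using p by (simp add: field_simps)
    finally show ?thesis by (simp add: mult_ac)
  qed
  have "p * m powr (p - 1) * Lp_mass 1 \<phi> = (LINT x|lborel. p * m powr (p - 1) * \<bar>\<phi> x\<bar>)"
    by (simp add: Lp_mass_def)
  also have "\<dots> \<le> (LINT x|lborel. \<bar>\<phi> x\<bar> powr p + (p - 1) * m powr p * indicator \<Omega> x)"
  proof (rule integral_mono)
    show "integrable lborel (\<lambda>x. p * m powr (p - 1) * \<bar>\<phi> x\<bar>)"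
      using Cc_integrable(3)[OF \<phi>, of 1] by simp
    show "integrable lborel (\<lambda>x. \<bar>\<phi> x\<bar> powr p + (p - 1) * m powr p * indicator \<Omega> x)"
      using Cc_integrable(1)[OF \<phi>, of p] p ind by auto
    show "p * m powr (p - 1) * \<bar>\<phi> x\<bar> \<le> \<bar>\<phi> x\<bar> powr p + (p - 1) * m powr p * indicator \<Omega> x" for x
    proof (cases "x \<in> \<Omega>")
      case False
      then have "\<phi> x = 0" using K by blast
      then show ?thesis using p by simp
    qed (use young[of "\<bar>\<phi> x\<bar>"] in auto)
  qed
  also have "\<dots> = Lp_mass p \<phi> + (p - 1) * m powr p * ?V"
    using Cc_integrable(1)[OF \<phi>, of p] p ind \<Omega>D by (simp add: Lp_mass_def)
  finally have "p * m powr (p - 1) * (m * ?V) \<le> Lp_mass p \<phi> + (p - 1) * m powr p * ?V"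
    using m by simp
  moreover have "m powr (p - 1) * m = m powr p" using m p by (cases "m = 0") (auto simp: powr_diff)
  then have "p * m powr (p - 1) * (m * ?V) = p * (m powr p * ?V)" by simp
  ultimately have "m powr p * ?V \<le> Lp_mass p \<phi>" by (simp add: left_diff_distrib)
  then have "?V powr (p - 1) * (m powr p * ?V) \<le> ?V powr (p - 1) * Lp_mass p \<phi>"
    by (intro mult_left_mono) auto
  moreover have "?V powr (p - 1) * (m powr p * ?V) = Lp_mass 1 \<phi> powr p"
    using m \<Omega>D(6) by (simp add: powr_mult powr_diff)
  ultimately show ?thesis by simp
qed

lemma W0_nonzero_Cc:
  assumes \<phi>: "\<phi> \<in> Cc_infinity \<Omega>" and p: "1 < p" and nz: "\<phi> x \<noteq> 0" and \<Omega>: "open \<Omega>"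
  shows "(\<phi>, grad \<phi>) \<in> W0_nonzero p \<Omega>"
proof -
  have [measurable]: "\<Omega> \<in> sets lebesgue" using \<Omega> by (simp add: borel_open)
  have bm[measurable]: "\<phi> \<in> borel_measurable lebesgue" "grad \<phi> \<in> borel_measurable lebesgue"
    using Cc_infinityD[OF \<phi>]
    by (auto intro!: measurable_completion borel_measurable_continuous_onI)
  have int: "integrable lebesgue (\<lambda>x. \<bar>\<phi> x\<bar> powr p)" "integrable lebesgue (\<lambda>x. norm (grad \<phi> x) powr p)"
    using Cc_integrable(1,2)[OF \<phi>, of p] p integrable_completion by auto
  have "Lp_on p \<Omega> \<phi>" "Lp_on p \<Omega> (grad \<phi>)"
    using int[THEN integrable_mult_indicator[of \<Omega>, rotated]]
    by (auto simp: Lp_on_def set_borel_measurable_def set_integrable_def)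
  then have W: "(\<phi>, grad \<phi>) \<in> W0 p \<Omega>"
    unfolding W0_def using \<phi> p by (auto intro!: exI[of _ "\<lambda>_. \<phi>"])
  have "\<not> (AE x in lebesgue. x \<in> \<Omega> \<longrightarrow> \<phi> x = 0)"
  proof
    assume "AE x in lebesgue. x \<in> \<Omega> \<longrightarrow> \<phi> x = 0"
    moreover obtain K where "K \<subseteq> \<Omega>" "\<And>x. x \<notin> K \<Longrightarrow> \<phi> x = 0"
      using Cc_infinity_support[OF \<phi>] by metis
    ultimately have "AE x in lebesgue. \<phi> x = 0" by (auto elim: eventually_mono)
    then show False using continuous_AE_zero Cc_infinityD(2)[OF \<phi>] nz by blast
  qed
  with W show ?thesis by (simp add: W0_nonzero_def)
qed

text \<open>Turns a supremum over Sobolev functions into a best constant on test functions, by the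
  limits of \<open>W0_limits\<close>. The bound on the quotients has a name of its own because it
  also yields the boundedness behind \<open>torsion_bound\<close>.\<close>

lemma torsion_least:
  fixes \<Omega> :: "'a::euclidean_space set"
  assumes \<Omega>: "\<Omega> \<in> convex_domains" and p: "1 < p" and t: "0 \<le> t"
    and le: "\<And>\<phi>. \<phi> \<in> Cc_infinity \<Omega> \<Longrightarrow> Lp_mass 1 \<phi> powr p \<le> t * Dir p \<phi>"
  shows W0_torsion_ratio: "\<And>u g. (u, g) \<in> W0_nonzero p \<Omega> \<Longrightarrow>
      (LINT x:\<Omega>|lebesgue. \<bar>u x\<bar>) powr p / (LINT x:\<Omega>|lebesgue. norm (g x) powr p) \<le> t"
    and "torsion p \<Omega> \<le> t"
proof -
  show *: "(LINT x:\<Omega>|lebesgue. \<bar>u x\<bar>) powr p / (LINT x:\<Omega>|lebesgue. norm (g x) powr p) \<le> t"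
    if "(u, g) \<in> W0_nonzero p \<Omega>" for u g
  proof -
    have "(u, g) \<in> W0 p \<Omega>" using that by (simp add: W0_nonzero_def)
    then obtain \<phi> where \<phi>: "\<And>n. \<phi> n \<in> Cc_infinity \<Omega>"
      "(\<lambda>n. Lp_mass 1 (\<phi> n)) \<longlonglongrightarrow> (LINT x:\<Omega>|lebesgue. \<bar>u x\<bar>)"
      "(\<lambda>n. Dir p (\<phi> n)) \<longlonglongrightarrow> (LINT x:\<Omega>|lebesgue. norm (g x) powr p)"
      using W0_limits[OF _ p \<Omega>] by metis
    have "(LINT x:\<Omega>|lebesgue. \<bar>u x\<bar>) powr p \<le> t * (LINT x:\<Omega>|lebesgue. norm (g x) powr p)"
    proof (rule LIMSEQ_le)
      show "(\<lambda>n. Lp_mass 1 (\<phi> n) powr p) \<longlonglongrightarrow> (LINT x:\<Omega>|lebesgue. \<bar>u x\<bar>) powr p"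
        using \<phi>(2) p by (intro tendsto_powr' tendsto_const) (auto simp: Lp_mass_nonneg)
      show "(\<lambda>n. t * Dir p (\<phi> n)) \<longlonglongrightarrow> t * (LINT x:\<Omega>|lebesgue. norm (g x) powr p)"
        by (intro tendsto_intros \<phi>)
    qed (use le \<phi>(1) in auto)
    moreover have "0 \<le> (LINT x:\<Omega>|lebesgue. norm (g x) powr p)"
      by (simp add: set_lebesgue_integral_def)
    \<comment> \<open>If the gradient integral is 0, the quotient is 0 by convention, and
      \<open>t\<close> is nonnegative.\<close>
    ultimately show ?thesis using t
      by (cases "(LINT x:\<Omega>|lebesgue. norm (g x) powr p) = 0") (auto simp: divide_le_eq)
  qed
  obtain \<phi> x where "\<phi> \<in> Cc_infinity \<Omega>" "\<phi> x \<noteq> 0"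
    using exists_Cc_pos convex_domainsD(1,2)[OF \<Omega>] by metis
  then have "(\<phi>, grad \<phi>) \<in> W0_nonzero p \<Omega>"
    using W0_nonzero_Cc p convex_domainsD(2)[OF \<Omega>] by metis
  then show "torsion p \<Omega> \<le> t"
    unfolding torsion_def using * by (intro cSUP_least) auto
qed

text \<open>A real supremum bounds its members only if the set is bounded above;
  \<open>Lp_mass_Jensen\<close> and \<open>Poincare_slab\<close> supply the crude bound
  \<open>t\<close> that ensures this.\<close>

lemma torsion_bound:
  fixes \<Omega> :: "'a::euclidean_space set"
  assumes \<Omega>: "\<Omega> \<in> convex_domains" and p: "1 < p" and \<phi>: "\<phi> \<in> Cc_infinity \<Omega>"
  shows "Lp_mass 1 \<phi> powr p \<le> torsion p \<Omega> * Dir p \<phi>"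
proof -
  obtain e :: 'a and L where L: "norm e = 1" "0 < L" "\<And>x. x \<in> \<Omega> \<Longrightarrow> \<bar>(x - 0) \<bullet> e\<bar> \<le> L"
    using convex_domain_slab[OF \<Omega>] by metis
  define t where "t = measure lebesgue \<Omega> powr (p - 1) * (2 * p * L) powr p"
  have t: "0 \<le> t" by (simp add: t_def)
  have le: "Lp_mass 1 \<phi> powr p \<le> t * Dir p \<phi>" if "\<phi> \<in> Cc_infinity \<Omega>" for \<phi>
  proof -
    have "Lp_mass 1 \<phi> powr p \<le> measure lebesgue \<Omega> powr (p - 1) * Lp_mass p \<phi>"
      by (rule Lp_mass_Jensen[OF that p \<Omega>])
    also have "\<dots> \<le> measure lebesgue \<Omega> powr (p - 1) * ((2 * p * L) powr p * Dir p \<phi>)"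
      by (intro mult_left_mono Poincare_slab[OF that p L(1,3)]) auto
    finally show ?thesis by (simp add: t_def mult_ac)
  qed
  show ?thesis
  proof (cases "\<exists>x. \<phi> x \<noteq> 0")
    case True
    then obtain x where x: "\<phi> x \<noteq> 0" ..
    have W: "(\<phi>, grad \<phi>) \<in> W0_nonzero p \<Omega>"
      using W0_nonzero_Cc[OF \<phi> p x] convex_domainsD(2)[OF \<Omega>] by blast
    have "bdd_above ((\<lambda>(u, g). (LINT x:\<Omega>|lebesgue. \<bar>u x\<bar>) powr p / (LINT x:\<Omega>|lebesgue. norm (g x) powr p))
        ` W0_nonzero p \<Omega>)"
      using W0_torsion_ratio[OF \<Omega> p t le] by (intro bdd_aboveI[of _ t]) auto
    from cSUP_upper[OF W this]
    have "Lp_mass 1 \<phi> powr p / Dir p \<phi> \<le> torsion p \<Omega>"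
      using Cc_set_integrals[OF \<phi>, of p] p by (simp add: torsion_def)
    \<comment> \<open>A nonzero test function has positive mass, so the crude bound forces its
      gradient integral to be positive as well.\<close>
    moreover have "0 < Lp_mass 1 \<phi> powr p" using Lp_mass_pos[OF \<phi> _ x, of 1] by simp
    then have "0 < Dir p \<phi>"
      using le[OF \<phi>] t Dir_nonneg[of p \<phi>] by (cases "Dir p \<phi> = 0") auto
    ultimately show ?thesis by (simp add: divide_le_eq)
  next
    case False
    then have "\<phi> = (\<lambda>x. 0)" by auto
    moreover have "grad (\<lambda>x::'a. 0) x = 0" for x by (rule grad_eqI) simp
    ultimately show ?thesis using p by (simp add: Lp_mass_def Dir_def)
  qed
qed

text \<open>Counterpart of \<open>torsion_least\<close> for the infimum. Here the denominator has to
  be positive, which is where it matters that u is not almost everywhere zero on \<Omega>.\<close>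

lemma eigenvalue_greatest:
  fixes \<Omega> :: "'a::euclidean_space set"
  assumes \<Omega>: "\<Omega> \<in> convex_domains" and p: "1 < p"
    and le: "\<And>\<phi>. \<phi> \<in> Cc_infinity \<Omega> \<Longrightarrow> l * Lp_mass p \<phi> \<le> Dir p \<phi>"
  shows "l \<le> eigenvalue p \<Omega>"
proof -
  have *: "l \<le> (LINT x:\<Omega>|lebesgue. norm (g x) powr p) / (LINT x:\<Omega>|lebesgue. \<bar>u x\<bar> powr p)"
    if ug: "(u, g) \<in> W0_nonzero p \<Omega>" for u g
  proof -
    have W: "(u, g) \<in> W0 p \<Omega>" using ug by (simp add: W0_nonzero_def)
    then obtain \<phi> where \<phi>: "\<And>n. \<phi> n \<in> Cc_infinity \<Omega>"
      "(\<lambda>n. Lp_mass p (\<phi> n)) \<longlonglongrightarrow> (LINT x:\<Omega>|lebesgue. \<bar>u x\<bar> powr p)"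
      "(\<lambda>n. Dir p (\<phi> n)) \<longlonglongrightarrow> (LINT x:\<Omega>|lebesgue. norm (g x) powr p)"
      using W0_limits[OF _ p \<Omega>] by metis
    have 1: "l * (LINT x:\<Omega>|lebesgue. \<bar>u x\<bar> powr p) \<le> (LINT x:\<Omega>|lebesgue. norm (g x) powr p)"
      by (rule LIMSEQ_le[OF tendsto_mult_left[OF \<phi>(2)] \<phi>(3)]) (use le \<phi>(1) in auto)
    have int: "integrable lebesgue (\<lambda>x. indicator \<Omega> x *\<^sub>R \<bar>u x\<bar> powr p)"
      using W by (auto simp: W0_def Lp_on_def set_integrable_def)
    have "(LINT x:\<Omega>|lebesgue. \<bar>u x\<bar> powr p) \<noteq> 0"
    proof
      assume "(LINT x:\<Omega>|lebesgue. \<bar>u x\<bar> powr p) = 0"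
      then have "AE x in lebesgue. indicator \<Omega> x *\<^sub>R \<bar>u x\<bar> powr p = 0"
        using integral_nonneg_eq_0_iff_AE[OF int] by (simp add: set_lebesgue_integral_def)
      then have "AE x in lebesgue. x \<in> \<Omega> \<longrightarrow> u x = 0"
        by (rule eventually_mono) auto
      then show False using ug by (simp add: W0_nonzero_def)
    qed
    moreover have "0 \<le> (LINT x:\<Omega>|lebesgue. \<bar>u x\<bar> powr p)"
      by (simp add: set_lebesgue_integral_def)
    ultimately show ?thesis using 1 by (simp add: le_divide_eq)
  qed
  obtain \<phi> x where "\<phi> \<in> Cc_infinity \<Omega>" "\<phi> x \<noteq> 0"
    using exists_Cc_pos convex_domainsD(1,2)[OF \<Omega>] by metis
  then have "(\<phi>, grad \<phi>) \<in> W0_nonzero p \<Omega>"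
    using W0_nonzero_Cc p convex_domainsD(2)[OF \<Omega>] by metis
  then show ?thesis
    unfolding eigenvalue_def using * by (intro cINF_greatest) auto
qed

lemma eigenvalue_bound:
  fixes \<Omega> :: "'a::euclidean_space set"
  assumes \<Omega>: "\<Omega> \<in> convex_domains" and p: "1 < p" and \<phi>: "\<phi> \<in> Cc_infinity \<Omega>"
  shows "eigenvalue p \<Omega> * Lp_mass p \<phi> \<le> Dir p \<phi>"
proof (cases "\<exists>x. \<phi> x \<noteq> 0")
  case True
  then obtain x where x: "\<phi> x \<noteq> 0" ..
  have W: "(\<phi>, grad \<phi>) \<in> W0_nonzero p \<Omega>"
    using W0_nonzero_Cc[OF \<phi> p x] convex_domainsD(2)[OF \<Omega>] by blast
  have "bdd_below ((\<lambda>(u, g). (LINT x:\<Omega>|lebesgue. norm (g x) powr p) / (LINT x:\<Omega>|lebesgue. \<bar>u x\<bar> powr p))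
      ` W0_nonzero p \<Omega>)"
    by (intro bdd_belowI[of _ 0]) (auto simp: set_lebesgue_integral_def)
  from cINF_lower[OF this W]
  have "eigenvalue p \<Omega> \<le> Dir p \<phi> / Lp_mass p \<phi>"
    using Cc_set_integrals[OF \<phi>, of p] p by (simp add: eigenvalue_def)
  moreover have "0 < Lp_mass p \<phi>" using Lp_mass_pos[OF \<phi> _ x, of p] p by simp
  ultimately show ?thesis by (simp add: le_divide_eq)
next
  case False
  then have "\<phi> = (\<lambda>x. 0)" by auto
  then show ?thesis using p Dir_nonneg[of p \<phi>] by (simp add: Lp_mass_def)
qed

lemma torsion_pos:
  fixes \<Omega> :: "'a::euclidean_space set"
  assumes \<Omega>: "\<Omega> \<in> convex_domains" and p: "1 < p"
  shows "0 < torsion p \<Omega>"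
proof -
  obtain \<phi> x where \<phi>: "\<phi> \<in> Cc_infinity \<Omega>" "\<phi> x \<noteq> 0"
    using exists_Cc_pos convex_domainsD(1,2)[OF \<Omega>] by metis
  have "0 < Lp_mass 1 \<phi> powr p" using Lp_mass_pos[OF \<phi>(1) _ \<phi>(2), of 1] by simp
  also have "\<dots> \<le> torsion p \<Omega> * Dir p \<phi>" by (rule torsion_bound[OF \<Omega> p \<phi>(1)])
  finally show ?thesis using Dir_nonneg[of p \<phi>] by (simp add: zero_less_mult_iff)
qed

lemma eigenvalue_ge_slab:
  fixes \<Omega> :: "'a::euclidean_space set"
  assumes \<Omega>: "\<Omega> \<in> convex_domains" and p: "1 < p"
    and e: "norm e = 1" and L: "0 < L" "\<And>x. x \<in> \<Omega> \<Longrightarrow> \<bar>(x - x0) \<bullet> e\<bar> \<le> L"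
  shows "(2 * p * L) powr (- p) \<le> eigenvalue p \<Omega>"
proof (rule eigenvalue_greatest[OF \<Omega> p])
  fix \<phi> assume "\<phi> \<in> Cc_infinity \<Omega>"
  from Poincare_slab[OF this p e L(2)]
  have "(2 * p * L) powr (- p) * Lp_mass p \<phi> \<le> (2 * p * L) powr (- p) * ((2 * p * L) powr p * Dir p \<phi>)"
    by (intro mult_left_mono) auto
  also have "\<dots> = Dir p \<phi>" using p L by (simp add: mult.assoc[symmetric] powr_add[symmetric])
  finally show "(2 * p * L) powr (- p) * Lp_mass p \<phi> \<le> Dir p \<phi>" .
qed

lemma eigenvalue_pos:
  fixes \<Omega> :: "'a::euclidean_space set"
  assumes \<Omega>: "\<Omega> \<in> convex_domains" and p: "1 < p"
  shows "0 < eigenvalue p \<Omega>"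
proof -
  obtain e :: 'a and L where L: "norm e = 1" "0 < L" "\<And>x. x \<in> \<Omega> \<Longrightarrow> \<bar>(x - 0) \<bullet> e\<bar> \<le> L"
    using convex_domain_slab[OF \<Omega>] by metis
  have "0 < (2 * p * L) powr (- p)" using p L by simp
  then show ?thesis using eigenvalue_ge_slab[OF \<Omega> p L] by (rule less_le_trans)
qed

text \<open>Jensen's inequality bounds the L^1 mass by the L^p mass, and the eigenvalue bounds the
  latter by the gradient integral. Equivalently, \<open>F p 1 \<Omega>\<close> is at most 1.\<close>

lemma torsion_eigenvalue_le:
  assumes \<Omega>: "\<Omega> \<in> convex_domains" and p: "1 < p"
  shows "eigenvalue p \<Omega> * torsion p \<Omega> \<le> measure lebesgue \<Omega> powr (p - 1)"
proof -
  note pos = eigenvalue_pos[OF \<Omega> p]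
  have "torsion p \<Omega> \<le> measure lebesgue \<Omega> powr (p - 1) / eigenvalue p \<Omega>"
  proof (rule torsion_least(2)[OF \<Omega> p])
    show "0 \<le> measure lebesgue \<Omega> powr (p - 1) / eigenvalue p \<Omega>" using pos by simp
    fix \<phi> assume \<phi>: "\<phi> \<in> Cc_infinity \<Omega>"
    have "Lp_mass 1 \<phi> powr p \<le> measure lebesgue \<Omega> powr (p - 1) * Lp_mass p \<phi>"
      by (rule Lp_mass_Jensen[OF \<phi> p \<Omega>])
    also have "\<dots> \<le> measure lebesgue \<Omega> powr (p - 1) * (Dir p \<phi> / eigenvalue p \<Omega>)"
      using eigenvalue_bound[OF \<Omega> p \<phi>] pos
      by (intro mult_left_mono) (auto simp: le_divide_eq mult.commute)
    finally show "Lp_mass 1 \<phi> powr p \<le> measure lebesgue \<Omega> powr (p - 1) / eigenvalue p \<Omega> * Dir p \<phi>" by simp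
  qed
  then show ?thesis using pos by (simp add: le_divide_eq mult.commute)
qed

lemma torsion_mono:
  assumes "\<Omega> \<in> convex_domains" "\<Omega>' \<in> convex_domains" "\<Omega> \<subseteq> \<Omega>'" "1 < p"
  shows "torsion p \<Omega> \<le> torsion p \<Omega>'"
  using assms by (intro torsion_least torsion_bound less_imp_le[OF torsion_pos]) (auto intro: Cc_infinity_mono)

lemma eigenvalue_antimono:
  assumes "\<Omega> \<in> convex_domains" "\<Omega>' \<in> convex_domains" "\<Omega> \<subseteq> \<Omega>'" "1 < p"
  shows "eigenvalue p \<Omega>' \<le> eigenvalue p \<Omega>"
  using assms by (intro eigenvalue_greatest eigenvalue_bound) (auto intro: Cc_infinity_mono)

section \<open>Behaviour under dilations and translations\<close>

lemma integral_lborel_affine: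
  fixes f :: "'a::euclidean_space \<Rightarrow> real"
  assumes [measurable]: "f \<in> borel_measurable borel" and a: "0 < a"
  shows "(LINT x|lborel. f (a *\<^sub>R x + b)) = a powr (- real DIM('a)) * (LINT x|lborel. f x)"
proof -
  have "(LINT x|lborel. f x) = (LINT x|density (distr lborel borel (\<lambda>x. b + a *\<^sub>R x)) (\<lambda>_. \<bar>a\<bar>^DIM('a)). f x)"
    using a lborel_affine[of a b] by simp
  also have "\<dots> = a ^ DIM('a) * (LINT x|lborel. f (b + a *\<^sub>R x))"
    using a by (simp add: integral_density integral_distr)
  finally show ?thesis
    using a by (simp add: powr_minus powr_realpow add.commute)
qed

lemma Lp_mass_affine:
  fixes \<phi> :: "'a::euclidean_space \<Rightarrow> real"
  assumes "\<phi> \<in> Cc_infinity \<Omega>" "0 < a"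
  shows "Lp_mass p (\<lambda>x. \<phi> (a *\<^sub>R x + b)) = a powr (- real DIM('a)) * Lp_mass p \<phi>"
proof -
  have [measurable]: "\<phi> \<in> borel_measurable borel"
    using Cc_infinityD[OF assms(1)] by (auto intro: borel_measurable_continuous_onI)
  show ?thesis
    unfolding Lp_mass_def by (rule integral_lborel_affine[OF _ assms(2), where f="\<lambda>x. \<bar>\<phi> x\<bar> powr p"]) measurable
qed

lemma Dir_affine:
  fixes \<phi> :: "'a::euclidean_space \<Rightarrow> real"
  assumes "\<phi> \<in> Cc_infinity \<Omega>" "0 < a"
  shows "Dir p (\<lambda>x. \<phi> (a *\<^sub>R x + b)) = a powr (p - real DIM('a)) * Dir p \<phi>"
proof -
  have [measurable]: "grad \<phi> \<in> borel_measurable borel"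
    using Cc_infinityD[OF assms(1)] by (auto intro: borel_measurable_continuous_onI)
  have "Dir p (\<lambda>x. \<phi> (a *\<^sub>R x + b)) = (LINT x|lborel. a powr p * norm (grad \<phi> (a *\<^sub>R x + b)) powr p)"
    unfolding Dir_def grad_affine[OF assms(1)] using assms(2) by (simp add: powr_mult)
  also have "\<dots> = a powr p * (a powr (- real DIM('a)) * Dir p \<phi>)"
    unfolding Dir_def
    by (subst integral_lborel_affine[OF _ assms(2), where f="\<lambda>x. norm (grad \<phi> x) powr p", symmetric]) auto
  finally show ?thesis by (simp add: mult.assoc[symmetric] powr_add[symmetric])
qed

lemma convex_domains_affine:
  assumes "\<Omega> \<in> convex_domains" "0 < a"
  shows "(\<lambda>x. a *\<^sub>R x + b) ` \<Omega> \<in> convex_domains"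
proof -
  have *: "(\<lambda>x. a *\<^sub>R x + b) ` \<Omega> = (+) b ` (*\<^sub>R) a ` \<Omega>" by (auto simp: image_image add.commute)
  show ?thesis
    using assms unfolding * convex_domains_def
    by (auto intro!: open_translation open_scaling convex_translation convex_scaling bounded_translation bounded_scaling)
qed

lemma measure_affine:
  fixes \<Omega> :: "'a::euclidean_space set"
  assumes "0 < a"
  shows "measure lebesgue ((\<lambda>x. a *\<^sub>R x + b) ` \<Omega>) = a powr real DIM('a) * measure lebesgue \<Omega>"
  using measure_lebesgue_affine[of a b \<Omega>] assms by (simp add: powr_realpow)

text \<open>Transplanting test functions gives one inequality for each affine map. Applied to the
  inverse map it gives the reverse one, so this half already contains the scaling law.\<close>

lemma torsion_affine_le:
  fixes \<Omega> :: "'a::euclidean_space set"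
  assumes \<Omega>: "\<Omega> \<in> convex_domains" and a: "0 < a" and p: "1 < p"
  shows "torsion p ((\<lambda>x. a *\<^sub>R x + b) ` \<Omega>) \<le> a powr (p + real DIM('a) * (p - 1)) * torsion p \<Omega>"
proof (rule torsion_least(2)[OF convex_domains_affine[OF \<Omega> a] p])
  let ?d = "real DIM('a)"
  show "0 \<le> a powr (p + ?d * (p - 1)) * torsion p \<Omega>"
    using torsion_pos[OF \<Omega> p] by simp
  fix \<phi> assume \<phi>: "\<phi> \<in> Cc_infinity ((\<lambda>x. a *\<^sub>R x + b) ` \<Omega>)"
  have "(\<lambda>x. \<phi> (a *\<^sub>R x + b)) \<in> Cc_infinity \<Omega>" using Cc_infinity_affine[OF \<phi>] a by simp
  from torsion_bound[OF \<Omega> p this]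
  have "(a powr (- ?d) * Lp_mass 1 \<phi>) powr p \<le> torsion p \<Omega> * (a powr (p - ?d) * Dir p \<phi>)"
    by (simp add: Lp_mass_affine[OF \<phi> a] Dir_affine[OF \<phi> a])
  then have "a powr (?d * p) * (a powr (- ?d) * Lp_mass 1 \<phi>) powr p
      \<le> a powr (?d * p) * (torsion p \<Omega> * (a powr (p - ?d) * Dir p \<phi>))"
    by (intro mult_left_mono) auto
  moreover have "a powr (?d * p) * (a powr (- ?d) * Lp_mass 1 \<phi>) powr p = Lp_mass 1 \<phi> powr p"
  proof -
    have "(a powr (- ?d) * Lp_mass 1 \<phi>) powr p = a powr (- ?d * p) * Lp_mass 1 \<phi> powr p"
      by (simp only: powr_mult powr_powr powr_ge_zero Lp_mass_nonneg)
    moreover have "a powr (?d * p) * a powr (- ?d * p) = 1"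
      using a by (simp only: powr_add[symmetric]) simp
    ultimately show ?thesis by (simp add: mult.assoc[symmetric])
  qed
  moreover have "a powr (?d * p) * (torsion p \<Omega> * (a powr (p - ?d) * Dir p \<phi>))
      = (a powr (?d * p) * a powr (p - ?d)) * torsion p \<Omega> * Dir p \<phi>" by simp
  moreover have "a powr (?d * p) * a powr (p - ?d) = a powr (p + ?d * (p - 1))"
    by (simp add: powr_add[symmetric] algebra_simps)
  ultimately show "Lp_mass 1 \<phi> powr p \<le> a powr (p + ?d * (p - 1)) * torsion p \<Omega> * Dir p \<phi>" by simp
qed

lemma affine_image_inverse:
  fixes b :: "'a::real_vector"
  assumes "0 < a"
  shows "(\<lambda>x. inverse a *\<^sub>R x + (- (inverse a *\<^sub>R b))) ` (\<lambda>x. a *\<^sub>R x + b) ` \<Omega> = \<Omega>"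
proof -
  have "inverse a *\<^sub>R (a *\<^sub>R x + b) + (- (inverse a *\<^sub>R b)) = x" for x
    using assms by (simp add: scaleR_right_distrib)
  then show ?thesis unfolding image_image by simp
qed

lemma torsion_affine:
  fixes \<Omega> :: "'a::euclidean_space set"
  assumes \<Omega>: "\<Omega> \<in> convex_domains" and a: "0 < a" and p: "1 < p"
  shows "torsion p ((\<lambda>x. a *\<^sub>R x + b) ` \<Omega>) = a powr (p + real DIM('a) * (p - 1)) * torsion p \<Omega>"
proof (rule antisym[OF torsion_affine_le[OF \<Omega> a p]])
  let ?k = "p + real DIM('a) * (p - 1)" and ?T = "torsion p ((\<lambda>x. a *\<^sub>R x + b) ` \<Omega>)"
  have "torsion p ((\<lambda>x. inverse a *\<^sub>R x + (- (inverse a *\<^sub>R b))) ` (\<lambda>x. a *\<^sub>R x + b) ` \<Omega>) \<le> inverse a powr ?k * ?T"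
    by (rule torsion_affine_le[OF convex_domains_affine[OF \<Omega> a] _ p]) (use a in simp)
  then have "torsion p \<Omega> \<le> inverse a powr ?k * ?T"
    unfolding affine_image_inverse[OF a] .
  then have "a powr ?k * torsion p \<Omega> \<le> a powr ?k * (inverse a powr ?k * ?T)"
    by (intro mult_left_mono) auto
  also have "\<dots> = ?T" using a by (simp add: inverse_powr)
  finally show "a powr ?k * torsion p \<Omega> \<le> ?T" .
qed

lemma eigenvalue_affine_ge:
  fixes \<Omega> :: "'a::euclidean_space set"
  assumes \<Omega>: "\<Omega> \<in> convex_domains" and a: "0 < a" and p: "1 < p"
  shows "a powr (- p) * eigenvalue p \<Omega> \<le> eigenvalue p ((\<lambda>x. a *\<^sub>R x + b) ` \<Omega>)"
proof (rule eigenvalue_greatest[OF convex_domains_affine[OF \<Omega> a] p])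
  let ?d = "real DIM('a)"
  fix \<phi> assume \<phi>: "\<phi> \<in> Cc_infinity ((\<lambda>x. a *\<^sub>R x + b) ` \<Omega>)"
  have "(\<lambda>x. \<phi> (a *\<^sub>R x + b)) \<in> Cc_infinity \<Omega>" using Cc_infinity_affine[OF \<phi>] a by simp
  from eigenvalue_bound[OF \<Omega> p this]
  have "eigenvalue p \<Omega> * (a powr (- ?d) * Lp_mass p \<phi>) \<le> a powr (p - ?d) * Dir p \<phi>"
    by (simp add: Lp_mass_affine[OF \<phi> a] Dir_affine[OF \<phi> a])
  then have "a powr (?d - p) * (eigenvalue p \<Omega> * (a powr (- ?d) * Lp_mass p \<phi>))
      \<le> a powr (?d - p) * (a powr (p - ?d) * Dir p \<phi>)"
    by (intro mult_left_mono) auto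
  moreover have "a powr (?d - p) * (a powr (p - ?d) * Dir p \<phi>) = Dir p \<phi>"
    using a by (simp add: mult.assoc[symmetric] powr_add[symmetric])
  moreover have "a powr (?d - p) * (eigenvalue p \<Omega> * (a powr (- ?d) * Lp_mass p \<phi>))
      = (a powr (?d - p) * a powr (- ?d)) * eigenvalue p \<Omega> * Lp_mass p \<phi>" by simp
  moreover have "a powr (?d - p) * a powr (- ?d) = a powr (- p)"
    by (simp add: powr_add[symmetric])
  ultimately show "a powr (- p) * eigenvalue p \<Omega> * Lp_mass p \<phi> \<le> Dir p \<phi>" by simp
qed

lemma eigenvalue_affine:
  fixes \<Omega> :: "'a::euclidean_space set"
  assumes \<Omega>: "\<Omega> \<in> convex_domains" and a: "0 < a" and p: "1 < p"
  shows "eigenvalue p ((\<lambda>x. a *\<^sub>R x + b) ` \<Omega>) = a powr (- p) * eigenvalue p \<Omega>"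
proof (rule antisym[OF _ eigenvalue_affine_ge[OF \<Omega> a p]])
  let ?E = "eigenvalue p ((\<lambda>x. a *\<^sub>R x + b) ` \<Omega>)"
  have "inverse a powr (- p) * ?E \<le> eigenvalue p ((\<lambda>x. inverse a *\<^sub>R x + (- (inverse a *\<^sub>R b))) ` (\<lambda>x. a *\<^sub>R x + b) ` \<Omega>)"
    by (rule eigenvalue_affine_ge[OF convex_domains_affine[OF \<Omega> a] _ p]) (use a in simp)
  then have "inverse a powr (- p) * ?E \<le> eigenvalue p \<Omega>"
    unfolding affine_image_inverse[OF a] .
  then have "a powr (- p) * (inverse a powr (- p) * ?E) \<le> a powr (- p) * eigenvalue p \<Omega>"
    by (intro mult_left_mono) auto
  moreover have "a powr (- p) * (inverse a powr (- p) * ?E) = ?E"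
    using a by (simp add: inverse_powr)
  ultimately show "?E \<le> a powr (- p) * eigenvalue p \<Omega>" by simp
qed

text \<open>The volume exponent is dictated by invariance: d times \<open>scaling_exponent\<close>
  equals -p + (p + d (p - 1)) q, the degree of the numerator.\<close>

lemma F_affine:
  fixes \<Omega> :: "'a::euclidean_space set"
  assumes \<Omega>: "\<Omega> \<in> convex_domains" and a: "0 < a" and p: "1 < p"
  shows "F p q ((\<lambda>x. a *\<^sub>R x + b) ` \<Omega>) = F p q \<Omega>"
proof -
  let ?d = "real DIM('a)" and ?\<alpha> = "scaling_exponent p q DIM('a)"
  have d: "?d \<noteq> 0" by simp
  have T: "(a powr (p + ?d * (p - 1)) * torsion p \<Omega>) powr q = a powr ((p + ?d * (p - 1)) * q) * torsion p \<Omega> powr q"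
    using torsion_pos[OF \<Omega> p] a by (simp add: powr_mult powr_powr)
  have M: "(a powr ?d * measure lebesgue \<Omega>) powr ?\<alpha> = a powr (?d * ?\<alpha>) * measure lebesgue \<Omega> powr ?\<alpha>"
    using a by (simp add: powr_mult powr_powr)
  have "- p + (p + ?d * (p - 1)) * q = ?d * ?\<alpha>"
    using d by (simp add: scaling_exponent_def field_simps)
  then have e: "a powr (- p) * a powr ((p + ?d * (p - 1)) * q) = a powr (?d * ?\<alpha>)"
    by (simp add: powr_add[symmetric])
  have "F p q ((\<lambda>x. a *\<^sub>R x + b) ` \<Omega>)
    = (a powr (- p) * a powr ((p + ?d * (p - 1)) * q)) * (eigenvalue p \<Omega> * torsion p \<Omega> powr q)
      / (a powr (?d * ?\<alpha>) * measure lebesgue \<Omega> powr ?\<alpha>)"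
    unfolding F_def eigenvalue_affine[OF assms] torsion_affine[OF assms] measure_affine[OF a] T M
    by (simp add: mult_ac)
  also have "\<dots> = F p q \<Omega>" unfolding e F_def using a by simp
  finally show ?thesis .
qed

subsection \<open>The Brunn--Minkowski inequality\<close>

text \<open>The Minkowski sum, written with nested unions because \<open>open_sums\<close> and
  \<open>bounded_sums\<close> have this form.\<close>

definition msum :: "'a::real_vector set \<Rightarrow> 'a set \<Rightarrow> 'a set" where
  "msum A B = (\<Union>x\<in>A. \<Union>y\<in>B. {x + y})"

lemma in_msum: "z \<in> msum A B \<longleftrightarrow> (\<exists>x\<in>A. \<exists>y\<in>B. z = x + y)"
  by (auto simp: msum_def)

lemma msum_commute: "msum A B = msum B A"
  by (auto simp: in_msum set_eq_iff) (metis add.commute)+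

lemma msum_mono: "A \<subseteq> A' \<Longrightarrow> B \<subseteq> B' \<Longrightarrow> msum A B \<subseteq> msum A' B'"
  by (auto simp: msum_def)

lemma open_msum: "open A \<Longrightarrow> open (msum A (B::'a::real_normed_vector set))"
  unfolding msum_def using open_sums by blast

lemma bounded_msum: "bounded A \<Longrightarrow> bounded B \<Longrightarrow> bounded (msum A (B::'a::real_normed_vector set))"
  unfolding msum_def using bounded_sums by blast

definition nbox :: "'a::euclidean_space set \<Rightarrow> bool" where
  "nbox X \<longleftrightarrow> X \<noteq> {} \<and> (\<exists>a b. X = box a b)"

text \<open>Two disjoint nonempty open boxes are separated by a coordinate hyperplane; the induction
  on the number of boxes cuts along such hyperplanes.\<close>

definition box_family :: "'a::euclidean_space set set \<Rightarrow> bool" where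
  "box_family P \<longleftrightarrow> finite P \<and> P \<noteq> {} \<and> (\<forall>X\<in>P. nbox X) \<and> pairwise disjnt P"



lemma box_family_Union:
  assumes "box_family P"
  shows "open (\<Union>P)" "bounded (\<Union>P)" "\<Union>P \<noteq> {}"
  using assms by (auto simp: box_family_def nbox_def intro!: open_Union bounded_Union open_box bounded_box)

lemma open_bounded_measure:
  fixes A :: "'a::euclidean_space set"
  assumes "open A" "bounded A"
  shows "A \<in> lmeasurable" "A \<noteq> {} \<Longrightarrow> 0 < measure lebesgue A"
proof -
  show "A \<in> lmeasurable" using assms lmeasurable_open by blast
  then show "0 < measure lebesgue A" if "A \<noteq> {}"
    using that assms open_not_negligible by (metis less_eq_real_def measure_nonneg negligible_iff_measure0)
qed

text \<open>The inequality of arithmetic and geometric means is applied to the ratios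
  \<alpha>/(\<alpha>+\<beta>) and to the ratios \<beta>/(\<alpha>+\<beta>), which add up to 1 for
  each index. With side lengths for \<alpha> and \<beta> this is Brunn--Minkowski for boxes.\<close>

lemma prod_Minkowski:
  fixes \<alpha> \<beta> :: "'b \<Rightarrow> real"
  assumes S: "finite S" "S \<noteq> {}" and pos: "\<And>i. i \<in> S \<Longrightarrow> 0 < \<alpha> i" "\<And>i. i \<in> S \<Longrightarrow> 0 < \<beta> i"
  shows "(prod \<alpha> S powr (1 / card S) + prod \<beta> S powr (1 / card S)) ^ card S \<le> (\<Prod>i\<in>S. \<alpha> i + \<beta> i)"
proof -
  let ?n = "real (card S)" and ?P = "\<Prod>i\<in>S. \<alpha> i + \<beta> i"
  have n: "0 < ?n" using S by (simp add: card_gt_0_iff)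
  have P: "0 < ?P" "0 < prod \<alpha> S" "0 < prod \<beta> S" using pos by (auto intro!: prod_pos add_pos_pos)
  have 1: "(prod \<alpha> S / ?P) powr (1 / ?n) \<le> (\<Sum>i\<in>S. (\<alpha> i / (\<alpha> i + \<beta> i)) / ?n)"
    using arith_geom_mean[OF S, of "\<lambda>i. \<alpha> i / (\<alpha> i + \<beta> i)"] pos by (simp add: prod_dividef less_imp_le add_nonneg_nonneg)
  have 2: "(prod \<beta> S / ?P) powr (1 / ?n) \<le> (\<Sum>i\<in>S. (\<beta> i / (\<alpha> i + \<beta> i)) / ?n)"
    using arith_geom_mean[OF S, of "\<lambda>i. \<beta> i / (\<alpha> i + \<beta> i)"] pos by (simp add: prod_dividef less_imp_le add_nonneg_nonneg)
  have "(\<Sum>i\<in>S. (\<alpha> i / (\<alpha> i + \<beta> i)) / ?n) + (\<Sum>i\<in>S. (\<beta> i / (\<alpha> i + \<beta> i)) / ?n) = (\<Sum>i\<in>S. 1 / ?n)"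
    unfolding sum.distrib[symmetric]
  proof (rule sum.cong)
    fix i assume "i \<in> S"
    then have "\<alpha> i + \<beta> i \<noteq> 0" using pos[of i] by linarith
    then show "\<alpha> i / (\<alpha> i + \<beta> i) / ?n + \<beta> i / (\<alpha> i + \<beta> i) / ?n = 1 / ?n"
      by (simp add: add_divide_distrib[symmetric])
  qed simp
  also have "\<dots> = 1" using n by simp
  finally have "(prod \<alpha> S / ?P) powr (1 / ?n) + (prod \<beta> S / ?P) powr (1 / ?n) \<le> 1" using 1 2 by linarith
  then have "(prod \<alpha> S powr (1 / ?n) + prod \<beta> S powr (1 / ?n)) / ?P powr (1 / ?n) \<le> 1"
    using P by (simp add: powr_divide add_divide_distrib)
  then have "prod \<alpha> S powr (1 / ?n) + prod \<beta> S powr (1 / ?n) \<le> ?P powr (1 / ?n)"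
    using P by (simp add: divide_le_eq)
  then have "(prod \<alpha> S powr (1 / ?n) + prod \<beta> S powr (1 / ?n)) ^ card S \<le> (?P powr (1 / ?n)) ^ card S"
    by (intro power_mono) auto
  also have "(?P powr (1 / ?n)) ^ card S = ?P" using P n by (simp add: powr_realpow[symmetric] powr_powr)
  finally show ?thesis .
qed

lemma measure_box:
  fixes a b :: "'a::euclidean_space"
  assumes "box a b \<noteq> {}"
  shows "measure lebesgue (box a b) = (\<Prod>i\<in>Basis. (b - a) \<bullet> i)"
  using assms by (auto simp: measure_lborel_box_eq box_ne_empty less_imp_le)

lemma BM_box:
  fixes X Y :: "'a::euclidean_space set"
  assumes "nbox X" "nbox Y"
  shows "(measure lebesgue X powr (1 / DIM('a)) + measure lebesgue Y powr (1 / DIM('a))) ^ DIM('a)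
    \<le> measure lebesgue (msum X Y)"
proof -
  obtain a b where X: "X = box a b" "X \<noteq> {}" using assms(1) unfolding nbox_def by blast
  obtain c d where Y: "Y = box c d" "Y \<noteq> {}" using assms(2) unfolding nbox_def by blast
  have lt: "0 < (b - a) \<bullet> i" "0 < (d - c) \<bullet> i" if "i \<in> Basis" for i
    using X Y that by (auto simp: box_ne_empty inner_diff_left)
  have "box (a + c) (b + d) \<subseteq> msum X Y"
  proof
    fix z assume z: "z \<in> box (a + c) (b + d)"
    \<comment> \<open>\<tau> i is the relative position of z between the summed corners in
      coordinate i; the points of the two boxes at this same relative position add up to z.\<close>
    define \<tau> where "\<tau> i = (z - a - c) \<bullet> i / ((b - a) \<bullet> i + (d - c) \<bullet> i)" for i
    define x where "x = (\<Sum>i\<in>Basis. (a \<bullet> i + \<tau> i * ((b - a) \<bullet> i)) *\<^sub>R i)"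
    have \<tau>: "0 < \<tau> i" "\<tau> i < 1" "\<tau> i * ((b - a) \<bullet> i) + \<tau> i * ((d - c) \<bullet> i) = (z - a - c) \<bullet> i" if "i \<in> Basis" for i
    proof -
      have s: "0 < (b - a) \<bullet> i + (d - c) \<bullet> i" using lt[OF that] by linarith
      have zi: "0 < (z - a - c) \<bullet> i" "(z - a - c) \<bullet> i < (b - a) \<bullet> i + (d - c) \<bullet> i"
        using z that by (auto simp: mem_box inner_diff_left inner_add_left algebra_simps)
      show "0 < \<tau> i" "\<tau> i < 1" using s zi by (auto simp: \<tau>_def)
      have "\<tau> i * ((b - a) \<bullet> i + (d - c) \<bullet> i) = (z - a - c) \<bullet> i" using s by (simp add: \<tau>_def)
      then show "\<tau> i * ((b - a) \<bullet> i) + \<tau> i * ((d - c) \<bullet> i) = (z - a - c) \<bullet> i" by (simp add: distrib_left)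
    qed
    have xi: "x \<bullet> i = a \<bullet> i + \<tau> i * ((b - a) \<bullet> i)" if "i \<in> Basis" for i
      unfolding x_def using that by (rule inner_sum_left_Basis)
    have frac: "0 < t * w \<and> t * w < w" if "0 < t" "t < 1" "0 < w" for t w :: real
      using that by simp
    have "x \<in> X"
      unfolding X mem_box
    proof (intro ballI)
      fix i :: 'a assume i: "i \<in> Basis"
      show "a \<bullet> i < x \<bullet> i \<and> x \<bullet> i < b \<bullet> i"
        using frac[OF \<tau>(1,2)[OF i] lt(1)[OF i]] unfolding xi[OF i] by (simp add: inner_diff_left)
    qed
    moreover have "z - x \<in> Y"
      unfolding Y mem_box
    proof (intro ballI)
      fix i :: 'a assume i: "i \<in> Basis"
      have "(z - x) \<bullet> i = c \<bullet> i + \<tau> i * ((d - c) \<bullet> i)"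
        using xi[OF i] \<tau>(3)[OF i] by (simp add: inner_diff_left)
      then show "c \<bullet> i < (z - x) \<bullet> i \<and> (z - x) \<bullet> i < d \<bullet> i"
        using frac[OF \<tau>(1,2)[OF i] lt(2)[OF i]] by (simp add: inner_diff_left)
    qed
    ultimately show "z \<in> msum X Y" unfolding in_msum by (metis add_diff_cancel_left' diff_add_cancel add.commute)
  qed
  then have le: "measure lebesgue (box (a + c) (b + d)) \<le> measure lebesgue (msum X Y)"
    unfolding X(1) Y(1)
    by (intro measure_mono_fmeasurable open_bounded_measure(1) open_msum bounded_msum open_box bounded_box)
      (auto simp: borel_open)
  have ne: "box (a + c) (b + d) \<noteq> {}"
    unfolding box_ne_empty
  proof (intro ballI)
    fix i :: 'a assume "i \<in> Basis"
    then show "(a + c) \<bullet> i < (b + d) \<bullet> i"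
      using lt[of i] by (simp add: inner_diff_left inner_add_left)
  qed
  have "(measure lebesgue X powr (1 / DIM('a)) + measure lebesgue Y powr (1 / DIM('a))) ^ DIM('a)
      \<le> (\<Prod>i\<in>Basis. (b - a) \<bullet> i + (d - c) \<bullet> i)"
    using prod_Minkowski[of Basis "\<lambda>i. (b - a) \<bullet> i" "\<lambda>i. (d - c) \<bullet> i"] lt
    unfolding X(1) Y(1) measure_box[OF X(2)[unfolded X(1)]] measure_box[OF Y(2)[unfolded Y(1)]] by simp
  also have "\<dots> = measure lebesgue (box (a + c) (b + d))"
    unfolding measure_box[OF ne] by (intro prod.cong) (auto simp: inner_diff_left inner_add_left)
  finally show ?thesis using le by linarith
qed

lemma box_halfspace:
  fixes a b :: "'a::euclidean_space"
  assumes i: "i \<in> Basis"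
  shows "\<exists>c. box a b \<inter> {x. x \<bullet> i < t} = box a c" "\<exists>c. box a b \<inter> {x. t < x \<bullet> i} = box c b"
proof -
  define u where "u = (\<Sum>j\<in>Basis. (if j = i then min (b \<bullet> i) t else b \<bullet> j) *\<^sub>R j)"
  have u: "u \<bullet> j = (if j = i then min (b \<bullet> i) t else b \<bullet> j)" if "j \<in> Basis" for j
    unfolding u_def using that by (rule inner_sum_left_Basis)
  have "box a b \<inter> {x. x \<bullet> i < t} = box a u" using i u by (auto simp: mem_box split: if_splits)
  then show "\<exists>c. box a b \<inter> {x. x \<bullet> i < t} = box a c" by blast
  define l where "l = (\<Sum>j\<in>Basis. (if j = i then max (a \<bullet> i) t else a \<bullet> j) *\<^sub>R j)"
  have l: "l \<bullet> j = (if j = i then max (a \<bullet> i) t else a \<bullet> j)" if "j \<in> Basis" for j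
    unfolding l_def using that by (rule inner_sum_left_Basis)
  have "box a b \<inter> {x. t < x \<bullet> i} = box l b" using i l by (auto simp: mem_box split: if_splits)
  then show "\<exists>c. box a b \<inter> {x. t < x \<bullet> i} = box c b" by blast
qed

text \<open>Empty pieces are dropped because members of a \<open>box_family\<close> are nonempty;
  this is also what lowers the number of boxes when some box misses \<open>H\<close>.\<close>

definition cut :: "'a set set \<Rightarrow> 'a set \<Rightarrow> 'a set set" where
  "cut P H = (\<lambda>Z. Z \<inter> H) ` P - {{}}"

lemma Union_cut: "\<Union>(cut P H) = \<Union>P \<inter> H"
  by (auto simp: cut_def)

lemma card_cut:
  assumes "finite P"
  shows "card (cut P H) \<le> card P" "Y \<in> P \<Longrightarrow> Y \<inter> H = {} \<Longrightarrow> card (cut P H) < card P"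
proof -
  have "card (cut P H) \<le> card ((\<lambda>Z. Z \<inter> H) ` P)"
    unfolding cut_def using assms by (intro card_mono) auto
  also have "\<dots> \<le> card P" using assms by (rule card_image_le)
  finally show "card (cut P H) \<le> card P" .
  assume Y: "Y \<in> P" "Y \<inter> H = {}"
  have "cut P H \<subseteq> (\<lambda>Z. Z \<inter> H) ` (P - {Y})" using Y by (auto simp: cut_def)
  then have "card (cut P H) \<le> card ((\<lambda>Z. Z \<inter> H) ` (P - {Y}))" using assms by (intro card_mono) auto
  also have "\<dots> \<le> card (P - {Y})" using assms by (intro card_image_le) auto
  also have "\<dots> < card P" using assms Y by (intro psubset_card_mono) auto
  finally show "card (cut P H) < card P" .
qed

lemma box_family_cut:
  assumes P: "box_family P" and i: "i \<in> Basis" and H: "H = {x. x \<bullet> i < t} \<or> H = {x. t < x \<bullet> i}"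
    and ne: "\<Union>P \<inter> H \<noteq> {}"
  shows "box_family (cut P H)"
  unfolding box_family_def
proof (intro conjI ballI)
  show "finite (cut P H)" using P by (auto simp: cut_def box_family_def)
  show "cut P H \<noteq> {}" using ne Union_cut by (metis Union_empty)
  fix X assume X: "X \<in> cut P H"
  then obtain Z where Z: "Z \<in> P" "X = Z \<inter> H" "X \<noteq> {}" unfolding cut_def by blast
  then obtain a b where "Z = box a b" using P unfolding box_family_def nbox_def by blast
  with Z have "X = box a b \<inter> H" "X \<noteq> {}" by auto
  then show "nbox X" using H box_halfspace[OF i] unfolding nbox_def by metis
next
  show "pairwise disjnt (cut P H)"
  proof (rule pairwiseI)
    fix X Y assume "X \<in> cut P H" "Y \<in> cut P H" "X \<noteq> Y"
    then obtain Z W where ZW: "Z \<in> P" "W \<in> P" "X = Z \<inter> H" "Y = W \<inter> H" by (auto simp: cut_def)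
    then have "Z \<noteq> W" using \<open>X \<noteq> Y\<close> by auto
    then have "disjnt Z W" using ZW P by (auto simp: box_family_def pairwise_def)
    then show "disjnt X Y" using ZW by (auto simp: disjnt_def)
  qed
qed

lemma halfspace_measure_split:
  fixes A :: "'a::euclidean_space set"
  assumes A: "open A" "bounded A" and i: "i \<in> Basis"
  shows "measure lebesgue A = measure lebesgue (A \<inter> {x. x \<bullet> i < t}) + measure lebesgue (A \<inter> {x. t < x \<bullet> i})"
proof -
  have i0: "i \<noteq> 0" using i nonzero_Basis by blast
  have o: "open {x. x \<bullet> i < t}" "open {x. t < x \<bullet> i}"
    by (auto intro!: open_Collect_less continuous_intros)
  have lm: "A \<inter> {x. x \<bullet> i < t} \<in> lmeasurable" "A \<inter> {x. t < x \<bullet> i} \<in> lmeasurable"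
    using A o by (auto intro!: lmeasurable_open open_Int bounded_Int)
  have neg: "negligible {x. i \<bullet> x = t}" using negligible_hyperplane i0 by blast
  have "measure lebesgue A = measure lebesgue ((A \<inter> {x. x \<bullet> i < t}) \<union> (A \<inter> {x. t < x \<bullet> i}))"
  proof (rule measure_negligible_symdiff[symmetric])
    show "A \<in> lmeasurable" using A open_bounded_measure by blast
    show "negligible (A - (A \<inter> {x. x \<bullet> i < t} \<union> A \<inter> {x. t < x \<bullet> i})
      \<union> (A \<inter> {x. x \<bullet> i < t} \<union> A \<inter> {x. t < x \<bullet> i} - A))"
      by (rule negligible_subset[OF neg]) (auto simp: inner_commute)
  qed
  moreover have "(A \<inter> {x. x \<bullet> i < t}) \<inter> (A \<inter> {x. t < x \<bullet> i}) = {}" by auto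
  ultimately show ?thesis unfolding measure_Un3[OF lm] by simp
qed

text \<open>The volume below level t is Lipschitz in t: raising t adds at most a slab of the
  bounding cube, whose cross-section has volume \<open>C\<close>. The intermediate value theorem
  then reaches every fraction.\<close>

lemma halfspace_fraction:
  fixes B :: "'a::euclidean_space set"
  assumes B: "open B" "bounded B" and i: "i \<in> Basis" and \<theta>: "0 \<le> \<theta>" "\<theta> \<le> 1"
  obtains t where "measure lebesgue (B \<inter> {x. x \<bullet> i < t}) = \<theta> * measure lebesgue B"
proof -
  obtain R where R: "0 < R" "\<And>x. x \<in> B \<Longrightarrow> norm x < R"
    using B(2) bounded_pos_less by metis
  define f where "f t = measure lebesgue (B \<inter> {x. x \<bullet> i < t})" for t
  have o: "open {x. x \<bullet> i < t}" for t
    by (auto intro!: open_Collect_less continuous_intros)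
  have lm: "B \<inter> {x. x \<bullet> i < t} \<in> lmeasurable" for t
    using B o by (auto intro!: lmeasurable_open open_Int bounded_Int)
  define C where "C = (2 * R) ^ (DIM('a) - 1)"
  have lip: "f s \<le> f t" "f t - f s \<le> C * (t - s)" if "s \<le> t" for s t
  proof -
    show "f s \<le> f t" unfolding f_def using that lm by (intro measure_mono_fmeasurable) auto
    define l where "l = (\<Sum>j\<in>Basis. (if j = i then s else - R) *\<^sub>R j)"
    define u where "u = (\<Sum>j\<in>Basis. (if j = i then t else R) *\<^sub>R j)"
    have lu: "l \<bullet> j = (if j = i then s else - R)" "u \<bullet> j = (if j = i then t else R)" if "j \<in> Basis" for j
      unfolding l_def u_def by (rule inner_sum_left_Basis[OF that])+
    have "\<bar>x \<bullet> j\<bar> \<le> R" if "x \<in> B" "j \<in> Basis" for x j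
      using Basis_le_norm[OF that(2), of x] R(2)[OF that(1)] by linarith
    then have bd: "- R \<le> x \<bullet> j" "x \<bullet> j \<le> R" if "x \<in> B" "j \<in> Basis" for x j
      using that by (force simp: abs_le_iff)+
    have "x \<in> cbox l u" if "x \<in> B" "x \<bullet> i < t" "\<not> x \<bullet> i < s" for x
      unfolding mem_box using that bd[of x] by (auto simp: lu)
    then have sub: "B \<inter> {x. x \<bullet> i < t} \<subseteq> (B \<inter> {x. x \<bullet> i < s}) \<union> cbox l u"
      by blast
    have "f t \<le> measure lebesgue ((B \<inter> {x. x \<bullet> i < s}) \<union> cbox l u)"
      unfolding f_def using lm sub by (intro measure_mono_fmeasurable) (auto intro: fmeasurable.Un)
    also have "\<dots> \<le> f s + measure lebesgue (cbox l u)"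
      unfolding f_def using lm by (intro measure_Un_le) auto
    also have "measure lebesgue (cbox l u) = (\<Prod>j\<in>Basis. (u - l) \<bullet> j)"
      using that R by (simp add: measure_lborel_cbox_eq lu inner_diff_left)
    also have "\<dots> = (\<Prod>j\<in>Basis. if j = i then t - s else 2 * R)"
      by (intro prod.cong) (auto simp: lu inner_diff_left)
    also have "\<dots> = C * (t - s)"
      by (subst prod.remove[OF finite_Basis i]) (simp add: C_def i)
    finally show "f t - f s \<le> C * (t - s)" by simp
  qed
  have "continuous_on {- R..R} f"
  proof (rule lipschitz_on_continuous_on, rule lipschitz_onI)
    show "0 \<le> C" using R by (simp add: C_def)
    fix s t
    show "dist (f s) (f t) \<le> C * dist s t"
      using lip[of s t] lip[of t s] by (cases "s \<le> t") (auto simp: dist_real_def)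
  qed
  moreover have bd: "\<bar>x \<bullet> i\<bar> < R" if "x \<in> B" for x
    using R(2)[OF that] Basis_le_norm[OF i, of x] by linarith
  moreover have "f (- R) = 0"
  proof -
    have "B \<inter> {x. x \<bullet> i < - R} = {}"
      using bd by (force simp: abs_less_iff)
    then show ?thesis by (simp add: f_def)
  qed
  moreover have "f R = measure lebesgue B"
  proof -
    have "B \<inter> {x. x \<bullet> i < R} = B"
      using bd by (force simp: abs_less_iff)
    then show ?thesis by (simp add: f_def)
  qed
  ultimately have "\<exists>t\<ge>- R. t \<le> R \<and> f t = \<theta> * measure lebesgue B"
    using R \<theta> by (intro IVT') (auto simp: mult_left_le_one_le)
  then show thesis using that by (auto simp: f_def)
qed

text \<open>The induction of Hadwiger and Ohmann: a hyperplane separating two boxes of \<open>P\<close> and a parallel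
  one splitting \<open>Q\<close> in the same ratio reduce the number of boxes, and the two partial sums lie on
  different sides of a hyperplane.\<close>

lemma BM_step:
  fixes P Q :: "'a::euclidean_space set set"
  assumes IH: "\<And>P' Q' :: 'a set set. box_family P' \<Longrightarrow> box_family Q' \<Longrightarrow> card P' + card Q' < card P + card Q \<Longrightarrow>
      (measure lebesgue (\<Union>P') powr (1 / DIM('a)) + measure lebesgue (\<Union>Q') powr (1 / DIM('a))) ^ DIM('a)
        \<le> measure lebesgue (msum (\<Union>P') (\<Union>Q'))"
    and P: "box_family P" and Q: "box_family Q" and card: "2 \<le> card P"
  shows "(measure lebesgue (\<Union>P) powr (1 / DIM('a)) + measure lebesgue (\<Union>Q) powr (1 / DIM('a))) ^ DIM('a)
        \<le> measure lebesgue (msum (\<Union>P) (\<Union>Q))"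
proof -
  note PU = box_family_Union[OF P] and QU = box_family_Union[OF Q]
  have fin: "finite P" "finite Q" using P Q by (auto simp: box_family_def)
  obtain X Y where XY: "X \<in> P" "Y \<in> P" "X \<noteq> Y"
    using card by (metis card_le_Suc0_iff_eq fin(1) not_less_eq_eq numeral_2_eq_2)
  obtain a b c d where bx: "X = box a b" "Y = box c d" "X \<noteq> {}" "Y \<noteq> {}"
    using XY P by (metis box_family_def nbox_def)
  have "X \<inter> Y = {}" using XY P by (auto simp: box_family_def pairwise_def disjnt_def)
  then obtain i where i: "i \<in> Basis" "b \<bullet> i \<le> a \<bullet> i \<or> d \<bullet> i \<le> c \<bullet> i \<or> b \<bullet> i \<le> c \<bullet> i \<or> d \<bullet> i \<le> a \<bullet> i"
    unfolding bx disjoint_interval by blast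
  have "a \<bullet> i < b \<bullet> i" "c \<bullet> i < d \<bullet> i" using bx(3,4) i(1) unfolding bx by (auto simp: box_ne_empty)
  then have sep: "b \<bullet> i \<le> c \<bullet> i \<or> d \<bullet> i \<le> a \<bullet> i" using i(2) by linarith
  \<comment> \<open>The hyperplane runs along the upper face of whichever of the two boxes lies
    lower in coordinate i.\<close>
  define s where "s = (if b \<bullet> i \<le> c \<bullet> i then b \<bullet> i else d \<bullet> i)"
  let ?lo = "\<lambda>t. {x::'a. x \<bullet> i < t}" and ?hi = "\<lambda>t. {x::'a. t < x \<bullet> i}"
  have side: "(X \<subseteq> ?lo s \<and> Y \<subseteq> ?hi s) \<or> (Y \<subseteq> ?lo s \<and> X \<subseteq> ?hi s)"
  proof (cases "b \<bullet> i \<le> c \<bullet> i")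
    case True
    then have "X \<subseteq> ?lo s" "Y \<subseteq> ?hi s" using i(1) unfolding bx s_def
      by (auto simp: mem_box intro: le_less_trans)
    then show ?thesis by blast
  next
    case False
    then have "Y \<subseteq> ?lo s" "X \<subseteq> ?hi s" using i(1) sep unfolding bx s_def
      by (auto simp: mem_box intro: le_less_trans)
    then show ?thesis by blast
  qed
  then have neP: "\<Union>P \<inter> ?lo s \<noteq> {}" "\<Union>P \<inter> ?hi s \<noteq> {}" using XY bx(3,4) by blast+
  have cP: "card (cut P (?lo s)) < card P" "card (cut P (?hi s)) < card P"
  proof -
    have "?lo s \<inter> ?hi s = {}" by auto
    then have "Y \<inter> ?lo s = {} \<or> X \<inter> ?lo s = {}" "X \<inter> ?hi s = {} \<or> Y \<inter> ?hi s = {}" using side by blast+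
    then show "card (cut P (?lo s)) < card P" "card (cut P (?hi s)) < card P"
      using card_cut(2)[OF fin(1)] XY by blast+
  qed
  define vP vQ where "vP = measure lebesgue (\<Union>P)" and "vQ = measure lebesgue (\<Union>Q)"
  have o: "open (?lo t)" "open (?hi t)" for t by (auto intro!: open_Collect_less continuous_intros)
  have v: "0 < vP" "0 < vQ"
    unfolding vP_def vQ_def using PU QU by (intro open_bounded_measure(2); blast)+
  define \<theta> where "\<theta> = measure lebesgue (\<Union>P \<inter> ?lo s) / vP"
  have plo: "measure lebesgue (\<Union>P \<inter> ?lo s) = \<theta> * vP" using v by (simp add: \<theta>_def)
  have phi: "measure lebesgue (\<Union>P \<inter> ?hi s) = (1 - \<theta>) * vP"
    using halfspace_measure_split[OF PU(1,2) i(1), of s] plo by (simp add: vP_def algebra_simps)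
  have "0 < measure lebesgue (\<Union>P \<inter> ?lo s)" "0 < measure lebesgue (\<Union>P \<inter> ?hi s)"
    using neP PU o by (intro open_bounded_measure(2) open_Int bounded_Int; blast)+
  then have \<theta>: "0 < \<theta>" "\<theta> < 1" using plo phi v by (auto simp: zero_less_mult_iff)
  obtain t where qlo: "measure lebesgue (\<Union>Q \<inter> ?lo t) = \<theta> * vQ"
    using halfspace_fraction[OF QU(1,2) i(1), of \<theta>] \<theta> by (auto simp: vQ_def)
  have qhi: "measure lebesgue (\<Union>Q \<inter> ?hi t) = (1 - \<theta>) * vQ"
    using halfspace_measure_split[OF QU(1,2) i(1), of t] qlo by (simp add: vQ_def algebra_simps)
  have neQ: "\<Union>Q \<inter> ?lo t \<noteq> {}" "\<Union>Q \<inter> ?hi t \<noteq> {}"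
    using qlo qhi \<theta> v by (metis measure_empty mult_eq_0_iff less_irrefl diff_gt_0_iff_gt)+
  let ?n = "DIM('a)"
  define M where "M = (vP powr (1 / ?n) + vQ powr (1 / ?n)) ^ ?n"
  \<comment> \<open>The Brunn--Minkowski bound is homogeneous of degree 1 in the pair of volumes.
    Cutting both families in the same ratio therefore gives the shares \<theta> and 1 - \<theta> of
    the full bound, which add up to it.\<close>
  have scale: "((\<eta> * vP) powr (1 / ?n) + (\<eta> * vQ) powr (1 / ?n)) ^ ?n = \<eta> * M" if "0 < \<eta>" for \<eta>
  proof -
    have "(\<eta> * vP) powr (1 / ?n) + (\<eta> * vQ) powr (1 / ?n) = \<eta> powr (1 / ?n) * (vP powr (1 / ?n) + vQ powr (1 / ?n))"
      using that v by (simp add: powr_mult distrib_left)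
    moreover have "(\<eta> powr (1 / ?n)) ^ ?n = \<eta>" using that by (simp add: powr_realpow[symmetric] powr_powr)
    ultimately show ?thesis by (simp add: M_def power_mult_distrib)
  qed
  have lo: "\<theta> * M \<le> measure lebesgue (msum (\<Union>P \<inter> ?lo s) (\<Union>Q \<inter> ?lo t))"
    using IH[OF box_family_cut[OF P i(1) _ neP(1)] box_family_cut[OF Q i(1) _ neQ(1)]]
      cP(1) card_cut(1)[OF fin(2), of "?lo t"] scale[OF \<theta>(1)]
    unfolding Union_cut plo qlo by auto
  have hi: "(1 - \<theta>) * M \<le> measure lebesgue (msum (\<Union>P \<inter> ?hi s) (\<Union>Q \<inter> ?hi t))"
    using IH[OF box_family_cut[OF P i(1) _ neP(2)] box_family_cut[OF Q i(1) _ neQ(2)]]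
      cP(2) card_cut(1)[OF fin(2), of "?hi t"] scale[of "1 - \<theta>"] \<theta>
    unfolding Union_cut phi qhi by auto
  let ?S = "msum (\<Union>P) (\<Union>Q)"
  have S: "open ?S" "bounded ?S" using PU QU open_msum bounded_msum by blast+
  have "measure lebesgue (msum (\<Union>P \<inter> ?lo s) (\<Union>Q \<inter> ?lo t)) \<le> measure lebesgue (?S \<inter> ?lo (s + t))"
    using S o PU QU
    by (intro measure_mono_fmeasurable lmeasurable_open open_Int bounded_Int fmeasurableD[OF lmeasurable_open] open_msum bounded_msum)
      (auto simp: in_msum inner_add_left intro!: add_strict_mono, blast)
  moreover have "measure lebesgue (msum (\<Union>P \<inter> ?hi s) (\<Union>Q \<inter> ?hi t)) \<le> measure lebesgue (?S \<inter> ?hi (s + t))"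
    using S o PU QU
    by (intro measure_mono_fmeasurable lmeasurable_open open_Int bounded_Int fmeasurableD[OF lmeasurable_open] open_msum bounded_msum)
      (auto simp: in_msum inner_add_left intro!: add_strict_mono, blast)
  ultimately have "\<theta> * M + (1 - \<theta>) * M \<le> measure lebesgue ?S"
    using lo hi halfspace_measure_split[OF S i(1), of "s + t"] by linarith
  then show ?thesis by (simp add: M_def vP_def vQ_def algebra_simps)
qed

lemma BM_families:
  fixes P Q :: "'a::euclidean_space set set"
  assumes "box_family P" "box_family Q"
  shows "(measure lebesgue (\<Union>P) powr (1 / DIM('a)) + measure lebesgue (\<Union>Q) powr (1 / DIM('a))) ^ DIM('a)
        \<le> measure lebesgue (msum (\<Union>P) (\<Union>Q))"
  using assms
proof (induction "card P + card Q" arbitrary: P Q rule: less_induct)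
  case less
  have card: "1 \<le> card P" "1 \<le> card Q" using less.prems by (auto simp: box_family_def Suc_le_eq card_gt_0_iff)
  consider "2 \<le> card P" | "2 \<le> card Q" | "card P = 1" "card Q = 1" using card by linarith
  then show ?case
  proof cases
    case 1
    show ?thesis by (rule BM_step[OF less.hyps less.prems 1])
  next
    case 2
    have "(measure lebesgue (\<Union>Q) powr (1 / DIM('a)) + measure lebesgue (\<Union>P) powr (1 / DIM('a))) ^ DIM('a)
        \<le> measure lebesgue (msum (\<Union>Q) (\<Union>P))"
      by (rule BM_step[OF _ less.prems(2,1) 2]) (simp add: less.hyps)
    then show ?thesis by (simp add: msum_commute add.commute)
  next
    case 3
    then obtain X Y where "P = {X}" "Q = {Y}" by (auto simp: card_1_singleton_iff)
    then show ?thesis using BM_box less.prems by (simp add: box_family_def)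
  qed
qed

text \<open>A compact subset of nearly full volume is covered by finitely many boxes inside A. The
  closed boxes are refined to a division, whose interiors are disjoint open boxes; only frontiers, a
  null set, are lost.\<close>

lemma open_inner_boxes:
  fixes A :: "'a::euclidean_space set"
  assumes A: "open A" "bounded A" "A \<noteq> {}" and \<epsilon>: "0 < \<epsilon>" "\<epsilon> < measure lebesgue A"
  obtains P where "box_family P" "\<Union>P \<subseteq> A" "measure lebesgue A - \<epsilon> \<le> measure lebesgue (\<Union>P)"
proof -
  have Al: "A \<in> lmeasurable" using A open_bounded_measure by blast
  obtain T where T: "closed T" "T \<subseteq> A" "A - T \<in> lmeasurable" "emeasure lebesgue (A - T) < ennreal \<epsilon>"
    using sets_lebesgue_inner_closed[OF fmeasurableD[OF Al] \<epsilon>(1)] by metis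
  have cT: "compact T" using T A(2) bounded_subset compact_eq_bounded_closed by metis
  have Tl: "T \<in> lmeasurable" using cT by (rule lmeasurable_compact)
  have mT: "measure lebesgue A - \<epsilon> < measure lebesgue T"
  proof -
    have "measure lebesgue (A - T) < \<epsilon>"
    proof -
      have "emeasure lebesgue (A - T) \<noteq> \<infinity>" using T(4) by auto
      then show ?thesis using T(4) by (simp add: emeasure_eq_ennreal_measure ennreal_less_iff)
    qed
    moreover have "measure lebesgue (A - T) = measure lebesgue A - measure lebesgue T"
      using Al Tl T(2) by (intro measurable_measure_Diff) auto
    ultimately show ?thesis by linarith
  qed
  have "\<forall>x\<in>T. \<exists>l u. x \<in> box l u \<and> cbox l u \<subseteq> A"
  proof
    fix x assume "x \<in> T"
    then have "x \<in> A" using T by blast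
    then show "\<exists>l u. x \<in> box l u \<and> cbox l u \<subseteq> A" using open_contains_cbox[of A x] A(1) by metis
  qed
  then obtain l u where lu: "\<And>x. x \<in> T \<Longrightarrow> x \<in> box (l x) (u x) \<and> cbox (l x) (u x) \<subseteq> A" by metis
  obtain D where D: "D \<subseteq> T" "finite D" "T \<subseteq> (\<Union>x\<in>D. box (l x) (u x))"
    using compactE_image[OF cT, of T "\<lambda>x. box (l x) (u x)"] lu by (metis (no_types, lifting) UN_I open_box subsetI)
  obtain p where p: "p division_of (\<Union>x\<in>D. cbox (l x) (u x))"
    using elementary_unions_intervals[of "(\<lambda>x. cbox (l x) (u x)) ` D"] D(2) by auto
  define P where "P = interior ` p - {{}}"
  note dp = division_ofD[OF p]
  have "(\<Union>x\<in>D. box (l x) (u x)) \<subseteq> (\<Union>x\<in>D. cbox (l x) (u x))"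
    by (intro UN_mono subset_refl box_subset_cbox)
  then have T': "T \<subseteq> \<Union>p" unfolding dp(6) using D(3) by (rule subset_trans[rotated])
  have "negligible (\<Union>(frontier ` p))"
  proof (rule negligible_Union)
    show "finite (frontier ` p)" using dp(1) by simp
    fix S assume "S \<in> frontier ` p"
    then obtain K where "K \<in> p" "S = frontier K" by blast
    then show "negligible S" using dp(4) negligible_convex_frontier convex_box(1) by metis
  qed
  then have N: "\<Union>(frontier ` p) \<in> lmeasurable" "measure lebesgue (\<Union>(frontier ` p)) = 0"
    by (auto simp: negligible_imp_measurable negligible_imp_measure0)
  have sub: "T \<subseteq> \<Union>P \<union> \<Union>(frontier ` p)"
  proof
    fix x assume "x \<in> T"
    then obtain K where K: "K \<in> p" "x \<in> K" using T' by blast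
    then have "x \<in> interior K \<or> x \<in> frontier K" using closure_subset by (auto simp: frontier_def)
    then show "x \<in> \<Union>P \<union> \<Union>(frontier ` p)" using K by (auto simp: P_def)
  qed
  have PA: "\<Union>P \<subseteq> A"
  proof -
    have "\<Union>P \<subseteq> \<Union>p" using interior_subset by (auto simp: P_def)
    also have "\<dots> \<subseteq> A" using dp(6) lu D(1) by blast
    finally show ?thesis .
  qed
  have PU: "open (\<Union>P)" "bounded (\<Union>P)" using PA A(2) bounded_subset by (auto simp: P_def)
  have "measure lebesgue T \<le> measure lebesgue (\<Union>P \<union> \<Union>(frontier ` p))"
    using sub Tl N(1) open_bounded_measure(1)[OF PU] by (intro measure_mono_fmeasurable fmeasurable.Un) auto
  also have "\<dots> \<le> measure lebesgue (\<Union>P) + measure lebesgue (\<Union>(frontier ` p))"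
    using N(1) open_bounded_measure(1)[OF PU] by (intro measure_Un_le) auto
  finally have le: "measure lebesgue A - \<epsilon> \<le> measure lebesgue (\<Union>P)" using mT N(2) by linarith
  have "box_family P"
    unfolding box_family_def
  proof (intro conjI ballI)
    show "finite P" using dp(1) by (simp add: P_def)
    show "P \<noteq> {}" using le \<epsilon>(2) by auto
    show "nbox X" if "X \<in> P" for X
      using that dp(4) by (auto simp: P_def nbox_def) (metis interior_cbox)
    show "pairwise disjnt P"
      using dp(5) by (auto simp: P_def pairwise_def disjnt_def)
  qed
  then show thesis using that PA le by blast
qed

text \<open>Approximation from inside suffices: it shrinks the sum set as well, so the bound for
  boxes carries over and only the left side has to converge.\<close>

theorem Brunn_Minkowski:
  fixes A B :: "'a::euclidean_space set"
  assumes A: "open A" "bounded A" "A \<noteq> {}" and B: "open B" "bounded B" "B \<noteq> {}"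
  shows "(measure lebesgue A powr (1 / DIM('a)) + measure lebesgue B powr (1 / DIM('a))) ^ DIM('a)
    \<le> measure lebesgue (msum A B)"
proof -
  let ?a = "measure lebesgue A" and ?b = "measure lebesgue B"
  have pos: "0 < ?a" "0 < ?b" using open_bounded_measure(2) A B by blast+
  have le: "((?a - \<epsilon>) powr (1 / DIM('a)) + (?b - \<epsilon>) powr (1 / DIM('a))) ^ DIM('a) \<le> measure lebesgue (msum A B)"
    if \<epsilon>: "0 < \<epsilon>" "\<epsilon> < min ?a ?b" for \<epsilon>
  proof -
    obtain P where P: "box_family P" "\<Union>P \<subseteq> A" "?a - \<epsilon> \<le> measure lebesgue (\<Union>P)"
      using open_inner_boxes[OF A, of \<epsilon>] \<epsilon> by auto
    obtain Q where Q: "box_family Q" "\<Union>Q \<subseteq> B" "?b - \<epsilon> \<le> measure lebesgue (\<Union>Q)"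
      using open_inner_boxes[OF B, of \<epsilon>] \<epsilon> by auto
    have "((?a - \<epsilon>) powr (1 / DIM('a)) + (?b - \<epsilon>) powr (1 / DIM('a))) ^ DIM('a)
        \<le> (measure lebesgue (\<Union>P) powr (1 / DIM('a)) + measure lebesgue (\<Union>Q) powr (1 / DIM('a))) ^ DIM('a)"
      using P Q \<epsilon> by (intro power_mono add_mono powr_mono2) auto
    also have "\<dots> \<le> measure lebesgue (msum (\<Union>P) (\<Union>Q))" by (rule BM_families[OF P(1) Q(1)])
    also have "\<dots> \<le> measure lebesgue (msum A B)"
      using msum_mono[OF P(2) Q(2)] A B box_family_Union[OF P(1)] box_family_Union[OF Q(1)]
      by (intro measure_mono_fmeasurable lmeasurable_open fmeasurableD[OF lmeasurable_open] open_msum bounded_msum) auto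
    finally show ?thesis .
  qed
  have "((\<lambda>\<epsilon>. ((?a - \<epsilon>) powr (1 / DIM('a)) + (?b - \<epsilon>) powr (1 / DIM('a))) ^ DIM('a)) \<longlongrightarrow>
      ((?a - 0) powr (1 / DIM('a)) + (?b - 0) powr (1 / DIM('a))) ^ DIM('a)) (at_right 0)"
    using pos by (intro tendsto_intros) auto
  moreover have "\<forall>\<^sub>F \<epsilon> in at_right 0. ((?a - \<epsilon>) powr (1 / DIM('a)) + (?b - \<epsilon>) powr (1 / DIM('a))) ^ DIM('a) \<le> measure lebesgue (msum A B)"
    using le pos by (intro eventually_at_rightI[of 0 "min ?a ?b"]) auto
  ultimately show ?thesis by (intro tendsto_upperbound[of _ _ "at_right (0::real)"]) auto
qed

subsection \<open>The Saint-Venant inequality\<close>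

text \<open>Both inequalities are strict so that the set is open for continuous f, as
  \<open>Brunn_Minkowski\<close> requires. By Tonelli its volume is the integral of f for
  nonnegative f.\<close>

definition hypo :: "('a \<Rightarrow> real) \<Rightarrow> ('a \<times> real) set" where
  "hypo f = {z. 0 < snd z \<and> snd z < f (fst z)}"

lemma measure_hypo:
  fixes f :: "'a::euclidean_space \<Rightarrow> real"
  assumes int: "integrable lborel f" and nn: "\<And>x. 0 \<le> f x" and [measurable]: "f \<in> borel_measurable borel"
  shows "hypo f \<in> sets borel" "emeasure lborel (hypo f) = ennreal (LINT x|lborel. f x)"
    "measure lebesgue (hypo f) = (LINT x|lborel. f x)" "hypo f \<in> lmeasurable"
proof -
  have "{z \<in> space (borel \<Otimes>\<^sub>M borel). 0 < snd z \<and> snd z < f (fst z)} \<in> sets (borel \<Otimes>\<^sub>M borel)"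
    by measurable
  then have "hypo f \<in> sets (borel \<Otimes>\<^sub>M borel)"
    by (simp add: hypo_def space_pair_measure)
  note prod_meas = this
  moreover have "sets (borel \<Otimes>\<^sub>M borel) = sets (borel :: ('a \<times> real) measure)"
    by (simp only: borel_prod)
  ultimately show b: "hypo f \<in> sets borel" by simp
  have "emeasure lborel (hypo f) = emeasure (lborel \<Otimes>\<^sub>M lborel) (hypo f)"
    by (simp add: lborel_prod)
  also have "\<dots> = (\<integral>\<^sup>+x. emeasure lborel (Pair x -` hypo f) \<partial>lborel)"
    by (rule lborel.emeasure_pair_measure_alt)
      (use prod_meas sets_pair_measure_cong[OF sets_lborel sets_lborel] in blast)
  also have "\<dots> = (\<integral>\<^sup>+x. ennreal (f x) \<partial>lborel)"
  proof (rule nn_integral_cong)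
    fix x
    have "Pair x -` hypo f = {0<..<f x}" by (auto simp: hypo_def)
    then show "emeasure lborel (Pair x -` hypo f) = ennreal (f x)" using nn[of x] by simp
  qed
  also have "\<dots> = ennreal (LINT x|lborel. f x)"
    using nn int by (intro nn_integral_eq_integral) auto
  finally show e: "emeasure lborel (hypo f) = ennreal (LINT x|lborel. f x)" .
  have nnI: "0 \<le> (LINT x|lborel. f x)" using nn by simp
  show "measure lebesgue (hypo f) = (LINT x|lborel. f x)"
    using b e nnI by (simp add: measure_def)
  show "hypo f \<in> lmeasurable"
    using b e by (auto simp: fmeasurable_def)
qed

lemma open_hypo:
  fixes f :: "'a::euclidean_space \<Rightarrow> real"
  assumes "continuous_on UNIV f"
  shows "open (hypo f)"
proof -
  have "continuous_on UNIV (\<lambda>z::'a \<times> real. f (fst z))"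
    by (rule continuous_on_compose2[OF assms]) (auto intro: continuous_intros)
  then show ?thesis
    unfolding hypo_def by (intro open_Collect_conj open_Collect_less continuous_intros)
qed

lemma bounded_hypo:
  fixes f :: "'a::euclidean_space \<Rightarrow> real"
  assumes c: "continuous_on UNIV f" and K: "compact K" "\<And>x. x \<notin> K \<Longrightarrow> f x \<le> 0"
  shows "bounded (hypo f)"
proof -
  have "compact (f ` K)" using c K by (intro compact_continuous_image) (auto intro: continuous_on_subset)
  then obtain M where "\<forall>y\<in>f ` K. norm y \<le> M" using compact_imp_bounded bounded_iff by blast
  then have M: "f x \<le> M" if "x \<in> K" for x using that by fastforce
  have "hypo f \<subseteq> K \<times> {0..M}"
  proof
    fix z assume "z \<in> hypo f"
    then have z: "0 < snd z" "snd z < f (fst z)" by (auto simp: hypo_def)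
    then have "fst z \<in> K" using K(2)[of "fst z"] by force
    then show "z \<in> K \<times> {0..M}" using z M[of "fst z"] by (cases z) auto
  qed
  then show ?thesis
    using bounded_Times[OF compact_imp_bounded[OF K(1)] bounded_closed_interval[of 0 M]] bounded_subset
    by blast
qed

text \<open>Up to \<open>Saint_Venant\<close>, q stands for the exponent conjugate to p and not for
  the power of the torsion in \<open>F\<close>. With this choice w = \<open>profile q R\<close>
  satisfies |grad w|^(p-2) grad w = -y in the ball, a field of divergence -d, so w is a multiple of
  the p-torsion function.\<close>

definition profile :: "real \<Rightarrow> real \<Rightarrow> 'a::euclidean_space \<Rightarrow> real" where
  "profile q R y = max 0 ((R powr q - norm y powr q) / q)"

definition profile_mass :: "'a::euclidean_space itself \<Rightarrow> real \<Rightarrow> real \<Rightarrow> real" where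
  "profile_mass _ q R = (LINT y|lborel. profile q R (y::'a))"

lemma profile_props:
  fixes y :: "'a::euclidean_space"
  assumes "1 < q" "0 < R"
  shows "0 \<le> profile q R y" "continuous_on UNIV (profile q R :: 'a \<Rightarrow> real)"
    "R \<le> norm y \<Longrightarrow> profile q R y = 0"
    "norm y \<le> R \<Longrightarrow> profile q R y = (R powr q - norm y powr q) / q"
    "0 < profile q R y \<Longrightarrow> norm y < R"
    "integrable lborel (profile q R :: 'a \<Rightarrow> real)"
proof -
  show "0 \<le> profile q R y" by (simp add: profile_def)
  show c: "continuous_on UNIV (profile q R :: 'a \<Rightarrow> real)"
    unfolding profile_def using assms by (intro continuous_intros continuous_on_powr') auto
  show z: "profile q R y = 0" if "R \<le> norm y" for y :: 'a
  proof -
    have "(R powr q - norm y powr q) / q \<le> 0"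
      using that assms powr_mono2[of q R "norm y"] by (intro divide_nonpos_pos) auto
    then show ?thesis by (simp add: profile_def max_absorb1)
  qed
  show "profile q R y = (R powr q - norm y powr q) / q" if "norm y \<le> R"
    using that assms powr_mono2[of q "norm y" R] by (simp add: profile_def)
  show "norm y < R" if "0 < profile q R y" using that z[of y] by force
  show "integrable lborel (profile q R :: 'a \<Rightarrow> real)"
    by (rule integrable_compact_support[OF c compact_cball[of 0 R]]) (auto intro: z)
qed

lemma profile_mass_scale:
  assumes "1 < q" "0 < R"
  shows "profile_mass TYPE('a::euclidean_space) q R = R powr (real DIM('a) + q) * profile_mass TYPE('a) q 1"
proof -
  have [measurable]: "(profile q R :: 'a \<Rightarrow> real) \<in> borel_measurable borel"
    using profile_props(2)[OF assms] by (rule borel_measurable_continuous_onI)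
  have "profile q R (R *\<^sub>R y + 0) = R powr q * profile q 1 y" for y :: 'a
  proof -
    have "R powr q * max 0 ((1 - norm y powr q) / q) = max (R powr q * 0) (R powr q * ((1 - norm y powr q) / q))"
      by (rule max_mult_distrib_left[THEN trans]) simp
    also have "\<dots> = max 0 ((R powr q - (R * norm y) powr q) / q)"
      using assms by (simp add: powr_mult right_diff_distrib)
    finally show ?thesis using assms by (simp add: profile_def)
  qed
  then have "R powr q * profile_mass TYPE('a) q 1 = (LINT y|lborel. profile q R (R *\<^sub>R y + (0::'a)))"
    by (simp add: profile_mass_def)
  also have "\<dots> = R powr (- real DIM('a)) * profile_mass TYPE('a) q R"
    unfolding profile_mass_def by (rule integral_lborel_affine[OF _ assms(2)]) measurable
  finally have "R powr real DIM('a) * (R powr q * profile_mass TYPE('a) q 1)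
      = R powr real DIM('a) * (R powr (- real DIM('a)) * profile_mass TYPE('a) q R)" by simp
  then show ?thesis using assms by (simp add: mult.assoc[symmetric] powr_add[symmetric])
qed

lemma ball_convex_domain: "0 < r \<Longrightarrow> ball (c::'a::euclidean_space) r \<in> convex_domains"
  by (auto simp: convex_domains_def)

lemma measure_ball:
  assumes "0 < r"
  shows "measure lebesgue (ball (c::'a::euclidean_space) r) = r powr real DIM('a) * measure lebesgue (ball (0::'a) 1)"
proof -
  have "ball c r = (\<lambda>x. r *\<^sub>R x + c) ` ball 0 1"
  proof
    show "ball c r \<subseteq> (\<lambda>x. r *\<^sub>R x + c) ` ball 0 1"
    proof
      fix x assume x: "x \<in> ball c r"
      have "norm (inverse r *\<^sub>R (x - c)) = norm (x - c) / r"
        using assms by (simp add: divide_inverse)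
      then have "inverse r *\<^sub>R (x - c) \<in> ball 0 1"
        using x assms by (simp add: dist_norm norm_minus_commute)
      moreover have "x = r *\<^sub>R (inverse r *\<^sub>R (x - c)) + c" using assms by simp
      ultimately show "x \<in> (\<lambda>x. r *\<^sub>R x + c) ` ball 0 1" by blast
    qed
    show "(\<lambda>x. r *\<^sub>R x + c) ` ball 0 1 \<subseteq> ball c r"
      using assms by (auto simp: dist_norm)
  qed
  then show ?thesis using measure_affine[OF assms, of c "ball 0 1"] by simp
qed

text \<open>Evaluates the integral without polar coordinates. By scaling, the integral for radius R
  is R^(d+q) times the one for radius 1, so its derivative at R = 1 has the factor d + q; on the
  other hand the R-derivative of the profile is R^(q-1) on the ball, which gives the volume of the
  unit ball.\<close>

lemma profile_mass_unit:
  assumes q: "1 < q"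
  shows "(real DIM('a::euclidean_space) + q) * profile_mass TYPE('a) q 1 = measure lebesgue (ball (0::'a) 1)"
proof -
  let ?d = "real DIM('a)" and ?\<omega> = "measure lebesgue (ball (0::'a) 1)" and ?\<kappa> = "profile_mass TYPE('a) q 1"
  have fin: "integrable lborel (indicator (ball (0::'a) R) :: 'a \<Rightarrow> real)" for R
    using emeasure_bounded_finite[OF bounded_ball, of "0::'a" R] by (intro integrable_real_indicator) auto
  have ind: "(LINT y|lborel. c * indicator (ball (0::'a) R) y) = c * measure lebesgue (ball (0::'a) R)" for c R :: real
    by simp
  \<comment> \<open>Raising the radius from 1 to R adds (R^q - 1)/q on the unit ball, and between 0
    and this amount on the rest of the larger ball. Dividing by R - 1 and letting R tend to 1
    squeezes the derivative.\<close>
  have bounds: "?\<omega> * ((R powr q - 1) / q) \<le> (R powr (?d + q) - 1) * ?\<kappa>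
      \<and> (R powr (?d + q) - 1) * ?\<kappa> \<le> ?\<omega> * (R powr ?d * ((R powr q - 1) / q))" if R: "1 < R" for R
  proof -
    note P1 = profile_props[OF q zero_less_one, where 'a='a] and PR = profile_props[OF q, of R, where 'a='a]
    have R0: "0 < R" and h: "0 \<le> (R powr q - 1) / q" using R q by (auto simp: ge_one_powr_ge_zero)
    have eq: "(R powr (?d + q) - 1) * ?\<kappa> = (LINT y|lborel. profile q R y - profile q 1 (y::'a))"
      using profile_mass_scale[OF q R0, where 'a='a] PR(6)[OF R0] P1(6)
      by (simp add: profile_mass_def left_diff_distrib)
    have diffint: "integrable lborel (\<lambda>y. profile q R y - profile q 1 (y::'a))"
      using PR(6)[OF R0] P1(6) by simp
    have le: "(R powr q - 1) / q * indicator (ball 0 1) y \<le> profile q R y - profile q 1 y \<and>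
        profile q R y - profile q 1 y \<le> (R powr q - 1) / q * indicator (ball 0 R) y" for y :: 'a
    proof -
      consider "norm y < 1" | "1 \<le> norm y" "norm y < R" | "R \<le> norm y" by linarith
      then show ?thesis
      proof cases
        case 1
        then show ?thesis using R PR(4)[OF R0, of y] P1(4)[of y]
          by (simp add: diff_divide_distrib)
      next
        case 2
        have "1 \<le> norm y powr q" using 2 q by (simp add: ge_one_powr_ge_zero)
        then have "(R powr q - norm y powr q) / q \<le> (R powr q - 1) / q"
          using q by (intro divide_right_mono) auto
        then show ?thesis using 2 R PR(1,4)[OF R0, of y] P1(3)[of y] by (simp add: indicator_def)
      next
        case 3
        then show ?thesis using R PR(3)[OF R0, of y] P1(3)[of y] by (simp add: indicator_def)
      qed
    qed
    have "(LINT y|lborel. (R powr q - 1) / q * indicator (ball (0::'a) 1) y) \<le> (LINT y|lborel. profile q R y - profile q 1 (y::'a))"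
      using le by (intro integral_mono integrable_mult_right fin diffint) auto
    moreover have "(LINT y|lborel. profile q R y - profile q 1 (y::'a)) \<le> (LINT y|lborel. (R powr q - 1) / q * indicator (ball (0::'a) R) y)"
      using le by (intro integral_mono integrable_mult_right fin diffint) auto
    ultimately show ?thesis
      unfolding ind eq measure_ball[OF R0] by (simp add: mult_ac)
  qed
  have lim: "((\<lambda>R. (R powr a - 1) / (R - 1)) \<longlongrightarrow> a) (at_right 1)" for a :: real
  proof -
    have "((\<lambda>R. R powr a) has_real_derivative a * 1 powr (a - 1)) (at 1)"
      by (rule has_real_derivative_powr) simp
    then show ?thesis
      by (auto simp: has_field_derivative_iff intro: filterlim_mono[OF _ order_refl at_le])
  qed
  have ev: "\<forall>\<^sub>F R in at_right 1. 1 < (R::real)" by (simp add: eventually_at_right_less)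
  have "?\<omega> * (q / q) \<le> (?d + q) * ?\<kappa>"
  proof (rule tendsto_le[of "at_right (1::real)"])
    show "((\<lambda>R. ?\<omega> * ((R powr q - 1) / (R - 1) / q)) \<longlongrightarrow> ?\<omega> * (q / q)) (at_right 1)"
      using q by (intro tendsto_intros lim) auto
    show "((\<lambda>R. (R powr (?d + q) - 1) / (R - 1) * ?\<kappa>) \<longlongrightarrow> (?d + q) * ?\<kappa>) (at_right 1)"
      by (intro tendsto_intros lim)
    show "\<forall>\<^sub>F R in at_right 1. ?\<omega> * ((R powr q - 1) / (R - 1) / q) \<le> (R powr (?d + q) - 1) / (R - 1) * ?\<kappa>"
      using ev
    proof eventually_elim
      case (elim R)
      have "?\<omega> * ((R powr q - 1) / (R - 1) / q) = ?\<omega> * ((R powr q - 1) / q) / (R - 1)" by simp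
      also have "\<dots> \<le> (R powr (?d + q) - 1) * ?\<kappa> / (R - 1)"
        using bounds[OF elim] elim by (intro divide_right_mono) auto
      finally show ?case by simp
    qed
  qed simp
  moreover have "(?d + q) * ?\<kappa> \<le> ?\<omega> * (1 powr ?d * (q / q))"
  proof (rule tendsto_le[of "at_right (1::real)"])
    show "((\<lambda>R. ?\<omega> * (R powr ?d * ((R powr q - 1) / (R - 1) / q))) \<longlongrightarrow> ?\<omega> * (1 powr ?d * (q / q))) (at_right 1)"
      using q by (intro tendsto_intros lim) auto
    show "((\<lambda>R. (R powr (?d + q) - 1) / (R - 1) * ?\<kappa>) \<longlongrightarrow> (?d + q) * ?\<kappa>) (at_right 1)"
      by (intro tendsto_intros lim)
    show "\<forall>\<^sub>F R in at_right 1. (R powr (?d + q) - 1) / (R - 1) * ?\<kappa> \<le> ?\<omega> * (R powr ?d * ((R powr q - 1) / (R - 1) / q))"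
      using ev
    proof eventually_elim
      case (elim R)
      have "(R powr (?d + q) - 1) / (R - 1) * ?\<kappa> = (R powr (?d + q) - 1) * ?\<kappa> / (R - 1)" by simp
      also have "\<dots> \<le> ?\<omega> * (R powr ?d * ((R powr q - 1) / q)) / (R - 1)"
        using bounds[OF elim] elim by (intro divide_right_mono) auto
      finally show ?case by (simp add: mult_ac)
    qed
  qed simp
  ultimately show ?thesis using q by simp
qed

lemma profile_mass_eq:
  assumes "1 < q" "0 < R"
  shows "(real DIM('a::euclidean_space) + q) * profile_mass TYPE('a) q R = R powr q * measure lebesgue (ball (0::'a) R)"
    "0 < profile_mass TYPE('a) q R"
proof -
  have "(real DIM('a) + q) * profile_mass TYPE('a) q R
      = R powr (real DIM('a) + q) * ((real DIM('a) + q) * profile_mass TYPE('a) q 1)"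
    using profile_mass_scale[OF assms, where 'a='a] by simp
  also have "\<dots> = R powr (real DIM('a) + q) * measure lebesgue (ball (0::'a) 1)"
    using profile_mass_unit[OF assms(1), where 'a='a] by simp
  also have "\<dots> = R powr q * measure lebesgue (ball (0::'a) R)"
    unfolding measure_ball[OF assms(2)] by (simp add: powr_add)
  finally show eq: "(real DIM('a) + q) * profile_mass TYPE('a) q R = R powr q * measure lebesgue (ball (0::'a) R)" .
  have "0 < R powr q * measure lebesgue (ball (0::'a) R)"
    using assms convex_domainsD(6)[OF ball_convex_domain[OF assms(2), of "0::'a"]] by (intro mult_pos_pos) auto
  then have "0 < (real DIM('a) + q) * profile_mass TYPE('a) q R" using eq by simp
  moreover have "0 < real DIM('a) + q" using assms by simp
  ultimately show "0 < profile_mass TYPE('a) q R" by (simp add: zero_less_mult_iff)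
qed

lemma root_power:
  assumes "0 < (t::real)" "0 < n"
  shows "(t ^ n) powr (1 / real n) = t" "(t powr (1 / real n)) ^ n = t"
  using assms by (simp_all add: powr_realpow[symmetric] powr_powr)

text \<open>With s = t R / \<rho> and w = x0 + (\<rho>/R) y in the inscribed ball, x + s w is (1 +
  s) times a convex combination of x and w. This places the sum of the hypographs over a set of
  volume |\<Omega>| + O(t).\<close>

lemma convex_enlarge:
  fixes \<Omega> :: "'a::euclidean_space set"
  assumes \<Omega>: "convex \<Omega>" and b: "ball x0 \<rho> \<subseteq> \<Omega>" and \<rho>: "0 < \<rho>" and x: "x \<in> \<Omega>" and y: "norm y < R" and t: "0 < t"
  shows "x + t *\<^sub>R y \<in> (\<lambda>x. (1 + t * R / \<rho>) *\<^sub>R x + (- (t * R / \<rho>) *\<^sub>R x0)) ` \<Omega>"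
proof -
  define s where "s = t * R / \<rho>"
  have R: "0 < R" using y norm_ge_zero[of y] by linarith
  have s: "0 < s" using \<rho> t R by (simp add: s_def)
  have "norm ((\<rho> / R) *\<^sub>R y) < \<rho>" using y \<rho> R by (simp add: field_simps)
  then have "x0 + (\<rho> / R) *\<^sub>R y \<in> \<Omega>" using b by (auto simp: dist_norm)
  then have "(1 / (1 + s)) *\<^sub>R x + (s / (1 + s)) *\<^sub>R (x0 + (\<rho> / R) *\<^sub>R y) \<in> \<Omega>" (is "?w \<in> _")
    using s x by (intro convexD[OF \<Omega>]) (auto simp: field_simps)
  moreover have "x + t *\<^sub>R y = (1 + s) *\<^sub>R ?w + (- s *\<^sub>R x0)"
  proof -
    have "(1 + s) *\<^sub>R ?w = x + s *\<^sub>R (x0 + (\<rho> / R) *\<^sub>R y)"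
      using s by (simp add: scaleR_right_distrib[of "1 + s"])
    also have "\<dots> = x + s *\<^sub>R x0 + t *\<^sub>R y"
      using \<rho> R by (simp add: scaleR_right_distrib s_def)
    finally show ?thesis by simp
  qed
  ultimately show ?thesis unfolding s_def by blast
qed

text \<open>The comparison for one fixed t. The error \<epsilon> bounds the variation of the
  gradient over distances up to t R, which allows the gradient to be evaluated at the end point of a
  displacement.\<close>

lemma Saint_Venant_step:
  fixes \<Omega> :: "'a::euclidean_space set"
  assumes \<Omega>: "\<Omega> \<in> convex_domains" and p: "1 < p" and \<phi>: "\<phi> \<in> Cc_infinity \<Omega>" and R: "0 < R"
    and q: "q = p / (p - 1)" and mass: "Lp_mass 1 \<phi> = profile_mass TYPE('a) q R"
    and b: "ball x0 \<rho> \<subseteq> \<Omega>" "0 < \<rho>" and t: "0 < t" and \<epsilon>: "0 < \<epsilon>"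
    and osc: "\<And>x y. norm (x - y) \<le> t * R \<Longrightarrow> norm (grad \<phi> x - grad \<phi> y) \<le> \<epsilon>"
  shows "real (DIM('a) + 1) * profile_mass TYPE('a) q R
    \<le> Dir p \<phi> / p + (1 + t * R / \<rho>) powr real DIM('a) * measure lebesgue \<Omega> * (R powr q / q + R * \<epsilon>)"
proof -
  let ?K = "profile_mass TYPE('a) q R" and ?n = "DIM('a \<times> real)"
  have q1: "1 < q" and pq: "1 / p + 1 / q = 1" using p by (auto simp: q field_simps)
  note P = profile_props[OF q1 R, where 'a='a] and K0 = profile_mass_eq(2)[OF q1 R, where 'a='a]
  note C = Cc_infinityD(2-4)[OF \<phi>]
  obtain S where S: "compact S" "S \<subseteq> \<Omega>" "\<And>x. x \<notin> S \<Longrightarrow> \<phi> x = 0" "\<And>x. x \<notin> S \<Longrightarrow> grad \<phi> x = 0"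
    using Cc_infinity_support[OF \<phi>] by metis
  define A where "A = hypo (\<lambda>x. \<bar>\<phi> x\<bar>)"
  define B where "B = hypo (profile q R :: 'a \<Rightarrow> real)"
  have cabs: "continuous_on UNIV (\<lambda>x. \<bar>\<phi> x\<bar>)" using C(1) by (intro continuous_intros)
  have A: "open A" "bounded A" "measure lebesgue A = ?K"
  proof -
    show "open A" unfolding A_def by (rule open_hypo[OF cabs])
    show "bounded A" unfolding A_def by (rule bounded_hypo[OF cabs S(1)]) (simp add: S)
    have "measure lebesgue A = (LINT x|lborel. \<bar>\<phi> x\<bar>)"
      unfolding A_def using Cc_integrable(3)[OF \<phi>, of 1] borel_measurable_continuous_onI[OF cabs]
      by (intro measure_hypo) auto
    then show "measure lebesgue A = ?K" using mass by (simp add: Lp_mass_def)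
  qed
  have B: "open B" "bounded B" "measure lebesgue B = ?K"
  proof -
    show "open B" unfolding B_def by (rule open_hypo[OF P(2)])
    show "bounded B" unfolding B_def by (rule bounded_hypo[OF P(2) compact_cball[of 0 R]]) (simp add: P(3))
    show "measure lebesgue B = ?K"
      unfolding B_def profile_mass_def using P(1,6) borel_measurable_continuous_onI[OF P(2)]
      by (intro measure_hypo) auto
  qed
  have ne: "A \<noteq> {}" "B \<noteq> {}" using A(3) B(3) K0 by auto
  let ?tB = "(\<lambda>z. t *\<^sub>R z + 0) ` B"
  have tB: "open ?tB" "bounded ?tB" "?tB \<noteq> {}" "measure lebesgue ?tB = t ^ ?n * ?K"
  proof -
    show "open ?tB" using B(1) t open_scaling[of t B] by simp
    show "bounded ?tB" using B(2) bounded_scaling[of B t] by simp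
    show "?tB \<noteq> {}" using ne by simp
    show "measure lebesgue ?tB = t ^ ?n * ?K"
      unfolding measure_affine[OF t] B(3) powr_realpow[OF t] ..
  qed
  \<comment> \<open>Equal volumes \<open>?K\<close> turn the Brunn--Minkowski bound into
    \<open>?K\<close> times (1 + t)^(d+1), of which Bernoulli's inequality keeps the part linear in
    t.\<close>
  have "?K * (1 + real ?n * t) \<le> ?K * (1 + t) ^ ?n"
    using K0 t Bernoulli_inequality[of t ?n] by (intro mult_left_mono) auto
  also have "\<dots> = (?K powr (1 / ?n) + (t ^ ?n * ?K) powr (1 / ?n)) ^ ?n"
  proof -
    have "(t ^ ?n * ?K) powr (1 / ?n) = t * ?K powr (1 / ?n)"
      using t K0 root_power(1)[OF t, of ?n] by (simp only: powr_mult DIM_positive)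
    then have "?K powr (1 / ?n) + (t ^ ?n * ?K) powr (1 / ?n) = ?K powr (1 / ?n) * (1 + t)"
      by (simp add: algebra_simps)
    moreover have "(?K powr (1 / ?n)) ^ ?n = ?K"
      using root_power(2)[OF K0 DIM_positive[where 'a="'a \<times> real"]] .
    ultimately show ?thesis by (simp only: power_mult_distrib)
  qed
  also have "\<dots> \<le> measure lebesgue (msum A ?tB)"
    using Brunn_Minkowski[OF A(1,2) ne(1) tB(1-3)] unfolding A(3) tB(4) .
  finally have lower: "?K * (1 + real ?n * t) \<le> measure lebesgue (msum A ?tB)" .
  define \<Omega>t where "\<Omega>t = (\<lambda>x. (1 + t * R / \<rho>) *\<^sub>R x + (- (t * R / \<rho>) *\<^sub>R x0)) ` \<Omega>"
  have pos1: "0 < 1 + t * R / \<rho>" using t R b(2) by (simp add: add_pos_pos)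
  have \<Omega>t: "\<Omega>t \<in> convex_domains" "measure lebesgue \<Omega>t = (1 + t * R / \<rho>) powr real DIM('a) * measure lebesgue \<Omega>"
    unfolding \<Omega>t_def using convex_domains_affine[OF \<Omega> pos1] measure_affine[OF pos1] by blast+
  have shift: "x + t *\<^sub>R y \<in> \<Omega>t" if "x \<in> \<Omega>" "norm y < R" for x y
    unfolding \<Omega>t_def using convex_enlarge[OF convex_domainsD(3)[OF \<Omega>] b that t] .
  have sub: "\<Omega> \<subseteq> \<Omega>t" using shift[of _ 0] R by auto
  define c where "c = R powr q / q + R * \<epsilon>"
  have c0: "0 \<le> c" using R \<epsilon> q1 by (simp add: c_def)
  \<comment> \<open>The upper envelope of the sum of the hypographs. The gradient is taken at the
    shifted point z, the variable of integration, so the integral of h needs no change of variables.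
    The constant c is spread over \<open>\<Omega>t\<close> because z may leave \<Omega>.\<close>
  define h where "h z = \<bar>\<phi> z\<bar> + t * (norm (grad \<phi> z) powr p / p) + t * c * indicator \<Omega>t z" for z
  have [measurable]: "\<phi> \<in> borel_measurable borel" "grad \<phi> \<in> borel_measurable borel"
    using C by (auto intro: borel_measurable_continuous_onI)
  have [measurable]: "\<Omega>t \<in> sets borel" using convex_domainsD(2)[OF \<Omega>t(1)] by (simp add: borel_open)
  have indint: "integrable lborel (indicator \<Omega>t :: 'a \<Rightarrow> real)"
    using convex_domainsD(7)[OF \<Omega>t(1)] by (intro integrable_real_indicator) auto
  have hint: "integrable lborel h"
    unfolding h_def using Cc_integrable(3)[OF \<phi>, of 1] Cc_integrable(2)[OF \<phi>, of p] p indint by auto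
  have hI: "(LINT z|lborel. h z) = ?K + t * (Dir p \<phi> / p) + t * c * measure lebesgue \<Omega>t"
    unfolding h_def mass[symmetric] using Cc_integrable(3)[OF \<phi>, of 1] Cc_integrable(2)[OF \<phi>, of p] p indint
    by (simp add: Lp_mass_def Dir_def convex_domainsD(8)[OF \<Omega>t(1)])
  have h0: "0 \<le> h z" for z using t c0 p by (auto simp: h_def)
  have [measurable]: "h \<in> borel_measurable borel" unfolding h_def by measurable
  note hyp = measure_hypo[OF hint h0]
  have incl: "msum A ?tB \<subseteq> hypo h"
  proof
    fix w assume "w \<in> msum A ?tB"
    then obtain u v where uv: "u \<in> A" "v \<in> B" "w = u + t *\<^sub>R v" unfolding in_msum by auto
    obtain x s y \<sigma> where xs: "u = (x, s)" "v = (y, \<sigma>)" by (metis surj_pair)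
    have s: "0 < s" "s < \<bar>\<phi> x\<bar>" and \<sigma>: "0 < \<sigma>" "\<sigma> < profile q R y"
      using uv xs by (auto simp: A_def B_def hypo_def)
    have x\<Omega>: "x \<in> \<Omega>" using s S by (metis abs_zero less_trans not_less_iff_gr_or_eq subset_eq)
    have yR: "norm y < R" using \<sigma> P(5)[of y] by linarith
    define z where "z = x + t *\<^sub>R y"
    have z\<Omega>: "z \<in> \<Omega>t" unfolding z_def by (rule shift[OF x\<Omega> yR])
    \<comment> \<open>Mean value inequality on the segment from x to z; \<open>osc\<close> replaces
      the gradient at intermediate points by the one at z.\<close>
    have "norm (\<phi> x - \<phi> z) \<le> (norm (grad \<phi> z) + \<epsilon>) * norm (x - z)"
    proof (rule differentiable_bound[of "closed_segment x z" \<phi> "\<lambda>a v. grad \<phi> a \<bullet> v"])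
      show "(\<phi> has_derivative (\<bullet>) (grad \<phi> a)) (at a within closed_segment x z)" for a
        using C(2) by (rule has_derivative_at_withinI)
      show "onorm ((\<bullet>) (grad \<phi> a)) \<le> norm (grad \<phi> z) + \<epsilon>" if a: "a \<in> closed_segment x z" for a
      proof (rule onorm_le)
        have "norm (a - z) \<le> norm (x - z)" using segment_bound(2)[OF a] by (simp add: norm_minus_commute)
        also have "\<dots> \<le> t * R" using yR t by (simp add: z_def)
        finally have "norm (grad \<phi> a - grad \<phi> z) \<le> \<epsilon>" by (rule osc)
        then have "norm (grad \<phi> a) \<le> norm (grad \<phi> z) + \<epsilon>"
          using norm_triangle_sub[of "grad \<phi> a" "grad \<phi> z"] by linarith
        then show "norm (grad \<phi> a \<bullet> v) \<le> (norm (grad \<phi> z) + \<epsilon>) * norm v" for v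
          using Cauchy_Schwarz_ineq2[of "grad \<phi> a" v] by (smt (verit) mult_right_mono norm_ge_zero real_norm_def)
      qed
    qed auto
    also have "\<dots> = t * (norm y * norm (grad \<phi> z) + norm y * \<epsilon>)"
      using t by (simp add: z_def algebra_simps)
    \<comment> \<open>Young's inequality for the product of |y| and the gradient norm. Its term
      |y|^q / q cancels against the height (R^q - |y|^q)/q of the profile at y.\<close>
    also have "\<dots> \<le> t * ((norm (grad \<phi> z) powr p / p + norm y powr q / q) + R * \<epsilon>)"
      using Youngs_inequality[OF p q1 pq, of "norm (grad \<phi> z)" "norm y"] yR \<epsilon> t
      by (intro mult_left_mono add_mono mult_right_mono) (auto simp: mult.commute)
    finally have "\<bar>\<phi> x\<bar> \<le> \<bar>\<phi> z\<bar> + t * ((norm (grad \<phi> z) powr p / p + norm y powr q / q) + R * \<epsilon>)"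
      by simp
    moreover have "t * \<sigma> < t * ((R powr q - norm y powr q) / q)"
      using \<sigma> P(4)[of y] yR t by (intro mult_strict_left_mono) auto
    ultimately have "s + t * \<sigma> < \<bar>\<phi> z\<bar> + t * (norm (grad \<phi> z) powr p / p) + t * c"
      using s(2) by (simp add: c_def algebra_simps diff_divide_distrib)
    moreover have "0 < s + t * \<sigma>" using s \<sigma> t by (simp add: add_pos_pos)
    ultimately show "w \<in> hypo h"
      using z\<Omega> unfolding uv xs hypo_def h_def by (simp add: z_def)
  qed
  have "measure lebesgue (msum A ?tB) \<le> measure lebesgue (hypo h)"
    using incl open_bounded_measure(1)[OF open_msum[OF A(1)] bounded_msum[OF A(2) tB(2)]] hyp(4)
    by (intro measure_mono_fmeasurable) auto
  also have "\<dots> = ?K + t * (Dir p \<phi> / p) + t * c * measure lebesgue \<Omega>t" using hyp(3) hI by simp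
  finally have "t * (real ?n * ?K) \<le> t * (Dir p \<phi> / p + c * measure lebesgue \<Omega>t)"
    using lower by (simp add: algebra_simps)
  then have "real ?n * ?K \<le> Dir p \<phi> / p + c * measure lebesgue \<Omega>t" using t by simp
  then show ?thesis unfolding \<Omega>t(2) c_def by (simp add: mult_ac)
qed

text \<open>The gradient vanishes off a compact set, so uniform continuity on a ball with radius
  larger by 1 suffices for points at distance at most 1.\<close>

lemma grad_uniform:
  assumes \<phi>: "\<phi> \<in> Cc_infinity \<Omega>" and \<epsilon>: "0 < \<epsilon>"
  obtains \<delta> where "0 < \<delta>" "\<And>x y. norm (x - y) \<le> \<delta> \<Longrightarrow> norm (grad \<phi> x - grad \<phi> y) \<le> \<epsilon>"
proof -
  obtain S where S: "compact S" "\<And>x. x \<notin> S \<Longrightarrow> grad \<phi> x = 0"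
    using Cc_infinity_support[OF \<phi>] by metis
  obtain r where r: "S \<subseteq> ball 0 r" using S(1) compact_imp_bounded bounded_subset_ballD by blast
  have "uniformly_continuous_on (cball 0 (r + 1)) (grad \<phi>)"
    using Cc_infinityD(4)[OF \<phi>] by (intro compact_uniformly_continuous) (auto intro: continuous_on_subset)
  then obtain d where d: "0 < d" "\<And>x y. x \<in> cball 0 (r + 1) \<Longrightarrow> y \<in> cball 0 (r + 1) \<Longrightarrow> dist y x < d \<Longrightarrow>
      dist (grad \<phi> y) (grad \<phi> x) < \<epsilon>"
    using \<epsilon> unfolding uniformly_continuous_on_def by metis
  show thesis
  proof
    show "0 < min (d / 2) 1" using d by simp
    fix x y :: 'a assume xy: "norm (x - y) \<le> min (d / 2) 1"
    show "norm (grad \<phi> x - grad \<phi> y) \<le> \<epsilon>"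
    proof (cases "x \<in> S \<or> y \<in> S")
      case True
      then have "norm x < r \<or> norm y < r" using r by auto
      then have "norm x \<le> r + 1" "norm y \<le> r + 1"
        using xy norm_triangle_ineq2[of x y] norm_triangle_ineq3[of x y] by auto
      then show ?thesis using d(2)[of y x] xy d(1) by (force simp: dist_norm)
    next
      case False
      then show ?thesis using S(2) \<epsilon> by simp
    qed
  qed
qed

text \<open>The admissible range of t depends on \<epsilon> through the modulus of continuity of the
  gradient, so t tends to 0 first and \<epsilon> afterwards.\<close>

lemma Saint_Venant_functional:
  fixes \<Omega> :: "'a::euclidean_space set"
  assumes \<Omega>: "\<Omega> \<in> convex_domains" and p: "1 < p" and \<phi>: "\<phi> \<in> Cc_infinity \<Omega>" and R: "0 < R"
    and q: "q = p / (p - 1)" and mass: "Lp_mass 1 \<phi> = profile_mass TYPE('a) q R"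
  shows "real (DIM('a) + 1) * profile_mass TYPE('a) q R \<le> Dir p \<phi> / p + measure lebesgue \<Omega> * (R powr q / q)"
proof -
  let ?L = "real (DIM('a) + 1) * profile_mass TYPE('a) q R" and ?V = "measure lebesgue \<Omega>"
  obtain x0 \<rho> where b: "0 < \<rho>" "ball x0 \<rho> \<subseteq> \<Omega>"
    using convex_domainsD(1,2)[OF \<Omega>] by (metis all_not_in_conv open_contains_ball)
  have e: "?L \<le> Dir p \<phi> / p + ?V * (R powr q / q + R * \<epsilon>)" if \<epsilon>: "0 < \<epsilon>" for \<epsilon>
  proof -
    obtain \<delta> where \<delta>: "0 < \<delta>" "\<And>x y. norm (x - y) \<le> \<delta> \<Longrightarrow> norm (grad \<phi> x - grad \<phi> y) \<le> \<epsilon>"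
      using grad_uniform[OF \<phi> \<epsilon>] by blast
    have "((\<lambda>t. Dir p \<phi> / p + (1 + t * R / \<rho>) powr real DIM('a) * ?V * (R powr q / q + R * \<epsilon>)) \<longlongrightarrow>
        Dir p \<phi> / p + (1 + 0 * R / \<rho>) powr real DIM('a) * ?V * (R powr q / q + R * \<epsilon>)) (at_right 0)"
      using b by (intro tendsto_intros) auto
    moreover have "\<forall>\<^sub>F t in at_right 0. ?L \<le> Dir p \<phi> / p + (1 + t * R / \<rho>) powr real DIM('a) * ?V * (R powr q / q + R * \<epsilon>)"
    proof (rule eventually_at_rightI[of 0 "\<delta> / R"])
      fix t assume t: "t \<in> {0<..<\<delta> / R}"
      then have "t * R \<le> \<delta>" using R by (simp add: field_simps)
      then show "?L \<le> Dir p \<phi> / p + (1 + t * R / \<rho>) powr real DIM('a) * ?V * (R powr q / q + R * \<epsilon>)"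
        using \<delta>(2) t by (intro Saint_Venant_step[OF \<Omega> p \<phi> R q mass b(2,1) _ \<epsilon>]) auto
    qed (use \<delta> R in auto)
    ultimately have "?L \<le> Dir p \<phi> / p + (1 + 0 * R / \<rho>) powr real DIM('a) * ?V * (R powr q / q + R * \<epsilon>)"
      by (intro tendsto_lowerbound[of _ _ "at_right (0::real)"]) auto
    then show ?thesis by simp
  qed
  have "((\<lambda>\<epsilon>. Dir p \<phi> / p + ?V * (R powr q / q + R * \<epsilon>)) \<longlongrightarrow> Dir p \<phi> / p + ?V * (R powr q / q + R * 0)) (at_right 0)"
    by (intro tendsto_intros)
  moreover have "\<forall>\<^sub>F \<epsilon> in at_right 0. ?L \<le> Dir p \<phi> / p + ?V * (R powr q / q + R * \<epsilon>)"
    using e by (intro eventually_at_rightI[of 0 1]) auto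
  ultimately have "?L \<le> Dir p \<phi> / p + ?V * (R powr q / q + R * 0)"
    by (intro tendsto_lowerbound[of _ _ "at_right (0::real)"]) auto
  then show ?thesis by simp
qed

text \<open>Let K be the profile mass. Scaling \<phi> by l equalises the masses. The volume term is
  (d + q) K / q by \<open>profile_mass_eq\<close>, and (d + 1) - (d + q)/q = d / p, so what remains
  is d K \<le> l^p \<open>Dir p \<phi>\<close>, an inequality homogeneous in \<phi>.\<close>

lemma torsion_upper:
  fixes \<Omega> :: "'a::euclidean_space set"
  assumes \<Omega>: "\<Omega> \<in> convex_domains" and p: "1 < p" and R: "0 < R"
    and q: "q = p / (p - 1)" and vol: "measure lebesgue \<Omega> = measure lebesgue (ball (0::'a) R)"
  shows "torsion p \<Omega> \<le> profile_mass TYPE('a) q R powr (p - 1) / real DIM('a)"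
proof (rule torsion_least(2)[OF \<Omega> p])
  let ?K = "profile_mass TYPE('a) q R" and ?d = "real DIM('a)"
  have q1: "1 < q" using p by (simp add: q field_simps)
  note K = profile_mass_eq[OF q1 R, where 'a='a]
  show "0 \<le> ?K powr (p - 1) / ?d" by simp
  fix \<phi> assume \<phi>: "\<phi> \<in> Cc_infinity \<Omega>"
  let ?m = "Lp_mass 1 \<phi>"
  show "?m powr p \<le> ?K powr (p - 1) / ?d * Dir p \<phi>"
  proof (cases "?m = 0")
    case True
    then show ?thesis using p Dir_nonneg[of p \<phi>] by simp
  next
    case False
    then have m: "0 < ?m" using Lp_mass_nonneg[of 1 \<phi>] by simp
    define l where "l = ?K / ?m"
    have l: "0 < l" using m K(2) by (simp add: l_def)
    have "Lp_mass 1 (\<lambda>x. l * \<phi> x) = l * ?m" using l by (simp add: Lp_mass_def abs_mult)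
    then have 1: "Lp_mass 1 (\<lambda>x. l * \<phi> x) = ?K" using m by (simp add: l_def)
    have 2: "Dir p (\<lambda>x. l * \<phi> x) = l powr p * Dir p \<phi>"
      unfolding Dir_def grad_cmult[OF \<phi>] using l by (simp add: powr_mult)
    have "(?d + 1) * ?K \<le> l powr p * Dir p \<phi> / p + measure lebesgue (ball (0::'a) R) * (R powr q / q)"
      using Saint_Venant_functional[OF \<Omega> p Cc_infinity_cmult[OF \<phi>] R q 1] unfolding 2 vol of_nat_add of_nat_1 .
    also have "measure lebesgue (ball (0::'a) R) * (R powr q / q) = (?d + q) * ?K / q"
      using K(1) by (simp add: mult.commute)
    finally have "(?d + 1) * ?K - (?d + q) * ?K / q \<le> l powr p * Dir p \<phi> / p" by simp
    then have "p * ((?d + 1) * ?K - (?d + q) * ?K / q) \<le> p * (l powr p * Dir p \<phi> / p)"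
      using p by (intro mult_left_mono) auto
    moreover have "p * ((?d + 1) * ?K - (?d + q) * ?K / q) = ?d * ?K"
      using p by (simp add: q field_simps)
    ultimately have "?d * ?K \<le> l powr p * Dir p \<phi>" using p by simp
    then have "?m powr p * (?d * ?K) \<le> ?m powr p * (l powr p * Dir p \<phi>)" by (intro mult_left_mono) auto
    also have "\<dots> = ?K powr p * Dir p \<phi>"
      using m K(2) by (simp add: l_def powr_divide)
    finally have "?m powr p \<le> ?K powr p * Dir p \<phi> / (?d * ?K)"
      using K(2) by (simp add: le_divide_eq)
    also have "\<dots> = ?K powr (p - 1) / ?d * Dir p \<phi>" using K(2) by (simp add: powr_diff)
    finally show ?thesis .
  qed
qed

section \<open>Smooth approximation of the torsion function of a ball\<close>

definition flat_slope :: "real \<Rightarrow> real" where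
  "flat_slope t = flat_exp 0 t + flat_exp (-1) t"

lemma flat_exp_1_deriv: "(flat_exp 1 has_real_derivative flat_slope t) (at t)"
  using flat_exp_deriv[of 1 t] by (simp add: flat_slope_def)

lemma flat_slope_bounds: "0 \<le> flat_slope t" "flat_slope t \<le> 1"
proof -
  show "0 \<le> flat_slope t" by (simp add: flat_slope_def flat_exp_def)
  \<comment> \<open>For positive t the slope is (1 + 1/t) exp(-1/t), and 1 + x is at most exp
    x.\<close>
  have "(1 + 1 / t) * exp (- (1 / t)) \<le> exp (1 / t) * exp (- (1 / t))" if "0 < t"
    using that by (intro mult_right_mono) auto
  then show "flat_slope t \<le> 1"
    by (auto simp: flat_slope_def flat_exp_def exp_minus field_simps powr_minus)
qed

lemma flat_slope_at_top: "(flat_slope \<longlongrightarrow> 1) at_top"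
proof -
  have "((\<lambda>t::real. t powr 0 * exp (- (1 / t)) + t powr (-1) * exp (- (1 / t))) \<longlongrightarrow> 1) at_top"
    by real_asymp
  then show ?thesis
    by (rule Lim_transform_eventually)
      (auto simp: flat_slope_def flat_exp_def intro: eventually_mono[OF eventually_gt_at_top[of 0]])
qed

text \<open>Smooth compactly supported approximations of the torsion function \<open>profile q R\<close> of the ball:
  the singularity at the origin is removed by \<open>\<epsilon> + |y|\<^sup>2\<close>, and the positive part is replaced
  by \<open>s exp (- \<epsilon> / s)\<close>, whose slope stays in \<open>[0, 1]\<close>.\<close>

definition level :: "real \<Rightarrow> real \<Rightarrow> real \<Rightarrow> 'a::euclidean_space \<Rightarrow> real" where
  "level q R \<epsilon> y = (\<epsilon> + R\<^sup>2) powr (q / 2) / q - (\<epsilon> + (norm y)\<^sup>2) powr (q / 2) / q - \<epsilon>"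

definition smooth_profile :: "real \<Rightarrow> real \<Rightarrow> real \<Rightarrow> 'a::euclidean_space \<Rightarrow> real" where
  "smooth_profile q R \<epsilon> y = \<epsilon> * flat_exp 1 (inverse \<epsilon> * level q R \<epsilon> y)"

context
  fixes q R \<epsilon> :: real
  assumes q: "1 < q" and R: "0 < R" and \<epsilon>: "0 < \<epsilon>"
begin

text \<open>The final \<open>- \<epsilon>\<close> in \<open>level\<close> makes the level negative
  on the sphere of radius R, so the support stays in a compact part of the open ball.\<close>

lemma level_pos_imp: "0 \<le> level q R \<epsilon> y \<Longrightarrow> norm y < R"
proof (rule ccontr)
  assume l: "0 \<le> level q R \<epsilon> y" and "\<not> norm y < R"
  then have "(\<epsilon> + R\<^sup>2) powr (q / 2) \<le> (\<epsilon> + (norm y)\<^sup>2) powr (q / 2)"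
    using q R \<epsilon> by (intro powr_mono2 add_left_mono power_mono) auto
  then have "(\<epsilon> + R\<^sup>2) powr (q / 2) / q \<le> (\<epsilon> + (norm y)\<^sup>2) powr (q / 2) / q"
    using q by (intro divide_right_mono) auto
  then show False using l \<epsilon> by (simp add: level_def)
qed

lemma level_le: "level q R \<epsilon> y \<le> (\<epsilon> + R\<^sup>2) powr (q / 2) / q"
proof -
  have "0 \<le> (\<epsilon> + (norm y)\<^sup>2) powr (q / 2) / q" using q by simp
  then show ?thesis using \<epsilon> by (simp add: level_def)
qed

lemma smooth_profile_nonneg: "0 \<le> smooth_profile q R \<epsilon> y"
  using \<epsilon> by (simp add: smooth_profile_def flat_exp_def)

lemma smooth_profile_eq:
  "smooth_profile q R \<epsilon> y = (if 0 < level q R \<epsilon> y then level q R \<epsilon> y * exp (- (\<epsilon> / level q R \<epsilon> y)) else 0)"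
  using \<epsilon> by (auto simp: smooth_profile_def flat_exp_def zero_less_mult_iff divide_inverse)

lemma smooth_profile_le: "smooth_profile q R \<epsilon> y \<le> (\<epsilon> + R\<^sup>2) powr (q / 2) / q"
proof (cases "0 < level q R \<epsilon> y")
  case True
  then have "level q R \<epsilon> y * exp (- (\<epsilon> / level q R \<epsilon> y)) \<le> level q R \<epsilon> y * 1"
    using \<epsilon> by (intro mult_left_mono) auto
  then show ?thesis unfolding smooth_profile_eq if_P[OF True] using level_le[of y] by linarith
next
  case False
  then show ?thesis using q by (simp add: smooth_profile_eq)
qed

lemma smooth_profile_zero: "R \<le> norm y \<Longrightarrow> smooth_profile q R \<epsilon> y = 0"
  using level_pos_imp[of y] by (force simp: smooth_profile_eq)

lemma C_k_level: "C_k k (level q R \<epsilon> :: 'a::euclidean_space \<Rightarrow> real)"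
proof -
  have "C_k k (\<lambda>y::'a. (\<epsilon> + (norm y)\<^sup>2) powr (q / 2))"
    using \<epsilon> by (intro C_k_powr C_k_add C_k_const C_k_norm_square) (simp add: add_pos_nonneg)
  then have "C_k k (\<lambda>y::'a. (\<epsilon> + R\<^sup>2) powr (q / 2) / q - inverse q * (\<epsilon> + (norm y)\<^sup>2) powr (q / 2) - \<epsilon>)"
    by (intro C_k_diff C_k_const C_k_cmult)
  moreover have "level q R \<epsilon> = (\<lambda>y::'a. (\<epsilon> + R\<^sup>2) powr (q / 2) / q - inverse q * (\<epsilon> + (norm y)\<^sup>2) powr (q / 2) - \<epsilon>)"
  proof
    fix y :: 'a
    have "inverse q * (\<epsilon> + (norm y)\<^sup>2) powr (q / 2) = (\<epsilon> + (norm y)\<^sup>2) powr (q / 2) / q"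
      by (rule inverse_eq_divide[THEN arg_cong[where f="\<lambda>t. t * _"], THEN trans]) simp
    then show "level q R \<epsilon> y = (\<epsilon> + R\<^sup>2) powr (q / 2) / q - inverse q * (\<epsilon> + (norm y)\<^sup>2) powr (q / 2) - \<epsilon>"
      unfolding level_def by simp
  qed
  ultimately show ?thesis by simp
qed

lemma smooth_profile_Cc: "(smooth_profile q R \<epsilon> :: 'a::euclidean_space \<Rightarrow> real) \<in> Cc_infinity (ball 0 R)"
proof (rule Cc_infinityI)
  let ?K = "{y::'a. 0 \<le> level q R \<epsilon> y}"
  show "C_k k (smooth_profile q R \<epsilon> :: 'a \<Rightarrow> real)" for k
    unfolding smooth_profile_def[abs_def]
    by (intro C_k_cmult C_k_compose[OF C_k_flat_exp] C_k_level)
  show K: "?K \<subseteq> ball 0 R" using level_pos_imp by auto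
  have "closed ?K"
    using C_k_continuous[OF C_k_level] by (intro closed_Collect_le) auto
  then show "compact ?K"
    using bounded_subset[OF bounded_ball K] by (simp add: compact_eq_bounded_closed)
  show "smooth_profile q R \<epsilon> y = 0" if "y \<notin> ?K" for y
    using that by (simp add: smooth_profile_eq)
qed

lemma grad_smooth_profile:
  "grad (smooth_profile q R \<epsilon>) y
    = (- (flat_slope (inverse \<epsilon> * level q R \<epsilon> y) * (\<epsilon> + (norm y)\<^sup>2) powr (q / 2 - 1))) *\<^sub>R y"
proof (rule grad_eqI)
  have pos: "0 < \<epsilon> + (norm y)\<^sup>2" using \<epsilon> by (simp add: add_pos_nonneg)
  have "((\<lambda>y. \<epsilon> + (norm y)\<^sup>2) has_derivative (\<lambda>v. 2 * (y \<bullet> v))) (at y)"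
    unfolding power2_norm_eq_inner by (auto intro!: derivative_eq_intros simp: inner_commute)
  from has_derivative_compose[OF this has_real_derivative_powr[OF pos, unfolded has_field_derivative_def, of "q / 2"]]
  have "((\<lambda>y. (\<epsilon> + (norm y)\<^sup>2) powr (q / 2)) has_derivative
      (\<lambda>v. q / 2 * (\<epsilon> + (norm y)\<^sup>2) powr (q / 2 - 1) * (2 * (y \<bullet> v)))) (at y)" .
  moreover define f where "f y = (\<epsilon> + (norm y)\<^sup>2) powr (q / 2)" for y :: 'a
  ultimately have f: "(f has_derivative (\<lambda>v. q / 2 * (\<epsilon> + (norm y)\<^sup>2) powr (q / 2 - 1) * (2 * (y \<bullet> v)))) (at y)"
    by (simp add: f_def[abs_def])
  have "((\<lambda>y. (\<epsilon> + R\<^sup>2) powr (q / 2) / q - f y / q - \<epsilon>) has_derivative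
      (\<lambda>v. - ((\<epsilon> + (norm y)\<^sup>2) powr (q / 2 - 1) * (y \<bullet> v)))) (at y)"
    using q by (auto intro!: derivative_eq_intros f)
  then have "(level q R \<epsilon> has_derivative (\<lambda>v. - ((\<epsilon> + (norm y)\<^sup>2) powr (q / 2 - 1) * (y \<bullet> v)))) (at y)"
    by (simp add: level_def[abs_def] f_def)
  then have "((\<lambda>y. inverse \<epsilon> * level q R \<epsilon> y) has_derivative
      (\<lambda>v. inverse \<epsilon> * (- ((\<epsilon> + (norm y)\<^sup>2) powr (q / 2 - 1) * (y \<bullet> v))))) (at y)"
    by (rule has_derivative_mult_right)
  from has_derivative_mult_right[OF has_derivative_compose[OF this flat_exp_1_deriv[unfolded has_field_derivative_def]], of \<epsilon>]
  show "(smooth_profile q R \<epsilon> has_derivative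
      (\<bullet>) ((- (flat_slope (inverse \<epsilon> * level q R \<epsilon> y) * (\<epsilon> + (norm y)\<^sup>2) powr (q / 2 - 1))) *\<^sub>R y)) (at y)"
    unfolding smooth_profile_def[abs_def]
    by (rule has_derivative_eq_rhs) (use \<epsilon> in \<open>auto simp: fun_eq_iff mult_ac\<close>)
qed

lemma norm_grad_smooth_profile:
  "norm (grad (smooth_profile q R \<epsilon>) y)
    = flat_slope (inverse \<epsilon> * level q R \<epsilon> y) * ((\<epsilon> + (norm y)\<^sup>2) powr (q / 2 - 1) * norm y)"
  unfolding grad_smooth_profile using flat_slope_bounds(1) by (simp add: abs_mult)

text \<open>For q < 2 the power with exponent q/2 - 1 blows up near the origin as \<epsilon>
  shrinks; the factor |y|, at most (\<epsilon> + |y|^2)^(1/2), compensates for it. The bound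
  provides the dominating function in the limit.\<close>

lemma norm_grad_smooth_profile_le:
  "norm (grad (smooth_profile q R \<epsilon>) y) \<le> (\<epsilon> + R\<^sup>2) powr ((q - 1) / 2) * indicator (ball 0 R) y"
proof (cases "norm y < R")
  case True
  have pos: "0 < \<epsilon> + (norm y)\<^sup>2" using \<epsilon> by (simp add: add_pos_nonneg)
  have "norm y = ((norm y)\<^sup>2) powr (1 / 2)" by (simp add: powr_half_sqrt)
  also have "\<dots> \<le> (\<epsilon> + (norm y)\<^sup>2) powr (1 / 2)" using \<epsilon> by (intro powr_mono2) auto
  finally have "(\<epsilon> + (norm y)\<^sup>2) powr (q / 2 - 1) * norm y
      \<le> (\<epsilon> + (norm y)\<^sup>2) powr (q / 2 - 1) * (\<epsilon> + (norm y)\<^sup>2) powr (1 / 2)"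
    by (intro mult_left_mono) auto
  also have "\<dots> = (\<epsilon> + (norm y)\<^sup>2) powr ((q - 1) / 2)"
    by (simp add: powr_add[symmetric] field_simps)
  also have "\<dots> \<le> (\<epsilon> + R\<^sup>2) powr ((q - 1) / 2)"
    using True q \<epsilon> by (intro powr_mono2 add_left_mono power_mono) auto
  finally have "(\<epsilon> + (norm y)\<^sup>2) powr (q / 2 - 1) * norm y \<le> (\<epsilon> + R\<^sup>2) powr ((q - 1) / 2)" .
  then have "flat_slope (inverse \<epsilon> * level q R \<epsilon> y) * ((\<epsilon> + (norm y)\<^sup>2) powr (q / 2 - 1) * norm y)
      \<le> 1 * (\<epsilon> + R\<^sup>2) powr ((q - 1) / 2)"
    using flat_slope_bounds by (intro mult_mono) auto
  then show ?thesis using True by (simp add: norm_grad_smooth_profile)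
next
  case False
  then have "level q R \<epsilon> y < 0" using level_pos_imp[of y] by linarith
  then have "inverse \<epsilon> * level q R \<epsilon> y < 0" using \<epsilon> by (simp add: mult_pos_neg)
  then have "flat_slope (inverse \<epsilon> * level q R \<epsilon> y) = 0" by (simp add: flat_slope_def flat_exp_def)
  then show ?thesis by (simp add: norm_grad_smooth_profile)
qed

end

lemma level_tendsto:
  assumes "1 < q" "0 < R" "\<epsilon> \<longlonglongrightarrow> 0" "\<And>n. 0 < \<epsilon> n"
  shows "(\<lambda>n. level q R (\<epsilon> n) y) \<longlonglongrightarrow> (R powr q - norm y powr q) / q"
proof -
  have sq: "((0 + s\<^sup>2) powr (q / 2)) = s powr q" if "0 \<le> s" for s :: real
  proof (cases "s = 0")
    case False
    then have "s\<^sup>2 = s powr 2" using that by (simp add: powr_numeral)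
    then show ?thesis by (simp add: powr_powr)
  qed simp
  have "(\<lambda>n. level q R (\<epsilon> n) y) \<longlonglongrightarrow> (0 + R\<^sup>2) powr (q / 2) / q - (0 + (norm y)\<^sup>2) powr (q / 2) / q - 0"
    unfolding level_def using assms
    by (intro tendsto_intros tendsto_powr' assms(3)) (auto intro!: always_eventually add_nonneg_nonneg less_imp_le)
  then show ?thesis using assms sq by (simp add: diff_divide_distrib)
qed

text \<open>With K the profile mass, the quotients of the approximations tend to K^p / (d K), which
  is the constant of \<open>torsion_upper\<close>. The limit gradient has norm |y|^(q-1), its p-th
  power is |y|^q since (q - 1) p = q, and the integral of |y|^q over the ball is R^q |B| - q K = d
  K.\<close>

lemma torsion_ball_lower:
  assumes p: "1 < p" and R: "0 < R" and q: "q = p / (p - 1)"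
  shows "profile_mass TYPE('a) q R powr (p - 1) / real DIM('a) \<le> torsion p (ball (0::'a::euclidean_space) R)"
proof -
  let ?d = "real DIM('a)" and ?K = "profile_mass TYPE('a) q R" and ?B = "ball (0::'a) R"
  have q1: "1 < q" and qp: "(q - 1) * p = q" using p by (auto simp: q field_simps)
  note K = profile_mass_eq[OF q1 R, where 'a='a] and P = profile_props[OF q1 R, where 'a='a]
  define \<epsilon> where "\<epsilon> n = inverse (real (Suc n))" for n
  have \<epsilon>: "0 < \<epsilon> n" "\<epsilon> n \<le> 1" for n by (auto simp: \<epsilon>_def field_simps)
  have \<epsilon>0: "\<epsilon> \<longlonglongrightarrow> 0" unfolding \<epsilon>_def by (rule LIMSEQ_inverse_real_of_nat)
  define \<phi> where "\<phi> n = (smooth_profile q R (\<epsilon> n) :: 'a \<Rightarrow> real)" for n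
  have \<phi>: "\<phi> n \<in> Cc_infinity ?B" for n unfolding \<phi>_def by (rule smooth_profile_Cc[OF q1 R \<epsilon>(1)])
  have [measurable]: "\<phi> n \<in> borel_measurable borel" "grad (\<phi> n) \<in> borel_measurable borel" for n
    using Cc_infinityD[OF \<phi>[of n]] by (auto intro!: borel_measurable_continuous_onI)
  have [measurable]: "(profile q R :: 'a \<Rightarrow> real) \<in> borel_measurable borel"
    using P(2) by (rule borel_measurable_continuous_onI)
  have [measurable]: "?B \<in> sets borel" by simp
  have indint: "integrable lborel (\<lambda>y. c * indicator ?B y :: real)" for c
    using emeasure_bounded_finite[OF bounded_ball, of "0::'a" R]
    by (intro integrable_mult_right integrable_real_indicator) auto
  have lev: "(\<lambda>n. level q R (\<epsilon> n) y) \<longlonglongrightarrow> (R powr q - norm y powr q) / q" for y :: 'a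
    by (rule level_tendsto[OF q1 R \<epsilon>0 \<epsilon>(1)])
  have levpos: "0 < (R powr q - norm y powr q) / q" if "norm y < R" for y :: 'a
    using that q1 R powr_less_mono2[of q "norm y" R] by simp
  have "(\<lambda>n. LINT y|lborel. \<bar>\<phi> n y\<bar> powr 1) \<longlonglongrightarrow> (LINT y|lborel. profile q R (y::'a))"
  proof (rule integral_dominated_convergence)
    let ?M = "(1 + R\<^sup>2) powr (q / 2) / q"
    show "integrable lborel (\<lambda>y. ?M * indicator ?B y)" by (rule indint)
    show "AE y in lborel. (\<lambda>n. \<bar>\<phi> n y\<bar> powr 1) \<longlonglongrightarrow> profile q R y"
    proof (rule AE_I2)
      fix y :: 'a
      show "(\<lambda>n. \<bar>\<phi> n y\<bar> powr 1) \<longlonglongrightarrow> profile q R y"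
      proof (cases "norm y < R")
        case True
        have "\<forall>\<^sub>F n in sequentially. 0 < level q R (\<epsilon> n) y"
          by (rule order_tendstoD(1)[OF lev levpos[OF True]])
        then have "\<forall>\<^sub>F n in sequentially. level q R (\<epsilon> n) y * exp (- (\<epsilon> n / level q R (\<epsilon> n) y)) = \<bar>\<phi> n y\<bar> powr 1"
          by eventually_elim (use \<epsilon> in \<open>simp add: \<phi>_def smooth_profile_eq[OF q1 R \<epsilon>(1)]\<close>)
        moreover have "(\<lambda>n. level q R (\<epsilon> n) y * exp (- (\<epsilon> n / level q R (\<epsilon> n) y)))
            \<longlonglongrightarrow> (R powr q - norm y powr q) / q * exp (- (0 / ((R powr q - norm y powr q) / q)))"
          using levpos[OF True] by (intro tendsto_intros lev \<epsilon>0) auto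
        ultimately show ?thesis using P(4)[of y] True by (auto intro: Lim_transform_eventually)
      next
        case False
        then show ?thesis using P(3)[of y] smooth_profile_zero[OF q1 R \<epsilon>(1), of y] by (simp add: \<phi>_def)
      qed
    qed
    show "AE y in lborel. norm (\<bar>\<phi> n y\<bar> powr 1) \<le> ?M * indicator ?B y" for n
    proof (rule AE_I2)
      fix y :: 'a
      have "\<phi> n y \<le> (\<epsilon> n + R\<^sup>2) powr (q / 2) / q"
        unfolding \<phi>_def by (rule smooth_profile_le[OF q1 R \<epsilon>(1)])
      also have "\<dots> \<le> ?M"
        using \<epsilon>[of n] q1 by (intro divide_right_mono powr_mono2) auto
      finally have "\<phi> n y \<le> ?M" .
      moreover have "0 \<le> \<phi> n y" unfolding \<phi>_def by (rule smooth_profile_nonneg[OF q1 R \<epsilon>(1)])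
      moreover have "\<phi> n y = 0" if "R \<le> norm y"
        unfolding \<phi>_def by (rule smooth_profile_zero[OF q1 R \<epsilon>(1) that])
      ultimately show "norm (\<bar>\<phi> n y\<bar> powr 1) \<le> ?M * indicator ?B y" by (auto simp: indicator_def)
    qed
  qed measurable
  then have 1: "(\<lambda>n. Lp_mass 1 (\<phi> n)) \<longlonglongrightarrow> ?K" by (simp add: Lp_mass_def profile_mass_def)
  have "(\<lambda>n. LINT y|lborel. norm (grad (\<phi> n) y) powr p) \<longlonglongrightarrow> (LINT y|lborel. norm y powr q * indicator ?B y)"
  proof (rule integral_dominated_convergence)
    let ?M = "((1 + R\<^sup>2) powr ((q - 1) / 2)) powr p"
    show "integrable lborel (\<lambda>y. ?M * indicator ?B y)" by (rule indint)
    have le: "norm (grad (\<phi> n) y) \<le> (1 + R\<^sup>2) powr ((q - 1) / 2) * indicator ?B y" for n y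
    proof -
      have "norm (grad (\<phi> n) y) \<le> (\<epsilon> n + R\<^sup>2) powr ((q - 1) / 2) * indicator ?B y"
        unfolding \<phi>_def by (rule norm_grad_smooth_profile_le[OF q1 R \<epsilon>(1)])
      also have "\<dots> \<le> (1 + R\<^sup>2) powr ((q - 1) / 2) * indicator ?B y"
        using \<epsilon>[of n] q1 by (intro mult_right_mono powr_mono2) auto
      finally show ?thesis .
    qed
    show "AE y in lborel. norm (norm (grad (\<phi> n) y) powr p) \<le> ?M * indicator ?B y" for n
    proof (rule AE_I2)
      fix y :: 'a
      have "norm (grad (\<phi> n) y) powr p \<le> ((1 + R\<^sup>2) powr ((q - 1) / 2) * indicator ?B y) powr p"
        using le p by (intro powr_mono2) auto
      then show "norm (norm (grad (\<phi> n) y) powr p) \<le> ?M * indicator ?B y"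
        by (auto simp: indicator_def split: if_splits)
    qed
    show "AE y in lborel. (\<lambda>n. norm (grad (\<phi> n) y) powr p) \<longlonglongrightarrow> norm y powr q * indicator ?B y"
    proof (rule AE_I2)
      fix y :: 'a
      show "(\<lambda>n. norm (grad (\<phi> n) y) powr p) \<longlonglongrightarrow> norm y powr q * indicator ?B y"
      \<comment> \<open>The origin is treated apart: for q < 2 the power of \<epsilon> + |y|^2
        diverges there, but the factor |y| makes all gradients vanish.\<close>
      proof (cases "norm y < R \<and> y \<noteq> 0")
        case True
        \<comment> \<open>Inside the ball the level has a positive limit, so its quotient by
          \<epsilon> tends to infinity and the slope to 1.\<close>
        have "filterlim (\<lambda>n. inverse (\<epsilon> n) * level q R (\<epsilon> n) y) at_top sequentially"
        proof (rule filterlim_at_top_mult_tendsto_pos[OF lev])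
          show "0 < (R powr q - norm y powr q) / q" using levpos True by blast
          have "filterlim (\<lambda>n. real (Suc n)) at_top sequentially"
            using filterlim_Suc filterlim_real_sequentially filterlim_compose by blast
          then show "filterlim (\<lambda>n. inverse (\<epsilon> n)) at_top sequentially" by (simp add: \<epsilon>_def)
        qed
        then have "(\<lambda>n. flat_slope (inverse (\<epsilon> n) * level q R (\<epsilon> n) y)) \<longlonglongrightarrow> 1"
          by (rule filterlim_compose[OF flat_slope_at_top])
        moreover have "(\<lambda>n. (\<epsilon> n + (norm y)\<^sup>2) powr (q / 2 - 1) * norm y) \<longlonglongrightarrow> (0 + (norm y)\<^sup>2) powr (q / 2 - 1) * norm y"
          using True by (intro tendsto_intros \<epsilon>0) auto
        ultimately have "(\<lambda>n. norm (grad (\<phi> n) y)) \<longlonglongrightarrow> 1 * ((0 + (norm y)\<^sup>2) powr (q / 2 - 1) * norm y)"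
          unfolding \<phi>_def norm_grad_smooth_profile[OF q1 R \<epsilon>(1)] by (rule tendsto_mult)
        moreover have "(0 + (norm y)\<^sup>2) powr (q / 2 - 1) * norm y = norm y powr (q - 1)"
        proof -
          have n2: "(norm y)\<^sup>2 = norm y powr 2" using True by (simp add: powr_numeral)
          have "(0 + (norm y)\<^sup>2) powr (q / 2 - 1) = norm y powr (2 * (q / 2 - 1))"
            by (simp only: n2 add_0 powr_powr)
          then have "(0 + (norm y)\<^sup>2) powr (q / 2 - 1) = norm y powr (q - 2)"
            by (simp add: right_diff_distrib)
          then show ?thesis using True by (simp add: powr_diff field_simps power2_eq_square powr_numeral)
        qed
        ultimately have "(\<lambda>n. norm (grad (\<phi> n) y) powr p) \<longlonglongrightarrow> (norm y powr (q - 1)) powr p"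
          using True by (intro tendsto_intros) auto
        then show ?thesis using True qp by (simp add: powr_powr)
      next
        case False
        then consider "y = 0" | "R \<le> norm y" by linarith
        then have g: "norm (grad (\<phi> n) y) = 0" for n
        proof cases
          case 1
          then show ?thesis by (simp add: \<phi>_def norm_grad_smooth_profile[OF q1 R \<epsilon>(1)])
        next
          case 2
          then show ?thesis using le[of n y] by simp
        qed
        have z: "norm y powr q * indicator ?B y = 0" using False by auto
        show ?thesis unfolding z g using p by simp
      qed
    qed
    show "(\<lambda>y. norm y powr q * indicator ?B y) \<in> borel_measurable lborel" by simp
    show "(\<lambda>y. norm (grad (\<phi> n) y) powr p) \<in> borel_measurable lborel" for n by simp
  qed
  moreover have "(LINT y|lborel. norm y powr q * indicator ?B y) = ?d * ?K"
  proof -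
    have "(LINT y|lborel. norm y powr q * indicator ?B y)
        = (LINT y|lborel. R powr q * indicator ?B y - q * profile q R (y::'a))"
    proof (rule Bochner_Integration.integral_cong)
      fix y :: 'a
      show "norm y powr q * indicator ?B y = R powr q * indicator ?B y - q * profile q R y"
        using P(3)[of y] P(4)[of y] q1 by (auto simp: indicator_def)
    qed simp
    also have "\<dots> = R powr q * measure lborel ?B - q * ?K"
      using indint[of "R powr q"] P(6) by (simp add: profile_mass_def)
    also have "\<dots> = ?d * ?K" using K(1) by (simp add: algebra_simps)
    finally show ?thesis .
  qed
  ultimately have 2: "(\<lambda>n. Dir p (\<phi> n)) \<longlonglongrightarrow> ?d * ?K" by (simp add: Dir_def)
  have "?K powr p \<le> torsion p ?B * (?d * ?K)"
  proof (rule LIMSEQ_le)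
    show "(\<lambda>n. Lp_mass 1 (\<phi> n) powr p) \<longlonglongrightarrow> ?K powr p"
      using K(2) by (intro tendsto_intros 1) auto
    show "(\<lambda>n. torsion p ?B * Dir p (\<phi> n)) \<longlonglongrightarrow> torsion p ?B * (?d * ?K)"
      by (intro tendsto_intros 2)
    show "\<exists>N. \<forall>n\<ge>N. Lp_mass 1 (\<phi> n) powr p \<le> torsion p ?B * Dir p (\<phi> n)"
      using torsion_bound[OF ball_convex_domain[OF R] p \<phi>] by blast
  qed
  then have "?K powr p / (?d * ?K) \<le> torsion p ?B" using K(2) by (simp add: divide_le_eq)
  moreover have "?K powr p / (?d * ?K) = ?K powr (p - 1) / ?d" using K(2) by (simp add: powr_diff)
  ultimately show ?thesis by simp
qed

text \<open>The quotient is invariant under dilations, so the ball may be rescaled to the volume of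
  \<Omega>; there the upper bound for \<Omega> and the lower bound for the ball are the same
  number.\<close>

theorem Saint_Venant:
  fixes \<Omega> :: "'a::euclidean_space set" and c :: 'a
  assumes \<Omega>: "\<Omega> \<in> convex_domains" and p: "1 < p" and r: "0 < r"
  shows "torsion p \<Omega> / measure lebesgue \<Omega> powr (p - 1 + p / real DIM('a))
    \<le> torsion p (ball c r) / measure lebesgue (ball c r) powr (p - 1 + p / real DIM('a))"
proof -
  let ?d = "real DIM('a)" and ?V = "measure lebesgue \<Omega>" and ?W = "measure lebesgue (ball c r)"
  let ?k = "p - 1 + p / real DIM('a)"
  have V: "0 < ?V" "0 < ?W"
    using convex_domainsD(6)[OF \<Omega>] convex_domainsD(6)[OF ball_convex_domain[OF r, of c]] by auto
  define a where "a = (?V / ?W) powr (1 / ?d)"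
  have a: "0 < a" "a powr ?d = ?V / ?W" using V by (auto simp: a_def powr_powr)
  define R where "R = a * r"
  have R: "0 < R" using a r by (simp add: R_def)
  have im: "(\<lambda>x. a *\<^sub>R x + (- (a *\<^sub>R c))) ` ball c r = ball 0 R"
  proof
    show "(\<lambda>x. a *\<^sub>R x + (- (a *\<^sub>R c))) ` ball c r \<subseteq> ball 0 R"
    proof
      fix y assume "y \<in> (\<lambda>x. a *\<^sub>R x + (- (a *\<^sub>R c))) ` ball c r"
      then obtain x where x: "x \<in> ball c r" "y = a *\<^sub>R x + (- (a *\<^sub>R c))" by blast
      have "y = a *\<^sub>R (x - c)" unfolding x(2) by (simp add: scaleR_diff_right)
      then show "y \<in> ball 0 R" using x(1) a by (simp add: R_def dist_norm norm_minus_commute)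
    qed
    show "ball 0 R \<subseteq> (\<lambda>x. a *\<^sub>R x + (- (a *\<^sub>R c))) ` ball c r"
    proof
      fix y :: 'a assume y: "y \<in> ball 0 R"
      have "norm (inverse a *\<^sub>R y) = norm y / a" using a by (simp add: divide_inverse)
      then have "c + inverse a *\<^sub>R y \<in> ball c r" using y a by (simp add: dist_norm R_def divide_less_eq mult.commute)
      moreover have "y = a *\<^sub>R (c + inverse a *\<^sub>R y) + (- (a *\<^sub>R c))" using a by (simp add: scaleR_right_distrib)
      ultimately show "y \<in> (\<lambda>x. a *\<^sub>R x + (- (a *\<^sub>R c))) ` ball c r" by blast
    qed
  qed
  have vol: "?V = measure lebesgue (ball (0::'a) R)"
    using measure_affine[OF a(1), of "- (a *\<^sub>R c)" "ball c r"] V unfolding im a(2) by simp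
  have "torsion p \<Omega> \<le> torsion p (ball (0::'a) R)"
    using torsion_upper[OF \<Omega> p R refl vol] torsion_ball_lower[OF p R refl, where 'a='a] by linarith
  also have "\<dots> = a powr (p + ?d * (p - 1)) * torsion p (ball c r)"
    using torsion_affine[OF ball_convex_domain[OF r, of c] a(1) p, of "- (a *\<^sub>R c)"] unfolding im .
  also have "a powr (p + ?d * (p - 1)) = (a powr ?d) powr ?k"
  proof -
    have "?d \<noteq> 0" by simp
    then have "p + ?d * (p - 1) = ?d * ?k" by (simp add: field_simps)
    then show ?thesis unfolding powr_powr by simp
  qed
  also have "\<dots> = ?V powr ?k / ?W powr ?k" unfolding a(2) using V by (simp add: powr_divide)
  finally show ?thesis using V by (simp add: divide_le_eq mult_ac)
qed

subsection \<open>Geometry of convex domains\<close>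

definition centroid :: "'a::euclidean_space set \<Rightarrow> 'a" where
  "centroid \<Omega> = (LINT x|lborel. indicator \<Omega> x *\<^sub>R x) /\<^sub>R measure lebesgue \<Omega>"

text \<open>The half-size copy of \<open>\<Omega>\<close> contracted towards \<open>y\<close> has a fixed proportion of the volume,
  which keeps the centroid away from the supporting hyperplane.\<close>

lemma centroid_support:
  fixes \<Omega> :: "'a::euclidean_space set"
  assumes \<Omega>: "\<Omega> \<in> convex_domains" and M: "\<And>x. x \<in> \<Omega> \<Longrightarrow> x \<bullet> e \<le> M" and y: "y \<in> \<Omega>"
  shows "(1 / 2) ^ (DIM('a) + 1) * (M - y \<bullet> e) \<le> M - centroid \<Omega> \<bullet> e"
proof -
  note D = convex_domainsD[OF \<Omega>]
  let ?V = "measure lebesgue \<Omega>"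
  have [measurable]: "\<Omega> \<in> sets borel" using D(2) by (simp add: borel_open)
  obtain r where r: "0 < r" "\<And>x. x \<in> \<Omega> \<Longrightarrow> norm x \<le> r" using D(4) bounded_pos by metis
  have ind: "integrable lborel (indicator \<Omega> :: 'a \<Rightarrow> real)"
    using D(7) by (intro integrable_real_indicator) auto
  have int: "integrable lborel (\<lambda>x. indicator \<Omega> x *\<^sub>R x)"
  proof (rule Bochner_Integration.integrable_bound)
    show "integrable lborel (\<lambda>x. r * indicator \<Omega> x)" using ind by simp
    show "AE x in lborel. norm (indicator \<Omega> x *\<^sub>R x) \<le> norm (r * indicator \<Omega> x)"
      using r by (intro AE_I2) (auto simp: indicator_def)
  qed measurable
  define \<Omega>' where "\<Omega>' = (\<lambda>x. (1 / 2) *\<^sub>R x + (1 / 2) *\<^sub>R y) ` \<Omega>"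
  have \<Omega>': "\<Omega>' \<in> convex_domains" "measure lebesgue \<Omega>' = (1 / 2) powr real DIM('a) * ?V"
    unfolding \<Omega>'_def using convex_domains_affine[OF \<Omega>, of "1 / 2"] measure_affine[of "1 / 2" _ \<Omega>] by auto
  have sub: "\<Omega>' \<subseteq> \<Omega>"
    unfolding \<Omega>'_def using convexD[OF D(3) _ y, of _ "1 / 2" "1 / 2"] by auto
  have ind': "integrable lborel (indicator \<Omega>' :: 'a \<Rightarrow> real)"
    using convex_domainsD(2,7)[OF \<Omega>'(1)] by (intro integrable_real_indicator) auto
  \<comment> \<open>On the contracted copy x \<bullet> e is at most the mean of M and y \<bullet> e,
    so the deficit M - x \<bullet> e is at least half of M - y \<bullet> e; on the rest of \<Omega>
    it is nonnegative.\<close>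
  have "(M - y \<bullet> e) / 2 * measure lebesgue \<Omega>' = (LINT x|lborel. (M - y \<bullet> e) / 2 * indicator \<Omega>' x)"
    using convex_domainsD(8)[OF \<Omega>'(1)] by simp
  also have "\<dots> \<le> (LINT x|lborel. M * indicator \<Omega> x - (indicator \<Omega> x *\<^sub>R x) \<bullet> e)"
  proof (rule integral_mono)
    show "integrable lborel (\<lambda>x. (M - y \<bullet> e) / 2 * indicator \<Omega>' x)" using ind' by simp
    show "integrable lborel (\<lambda>x. M * indicator \<Omega> x - (indicator \<Omega> x *\<^sub>R x) \<bullet> e)"
      using ind int by (intro Bochner_Integration.integrable_diff integrable_mult_right integrable_inner_left) auto
    fix x
    show "(M - y \<bullet> e) / 2 * indicator \<Omega>' x \<le> M * indicator \<Omega> x - (indicator \<Omega> x *\<^sub>R x) \<bullet> e"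
    proof (cases "x \<in> \<Omega>'")
      case True
      then obtain z where z: "z \<in> \<Omega>" "x = (1 / 2) *\<^sub>R z + (1 / 2) *\<^sub>R y" unfolding \<Omega>'_def by blast
      then have "x \<bullet> e = (z \<bullet> e + y \<bullet> e) / 2" by (simp add: inner_add_left add_divide_distrib)
      then have "x \<bullet> e \<le> (M + y \<bullet> e) / 2" using M[OF z(1)] by simp
      then show ?thesis using True sub by (auto simp: indicator_def field_simps)
    next
      case False
      then show ?thesis using M[of x] by (auto simp: indicator_def)
    qed
  qed
  also have "\<dots> = M * ?V - (LINT x|lborel. indicator \<Omega> x *\<^sub>R x) \<bullet> e"
  proof -
    have "(LINT x|lborel. (indicator \<Omega> x *\<^sub>R x) \<bullet> e) = (LINT x|lborel. indicator \<Omega> x *\<^sub>R x) \<bullet> e"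
      using int by (rule integral_inner_left)
    moreover have "integrable lborel (\<lambda>x. (indicator \<Omega> x *\<^sub>R x) \<bullet> e)"
      using int by (rule integrable_inner_left)
    ultimately show ?thesis
      using ind D(8) by (subst Bochner_Integration.integral_diff) auto
  qed
  also have "\<dots> = ?V * (M - centroid \<Omega> \<bullet> e)"
    using D(6) by (simp add: centroid_def right_diff_distrib)
  finally have "(M - y \<bullet> e) / 2 * ((1 / 2) ^ DIM('a) * ?V) \<le> ?V * (M - centroid \<Omega> \<bullet> e)"
    unfolding \<Omega>'(2) by (simp add: powr_realpow)
  then have "?V * ((1 / 2) ^ (DIM('a) + 1) * (M - y \<bullet> e)) \<le> ?V * (M - centroid \<Omega> \<bullet> e)"
    by (simp add: mult_ac)
  then show ?thesis using D(6) by simp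
qed

text \<open>\<open>W e\<close> is the width of \<Omega> in direction e. By
  \<open>centroid_support\<close> the centroid keeps a distance of at least 2^-(d+1) times this
  width from the supporting hyperplane, so a ball whose radius is that fraction of the infimum of
  the widths fits in.\<close>

lemma inscribed_ball_slab:
  fixes \<Omega> :: "'a::euclidean_space set"
  assumes \<Omega>: "\<Omega> \<in> convex_domains"
  obtains x0 e \<rho> where "norm e = 1" "0 < \<rho>" "ball x0 \<rho> \<subseteq> \<Omega>" "\<And>x. x \<in> \<Omega> \<Longrightarrow> \<bar>(x - x0) \<bullet> e\<bar> \<le> 2 ^ (DIM('a) + 2) * \<rho>"
proof -
  note D = convex_domainsD[OF \<Omega>]
  define h where "h e = (SUP x\<in>\<Omega>. x \<bullet> e)" for e
  define W where "W e = h e + h (- e)" for e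
  let ?c = "centroid \<Omega>" and ?k = "(1 / 2 :: real) ^ (DIM('a) + 1)"
  obtain r where r: "0 < r" "\<And>x. x \<in> \<Omega> \<Longrightarrow> norm x \<le> r" using D(4) bounded_pos by metis
  have bdd: "bdd_above ((\<lambda>x. x \<bullet> e) ` \<Omega>)" for e
  proof (rule bdd_aboveI2)
    fix x assume "x \<in> \<Omega>"
    then have "norm x * norm e \<le> r * norm e" using r by (intro mult_right_mono) auto
    then show "x \<bullet> e \<le> r * norm e" using norm_cauchy_schwarz[of x e] by linarith
  qed
  have hu: "x \<bullet> e \<le> h e" if "x \<in> \<Omega>" for x e
    unfolding h_def using cSUP_upper[OF that bdd] .
  have cent: "?k * W e \<le> h e - ?c \<bullet> e" for e
  proof -
    have "h (- e) \<le> (h e - ?c \<bullet> e) / ?k - h e"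
      unfolding h_def[of "- e"]
    proof (rule cSUP_least[OF D(1)])
      fix y assume y: "y \<in> \<Omega>"
      have "?k * (h e - y \<bullet> e) \<le> h e - ?c \<bullet> e" by (rule centroid_support[OF \<Omega> hu y])
      then have "h e - y \<bullet> e \<le> (h e - ?c \<bullet> e) / ?k" by (subst pos_le_divide_eq) (simp_all add: mult.commute)
      then show "y \<bullet> - e \<le> (h e - ?c \<bullet> e) / ?k - h e" by simp
    qed
    then have "W e \<le> (h e - ?c \<bullet> e) / ?k" by (simp add: W_def)
    then show ?thesis by (subst (asm) pos_le_divide_eq) (simp_all add: mult.commute)
  qed
  obtain z s where z: "0 < s" "ball z s \<subseteq> \<Omega>"
    using D(1,2) by (metis all_not_in_conv open_contains_ball)
  have Wlow: "s \<le> W e" if "norm e = 1" for e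
  proof -
    have "z + (s / 2) *\<^sub>R e \<in> \<Omega>" "z - (s / 2) *\<^sub>R e \<in> \<Omega>" using z that by (auto simp: dist_norm)
    from hu[OF this(1), of e] hu[OF this(2), of "- e"]
    have "z \<bullet> e + s / 2 \<le> h e" "- (z \<bullet> e) + s / 2 \<le> h (- e)"
      using that by (simp_all add: inner_add_left inner_diff_left norm_eq_1)
    then show ?thesis by (simp add: W_def)
  qed
  define w where "w = (INF e\<in>sphere 0 1. W e)"
  have ne: "sphere (0::'a) 1 \<noteq> {}" by simp
  have bb: "bdd_below (W ` sphere 0 1)" using Wlow by (intro bdd_belowI2[of _ s]) auto
  have w: "0 < w" using cINF_greatest[OF ne, of s W] Wlow z(1) by (auto simp: w_def)
  have wW: "w \<le> W e" if "norm e = 1" for e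
    unfolding w_def using that by (intro cINF_lower[OF bb]) auto
  have "w < 2 * w" using w by simp
  \<comment> \<open>A direction of width below twice the infimum makes it unnecessary to attain the
    infimum; this factor turns 2^(d+1) into 2^(d+2).\<close>
  then obtain e0 where e0: "norm e0 = 1" "W e0 < 2 * w"
    unfolding w_def using cINF_less_iff[OF ne bb] by auto
  define \<rho> where "\<rho> = ?k * w"
  have \<rho>: "0 < \<rho>" using w by (simp add: \<rho>_def)
  \<comment> \<open>Separation of a point needs a closed set. An open convex set is the interior of
    its closure, which brings the open ball back into \<Omega>.\<close>
  have "ball ?c \<rho> \<subseteq> closure \<Omega>"
  proof
    fix y assume y: "y \<in> ball ?c \<rho>"
    show "y \<in> closure \<Omega>"
    proof (rule ccontr)
      assume "y \<notin> closure \<Omega>"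
      then obtain a b where ab: "a \<bullet> y < b" "\<And>x. x \<in> closure \<Omega> \<Longrightarrow> b < a \<bullet> x"
        using separating_hyperplane_closed_point[of "closure \<Omega>" y] convex_closure[OF D(3)] by auto
      have a: "a \<noteq> 0" using ab D(1) closure_subset by fastforce
      define e where "e = - (a /\<^sub>R norm a)"
      have e: "norm e = 1" using a by (simp add: e_def)
      have ye: "x \<bullet> e \<le> y \<bullet> e" if "x \<in> \<Omega>" for x
      proof -
        have "a \<bullet> y \<le> a \<bullet> x" using ab that closure_subset by fastforce
        then have "a \<bullet> y / norm a \<le> a \<bullet> x / norm a" by (intro divide_right_mono) auto
        then show ?thesis by (simp add: e_def inner_commute divide_inverse mult.commute)
      qed
      then have "h e \<le> y \<bullet> e" unfolding h_def by (intro cSUP_least D)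
      then have "?k * w \<le> y \<bullet> e - ?c \<bullet> e"
      proof -
        have "?k * w \<le> ?k * W e" by (intro mult_left_mono wW e) simp
        with cent[of e] \<open>h e \<le> y \<bullet> e\<close> show ?thesis by linarith
      qed
      also have "\<dots> = (y - ?c) \<bullet> e" by (simp add: inner_diff_left)
      also have "\<dots> \<le> norm (y - ?c)" using norm_cauchy_schwarz[of "y - ?c" e] e by simp
      also have "\<dots> < \<rho>" using y by (simp add: dist_norm norm_minus_commute)
      finally show False by (simp add: \<rho>_def)
    qed
  qed
  then have "ball ?c \<rho> \<subseteq> interior (closure \<Omega>)" by (intro interior_maximal) auto
  then have ball: "ball ?c \<rho> \<subseteq> \<Omega>" using convex_interior_closure[OF D(3)] D(2) by (simp add: interior_open)
  show thesis
  proof (rule that[OF e0(1) \<rho> ball])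
    fix x assume x: "x \<in> \<Omega>"
    have c: "?c \<in> \<Omega>" using ball \<rho> by auto
    have "\<bar>(x - ?c) \<bullet> e0\<bar> \<le> W e0"
      using hu[OF x, of e0] hu[OF x, of "- e0"] hu[OF c, of e0] hu[OF c, of "- e0"]
      by (simp add: W_def inner_diff_left abs_le_iff)
    also have "\<dots> \<le> 2 * w" using e0(2) by simp
    also have "\<dots> = 2 ^ (DIM('a) + 2) * \<rho>" by (simp add: \<rho>_def power_divide)
    finally show "\<bar>(x - ?c) \<bullet> e0\<bar> \<le> 2 ^ (DIM('a) + 2) * \<rho>" .
  qed
qed

text \<open>Fixes the scale: the slab bounds the eigenvalue from below by a constant depending only
  on p and d, and the unit ball gives room for packing test functions. Since \<open>F\<close> is
  invariant, optimising sequences may consist of such sets.\<close>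

definition normalized :: "'a::euclidean_space set \<Rightarrow> bool" where
  "normalized \<Omega> \<longleftrightarrow> \<Omega> \<in> convex_domains \<and> ball 0 1 \<subseteq> \<Omega> \<and>
    (\<exists>e. norm e = 1 \<and> (\<forall>x\<in>\<Omega>. \<bar>(x - 0) \<bullet> e\<bar> \<le> 2 ^ (DIM('a) + 2)))"

lemma normalize:
  fixes \<Omega> :: "'a::euclidean_space set"
  assumes \<Omega>: "\<Omega> \<in> convex_domains" and p: "1 < p"
  obtains \<Omega>' :: "'a set" where "normalized \<Omega>'" "F p q \<Omega>' = F p q \<Omega>"
proof -
  obtain x0 e \<rho> where s: "norm e = 1" "0 < \<rho>" "ball x0 \<rho> \<subseteq> \<Omega>" "\<And>x. x \<in> \<Omega> \<Longrightarrow> \<bar>(x - x0) \<bullet> e\<bar> \<le> 2 ^ (DIM('a) + 2) * \<rho>"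
    using inscribed_ball_slab[OF \<Omega>] by metis
  let ?f = "\<lambda>x. inverse \<rho> *\<^sub>R x + (- (inverse \<rho> *\<^sub>R x0))"
  have i: "0 < inverse \<rho>" using s by simp
  have f: "?f x = inverse \<rho> *\<^sub>R (x - x0)" for x by (simp add: scaleR_diff_right)
  have "ball 0 1 \<subseteq> ?f ` \<Omega>"
  proof
    fix z :: 'a assume "z \<in> ball 0 1"
    then have "x0 + \<rho> *\<^sub>R z \<in> \<Omega>" using s by (auto simp: dist_norm)
    moreover have "?f (x0 + \<rho> *\<^sub>R z) = z" unfolding f using s by simp
    ultimately show "z \<in> ?f ` \<Omega>" by (metis image_eqI)
  qed
  moreover have "\<bar>(x - 0) \<bullet> e\<bar> \<le> 2 ^ (DIM('a) + 2)" if xi: "x \<in> ?f ` \<Omega>" for x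
  proof -
    obtain y where "x = ?f y" "y \<in> \<Omega>" using xi by (rule imageE)
    then have y: "y \<in> \<Omega>" "x = inverse \<rho> *\<^sub>R (y - x0)" unfolding f by blast+
    have "\<bar>x \<bullet> e\<bar> = inverse \<rho> * \<bar>(y - x0) \<bullet> e\<bar>" using s(2) by (simp add: y(2) abs_mult)
    also have "\<dots> \<le> inverse \<rho> * (2 ^ (DIM('a) + 2) * \<rho>)" using s(4)[OF y(1)] i by (intro mult_left_mono) auto
    also have "\<dots> = 2 ^ (DIM('a) + 2)" using s(2) by (simp add: field_simps)
    finally show ?thesis by simp
  qed
  ultimately have "normalized (?f ` \<Omega>)"
    unfolding normalized_def using convex_domains_affine[OF \<Omega> i] s(1) by blast
  then show thesis using that F_affine[OF \<Omega> i p] by blast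
qed

text \<open>A finite net of balls of radius r bounds the size of separated sets, because each of its
  balls contains at most one of their points. A separated set of largest size leaves no point of A
  uncovered.\<close>

lemma maximal_separated:
  fixes A :: "'a::euclidean_space set"
  assumes "bounded A" "0 < r"
  obtains S where "finite S" "S \<subseteq> A" "\<And>x y. x \<in> S \<Longrightarrow> y \<in> S \<Longrightarrow> x \<noteq> y \<Longrightarrow> 2 * r \<le> dist x y"
    "A \<subseteq> (\<Union>x\<in>S. ball x (2 * r))"
proof -
  define P where "P S \<longleftrightarrow> finite S \<and> S \<subseteq> A \<and> (\<forall>x\<in>S. \<forall>y\<in>S. x \<noteq> y \<longrightarrow> 2 * r \<le> dist x y)" for S
  have "compact (closure A)" using assms(1) by simp
  then obtain k where k: "finite k" "closure A \<subseteq> (\<Union>x\<in>k. ball x r)"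
    using seq_compact_imp_totally_bounded assms(2) unfolding compact_eq_seq_compact_metric by metis
  have "card S \<le> card k" if S: "P S" for S
  proof -
    have "\<forall>x\<in>S. \<exists>y\<in>k. x \<in> ball y r" using S k(2) closure_subset by (fastforce simp: P_def)
    then obtain f where f: "\<And>x. x \<in> S \<Longrightarrow> f x \<in> k" "\<And>x. x \<in> S \<Longrightarrow> dist (f x) x < r"
      by (metis mem_ball)
    have "inj_on f S"
    proof (rule inj_onI, rule ccontr)
      fix x y assume xy: "x \<in> S" "y \<in> S" "f x = f y" "x \<noteq> y"
      have "dist x y \<le> dist (f x) x + dist (f x) y" by (rule dist_triangle3)
      also have "\<dots> < 2 * r" using f(2)[OF xy(1)] f(2)[OF xy(2)] xy(3) by simp
      finally show False using S xy(1,2,4) unfolding P_def by (meson not_le)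
    qed
    then show ?thesis using f(1) k(1) by (intro card_inj_on_le) auto
  qed
  moreover have "P {}" by (simp add: P_def)
  ultimately obtain S where S: "P S" "\<And>S'. P S' \<Longrightarrow> card S' \<le> card S"
    using ex_has_greatest_nat[of P "{}" card "Suc (card k)"] by (auto simp: less_Suc_eq_le)
  show thesis
  proof (rule that[of S])
    show "A \<subseteq> (\<Union>x\<in>S. ball x (2 * r))"
    proof (rule ccontr)
      assume "\<not> ?thesis"
      then obtain a where a: "a \<in> A" "a \<notin> (\<Union>x\<in>S. ball x (2 * r))" by blast
      then have a: "a \<in> A" "\<And>x. x \<in> S \<Longrightarrow> 2 * r \<le> dist x a" by (auto simp: not_less)
      have "a \<notin> S" using a(2)[of a] assms(2) by auto
      moreover have Pi: "P (insert a S)"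
        using S(1) a unfolding P_def by (simp add: dist_commute)
      moreover have "finite S" using S(1) by (simp add: P_def)
      ultimately show False using S(2)[OF Pi] by simp
    qed
  qed (use S(1) in \<open>auto simp: P_def\<close>)
qed

lemma Cc_infinity_sum:
  assumes "finite I" "\<And>i. i \<in> I \<Longrightarrow> \<phi> i \<in> Cc_infinity \<Omega>"
  shows "(\<lambda>x. \<Sum>i\<in>I. \<phi> i x) \<in> Cc_infinity \<Omega>"
proof -
  have "\<exists>K. compact K \<and> K \<subseteq> \<Omega> \<and> (\<forall>x. x \<notin> K \<longrightarrow> \<phi> i x = 0)" if "i \<in> I" for i
    using Cc_infinity_support[OF assms(2)[OF that]] by metis
  then obtain K where K: "\<And>i. i \<in> I \<Longrightarrow> compact (K i)" "\<And>i. i \<in> I \<Longrightarrow> K i \<subseteq> \<Omega>"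
    "\<And>i x. i \<in> I \<Longrightarrow> x \<notin> K i \<Longrightarrow> \<phi> i x = 0" by metis
  show ?thesis
    by (rule Cc_infinityI[of _ "\<Union>i\<in>I. K i"])
      (use assms K Cc_infinityD(1)[OF assms(2)] in \<open>auto intro!: C_k_sum sum.neutral compact_UN\<close>)
qed

lemma grad_sum:
  assumes "finite I" "\<And>i. i \<in> I \<Longrightarrow> \<phi> i \<in> Cc_infinity \<Omega>"
  shows "grad (\<lambda>x. \<Sum>i\<in>I. \<phi> i x) x = (\<Sum>i\<in>I. grad (\<phi> i) x)"
  by (rule grad_eqI)
    (auto simp: inner_sum_left intro!: derivative_eq_intros Cc_infinityD(3)[OF assms(2)])

text \<open>The test function is a sum of disjoint bumps of unit size packed into \<open>\<Omega>\<close>.\<close>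

lemma torsion_packing_lower:
  assumes p: "1 < p"
  obtains c where "0 < c" "\<And>\<Omega>::'a::euclidean_space set. \<Omega> \<in> convex_domains \<Longrightarrow> ball 0 4 \<subseteq> \<Omega> \<Longrightarrow>
    c * measure lebesgue \<Omega> powr (p - 1) \<le> torsion p \<Omega>"
proof -
  let ?d = "real DIM('a)"
  have bumpU: "(bump :: 'a \<Rightarrow> real) \<in> Cc_infinity (cball 0 1)" by (rule bump_Cc) simp
  note CU = Cc_infinityD[OF bumpU]
  define b where "b = Lp_mass 1 (bump :: 'a \<Rightarrow> real)"
  have b: "0 < b" unfolding b_def
    by (rule Lp_mass_pos[OF bumpU, of _ 0]) (use bump_pos[of "0::'a"] in auto)
  have "compact (grad bump ` cball (0::'a) 1)"
    using CU(4) by (intro compact_continuous_image) (auto intro: continuous_on_subset)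
  then obtain G0 where G0: "\<forall>g\<in>grad bump ` cball (0::'a) 1. norm g \<le> G0"
    using compact_imp_bounded bounded_iff by blast
  have bzero: "bump x = 0" "grad bump x = 0" if "1 < norm x" for x :: 'a
    using Cc_infinity_support[OF bumpU] that by (metis mem_cball_0 not_less subset_eq)+
  define G where "G = \<bar>G0\<bar> + 1"
  have G: "0 < G" "norm (grad bump x) \<le> G" for x :: 'a
  proof -
    show "0 < G" by (simp add: G_def)
    show "norm (grad bump x) \<le> G"
    proof (cases "norm x \<le> 1")
      case True
      then have "norm (grad bump x) \<le> G0" using G0 by simp
      then show ?thesis by (simp add: G_def)
    next
      case False
      then show ?thesis using bzero(2)[of x] by (simp add: G_def)
    qed
  qed
  define \<omega> where "\<omega> = measure lebesgue (ball (0::'a) 1)"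
  have \<omega>: "0 < \<omega>" using convex_domainsD(6)[OF ball_convex_domain[of 1 "0::'a"]] by (simp add: \<omega>_def)
  define \<kappa> where "\<kappa> = b * (1 / 8) powr ?d / \<omega> / G"
  have \<kappa>: "0 < \<kappa>" using b \<omega> G by (simp add: \<kappa>_def)
  show thesis
  proof
    show "0 < \<kappa> powr p" using \<kappa> by simp
    fix \<Omega> :: "'a set" assume \<Omega>: "\<Omega> \<in> convex_domains" and ball: "ball 0 4 \<subseteq> \<Omega>"
    note D = convex_domainsD[OF \<Omega>]
    let ?V = "measure lebesgue \<Omega>"
    \<comment> \<open>Centres are taken from \<Omega>/2: for u in the unit ball, z/2 + u is the
      midpoint of z and 2u, and 2u lies in the ball of radius 4, hence in \<Omega>. So the bumps
      stay inside \<Omega>.\<close>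
    define A where "A = (\<lambda>x. (1 / 2) *\<^sub>R x + 0) ` \<Omega>"
    have A: "A \<in> convex_domains" "measure lebesgue A = (1 / 2) powr ?d * ?V"
      unfolding A_def using convex_domains_affine[OF \<Omega>, of "1 / 2" 0] measure_affine[of "1 / 2" 0 \<Omega>] by auto
    \<comment> \<open>The separation 3 exceeds the diameter 2 of the support of a bump, so at each
      point at most one bump has a nonzero gradient.\<close>
    obtain S where S: "finite S" "S \<subseteq> A" "\<And>x y. x \<in> S \<Longrightarrow> y \<in> S \<Longrightarrow> x \<noteq> y \<Longrightarrow> 2 * (3 / 2) \<le> dist x y"
      "A \<subseteq> (\<Union>x\<in>S. ball x (2 * (3 / 2)))"
      by (rule maximal_separated[OF convex_domainsD(4)[OF A(1)], of "3 / 2"]) (simp, blast)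
    let ?N = "real (card S)"
    have "(\<Union>x\<in>S. ball x 3) \<in> lmeasurable"
      using S(1) by (intro lmeasurable_open bounded_UN) auto
    then have "measure lebesgue A \<le> measure lebesgue (\<Union>x\<in>S. ball x 3)"
      using S(4) convex_domainsD(5)[OF A(1)] by (intro measure_mono_fmeasurable) auto
    also have "\<dots> \<le> (\<Sum>x\<in>S. measure lebesgue (ball x 3))"
      using S(1) by (intro measure_UNION_le) auto
    also have "\<dots> = ?N * (3 powr ?d * \<omega>)" using measure_ball[of 3, where 'a='a] by (simp add: \<omega>_def)
    \<comment> \<open>Rounding 3 up to 4 makes the constant a power of 1/8: the half-size copy
      contributes 1/2 and the covering balls 1/4.\<close>
    also have "\<dots> \<le> ?N * (4 powr ?d * \<omega>)"
      using \<omega> by (intro mult_left_mono mult_right_mono powr_mono2) auto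
    finally have N: "(1 / 2) powr ?d * ?V \<le> ?N * (4 powr ?d * \<omega>)" unfolding A(2) .
    have "(1 / 8) powr ?d * 4 powr ?d = (1 / 2 :: real) powr ?d"
      by (simp add: powr_mult[symmetric])
    then have "4 powr ?d * (1 / 8) powr ?d = (1 / 2 :: real) powr ?d"
      by (simp only: mult.commute)
    then have "(4 powr ?d * \<omega>) * ((1 / 8) powr ?d / \<omega> * ?V) = (1 / 2) powr ?d * ?V"
      using \<omega> by simp
    then have "(4 powr ?d * \<omega>) * ((1 / 8) powr ?d / \<omega> * ?V) \<le> (4 powr ?d * \<omega>) * ?N"
      using N by (simp add: mult.commute)
    then have N': "(1 / 8) powr ?d / \<omega> * ?V \<le> ?N"
      using \<omega> by (subst (asm) mult_le_cancel_left_pos) (auto intro: mult_pos_pos)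
    define \<psi> where "\<psi> x y = bump (1 *\<^sub>R y + (- x))" for x y :: 'a
    have \<psi>: "\<psi> x \<in> Cc_infinity \<Omega>" if xS: "x \<in> S" for x
      unfolding \<psi>_def[abs_def]
    proof (rule Cc_infinity_affine[OF bumpU])
      obtain z where z: "z \<in> \<Omega>" "x = (1 / 2) *\<^sub>R z" using xS S(2) by (auto simp: A_def)
      show "cball 0 1 \<subseteq> (\<lambda>y. 1 *\<^sub>R y + - x) ` \<Omega>"
      proof
        fix u :: 'a assume u: "u \<in> cball 0 1"
        then have "2 *\<^sub>R u \<in> ball 0 4" by simp
        then have "2 *\<^sub>R u \<in> \<Omega>" using ball by blast
        then have "(1 / 2) *\<^sub>R z + (1 / 2) *\<^sub>R (2 *\<^sub>R u) \<in> \<Omega>" using z by (intro convexD[OF D(3)]) auto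
        then have "x + u \<in> \<Omega>" using z by simp
        then show "u \<in> (\<lambda>y. 1 *\<^sub>R y + - x) ` \<Omega>" by (intro image_eqI[of _ _ "x + u"]) auto
      qed
    qed simp
    define \<phi> where "\<phi> y = (\<Sum>x\<in>S. \<psi> x y)" for y
    have \<phi>: "\<phi> \<in> Cc_infinity \<Omega>" unfolding \<phi>_def[abs_def] by (rule Cc_infinity_sum[OF S(1) \<psi>])
    have "Lp_mass 1 \<phi> = (LINT y|lborel. (\<Sum>x\<in>S. \<bar>\<psi> x y\<bar> powr 1))"
      unfolding Lp_mass_def \<phi>_def \<psi>_def by (simp add: bump_nonneg sum_nonneg)
    also have "\<dots> = (\<Sum>x\<in>S. Lp_mass 1 (\<psi> x))"
      unfolding Lp_mass_def
      by (rule Bochner_Integration.integral_sum) (rule Cc_integrable(1)[OF \<psi> zero_less_one])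
    also have "\<dots> = (\<Sum>x\<in>S. b)"
      unfolding \<psi>_def[abs_def] b_def Lp_mass_affine[OF bumpU zero_less_one] by simp
    finally have mass: "Lp_mass 1 \<phi> = ?N * b" by simp
    have gr: "norm (grad \<phi> y) powr p \<le> G powr p * indicator \<Omega> y" for y
    proof (cases "y \<in> \<Omega>")
      case True
      have g\<psi>: "grad (\<psi> x) y = grad bump (y - x)" for x
        unfolding \<psi>_def[abs_def] grad_affine[OF bumpU] by simp
      have g\<phi>: "grad \<phi> y = (\<Sum>x\<in>S. grad bump (y - x))"
        unfolding \<phi>_def[abs_def] by (simp only: grad_sum[OF S(1) \<psi>] g\<psi>)
      have "norm (grad \<phi> y) \<le> G"
      proof (cases "\<exists>x\<in>S. norm (y - x) \<le> 1")
        case True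
        then obtain x where x: "x \<in> S" "norm (y - x) \<le> 1" by blast
        have "1 < norm (y - x')" if "x' \<in> S - {x}" for x'
        proof -
          have "3 \<le> dist x x'" using S(3)[of x x'] x that by auto
          also have "\<dots> \<le> norm (y - x) + norm (y - x')" using dist_triangle3[of x x' y] by (simp add: dist_norm)
          finally show ?thesis using x by simp
        qed
        then have "(\<Sum>x'\<in>S - {x}. grad bump (y - x')) = 0" by (intro sum.neutral ballI bzero(2))
        then have "grad \<phi> y = grad bump (y - x)"
          unfolding g\<phi> sum.remove[OF S(1) x(1)] by simp
        then show ?thesis using G(2) by simp
      next
        case False
        then have "grad \<phi> y = 0"
          unfolding g\<phi> by (intro sum.neutral ballI bzero(2)) (auto simp: not_le)
        then show ?thesis using G(1) by simp
      qed
      then show ?thesis using True p by (simp add: powr_mono2)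
    next
      case False
      then have "grad \<phi> y = 0" using Cc_infinity_support[OF \<phi>] by (metis subset_eq)
      then show ?thesis by simp
    qed
    have ind: "integrable lborel (indicator \<Omega> :: 'a \<Rightarrow> real)"
      using D(2,7) by (intro integrable_real_indicator) auto
    have "Dir p \<phi> \<le> (LINT y|lborel. G powr p * indicator \<Omega> y)"
      unfolding Dir_def using Cc_integrable(2)[OF \<phi>, of p] p ind gr by (intro integral_mono) auto
    also have "\<dots> = G powr p * ?V" using D(8) by simp
    finally have dir: "Dir p \<phi> \<le> G powr p * ?V" .
    have "G * (\<kappa> * ?V) = b * ((1 / 8) powr ?d / \<omega> * ?V)" using G(1) by (simp add: \<kappa>_def)
    also have "\<dots> \<le> b * ?N" using N' b by (intro mult_left_mono) auto
    finally have "(G * (\<kappa> * ?V)) powr p \<le> (?N * b) powr p"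
      using G \<kappa> p D(6) by (intro powr_mono2) (auto simp: mult.commute)
    also have "\<dots> \<le> torsion p \<Omega> * Dir p \<phi>" using torsion_bound[OF \<Omega> p \<phi>] mass by simp
    also have "\<dots> \<le> torsion p \<Omega> * (G powr p * ?V)" using dir torsion_pos[OF \<Omega> p] by (intro mult_left_mono) auto
    finally have "G powr p * (\<kappa> powr p * ?V powr p) \<le> G powr p * (torsion p \<Omega> * ?V)"
      using G \<kappa> D(6) by (simp add: powr_mult mult_ac)
    then have "\<kappa> powr p * ?V powr p \<le> torsion p \<Omega> * ?V" using G(1) by simp
    then have "\<kappa> powr p * ?V powr p / ?V \<le> torsion p \<Omega>" using D(6) by (subst pos_divide_le_eq) auto
    moreover have "\<kappa> powr p * ?V powr p / ?V = \<kappa> powr p * ?V powr (p - 1)" using D(6) by (simp add: powr_diff)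
    ultimately show "\<kappa> powr p * ?V powr (p - 1) \<le> torsion p \<Omega>" by simp
  qed
qed

text \<open>A far point forces volume: at least |x|/2 disjoint balls of radius 1/2 are strung along
  the first half of the segment from the origin to x.\<close>

lemma domain_diameter:
  fixes \<Omega> :: "'a::euclidean_space set"
  assumes \<Omega>: "\<Omega> \<in> convex_domains" and ball: "ball 0 1 \<subseteq> \<Omega>" and x: "x \<in> \<Omega>"
  shows "norm x / 2 * measure lebesgue (ball (0::'a) (1 / 2)) \<le> measure lebesgue \<Omega>"
proof (cases "x = 0")
  case False
  define L where "L = norm x"
  have L: "0 < L" using False by (simp add: L_def)
  define m where "m = nat \<lfloor>L / 2\<rfloor>"
  have "real m = real_of_int \<lfloor>L / 2\<rfloor>" using L by (simp add: m_def)
  then have m: "real m \<le> L / 2" "L / 2 \<le> real (Suc m)"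
    using floor_correct[of "L / 2"] by linarith+
  define c where "c i = (real i / L) *\<^sub>R x" for i
  let ?w = "measure lebesgue (ball (0::'a) (1 / 2))"
  have sub: "ball (c i) (1 / 2) \<subseteq> \<Omega>" if "i \<le> m" for i
  proof
    fix z assume z: "z \<in> ball (c i) (1 / 2)"
    \<comment> \<open>The convex hull of x and the unit ball contains the ball of radius 1 - s about
      s x; up to the midpoint this radius is at least 1/2.\<close>
    define s where "s = real i / L"
    have "real i \<le> L / 2" using m(1) that by linarith
    then have s: "0 \<le> s" "s \<le> 1 / 2" using L by (simp_all add: s_def divide_le_eq)
    define u where "u = 1 - s"
    have u: "1 / 2 \<le> u" "s + u = 1" using s by (auto simp: u_def)
    have "norm (z - c i) < u" using z u(1) by (simp add: dist_norm norm_minus_commute)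
    then have "norm (inverse u *\<^sub>R (z - c i)) < 1"
      using u(1) by (simp add: divide_less_eq flip: divide_inverse_commute)
    then have "inverse u *\<^sub>R (z - c i) \<in> \<Omega>" using ball by (metis mem_ball_0 subsetD)
    then have "s *\<^sub>R x + u *\<^sub>R (inverse u *\<^sub>R (z - c i)) \<in> \<Omega>"
      using x s(1) u by (intro convexD[OF convex_domainsD(3)[OF \<Omega>]]) auto
    then show "z \<in> \<Omega>" using u(1) by (simp add: c_def s_def)
  qed
  have disj: "pairwise (\<lambda>i j. disjnt (ball (c i) (1 / 2)) (ball (c j) (1 / 2))) {..m}"
  proof (rule pairwiseI)
    fix i j :: nat assume "i \<noteq> j"
    then have "1 \<le> \<bar>real i - real j\<bar>" by linarith
    moreover have "dist (c i) (c j) = \<bar>real i - real j\<bar>"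
    proof -
      have "c i - c j = ((real i - real j) / L) *\<^sub>R x"
        by (simp add: c_def scaleR_diff_left[symmetric] diff_divide_distrib)
      then show ?thesis using L by (simp add: dist_norm L_def)
    qed
    ultimately have "1 / 2 + 1 / 2 \<le> dist (c i) (c j)" by simp
    then show "disjnt (ball (c i) (1 / 2)) (ball (c j) (1 / 2))"
      unfolding disjnt_def by (rule disjoint_ballI)
  qed
  have "L / 2 * ?w \<le> real (Suc m) * ?w" using m(2) by (intro mult_right_mono) auto
  also have "\<dots> = (\<Sum>i\<le>m. measure lebesgue (ball (c i) (1 / 2)))"
    using measure_ball[of "1 / 2", where 'a='a] by simp
  also have "\<dots> = measure lebesgue (\<Union>i\<le>m. ball (c i) (1 / 2))"
    by (rule measure_UNION'[symmetric]) (use disj in auto)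
  also have "\<dots> \<le> measure lebesgue \<Omega>"
    using sub convex_domainsD(5)[OF \<Omega>] by (intro measure_mono_fmeasurable) (auto simp: borel_open)
  finally show ?thesis by (simp add: L_def)
qed simp

section \<open>Bounds for \<open>F\<close> on normalized domains\<close>

lemma F_factor:
  fixes \<Omega> :: "'a::euclidean_space set"
  assumes \<Omega>: "\<Omega> \<in> convex_domains" and p: "1 < p"
  shows "F p q \<Omega> = F p 1 \<Omega> * (torsion p \<Omega> / measure lebesgue \<Omega> powr (p - 1 + p / real DIM('a))) powr (q - 1)"
proof -
  let ?d = "real DIM('a)" and ?V = "measure lebesgue \<Omega>" and ?T = "torsion p \<Omega>"
  note T = torsion_pos[OF \<Omega> p]
  define k where "k = p - 1 + p / ?d"
  have a: "?T powr q = ?T * ?T powr (q - 1)" using T by (simp add: powr_diff)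
  have b: "(?T / ?V powr k) powr (q - 1) = ?T powr (q - 1) / ?V powr (k * (q - 1))"
    using T by (simp add: powr_divide powr_powr)
  have "scaling_exponent p q DIM('a) = (p - 1) + k * (q - 1)"
    by (simp add: scaling_exponent_def k_def field_simps)
  then have c: "?V powr scaling_exponent p q DIM('a) = ?V powr (p - 1) * ?V powr (k * (q - 1))"
    by (simp add: powr_add)
  have "F p 1 \<Omega> = eigenvalue p \<Omega> * ?T / ?V powr (p - 1)"
    using T by (simp add: F_def scaling_exponent_def)
  then show ?thesis unfolding k_def[symmetric] b unfolding F_def a c by simp
qed

lemma F_nonneg:
  assumes "\<Omega> \<in> convex_domains" "1 < p"
  shows "0 \<le> F p q \<Omega>" "0 < F p q \<Omega>"
  using eigenvalue_pos[OF assms] torsion_pos[OF assms] convex_domainsD(6)[OF assms(1)] by (auto simp: F_def)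

lemma F_one_le:
  fixes \<Omega> :: "'a::euclidean_space set"
  assumes \<Omega>: "\<Omega> \<in> convex_domains" and p: "1 < p"
  shows "F p 1 \<Omega> \<le> 1"
  using torsion_eigenvalue_le[OF assms] convex_domainsD(6)[OF \<Omega>] torsion_pos[OF assms]
  by (simp add: F_def scaling_exponent_def)

lemma normalized_torsion_ratio_upper:
  fixes \<Omega> :: "'a::euclidean_space set"
  assumes n: "normalized \<Omega>" and p: "1 < p"
  shows "torsion p \<Omega> \<le> (2 * p * 2 ^ (DIM('a) + 2)) powr p * measure lebesgue \<Omega> powr (p - 1)"
    and "(2 * p * 2 ^ (DIM('a) + 2)) powr (- p) \<le> eigenvalue p \<Omega>"
proof -
  let ?L = "2 ^ (DIM('a) + 2) :: real"
  obtain e where e: "norm e = 1" "\<And>x. x \<in> \<Omega> \<Longrightarrow> \<bar>(x - 0) \<bullet> e\<bar> \<le> ?L" and \<Omega>: "\<Omega> \<in> convex_domains"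
    using n unfolding normalized_def by blast
  show low: "(2 * p * ?L) powr (- p) \<le> eigenvalue p \<Omega>"
    by (rule eigenvalue_ge_slab[OF \<Omega> p e(1) _ e(2)]) simp_all
  have "(2 * p * ?L) powr (- p) * torsion p \<Omega> \<le> eigenvalue p \<Omega> * torsion p \<Omega>"
    using low torsion_pos[OF \<Omega> p] by (intro mult_right_mono) auto
  also have "\<dots> \<le> measure lebesgue \<Omega> powr (p - 1)" by (rule torsion_eigenvalue_le[OF \<Omega> p])
  finally have "(2 * p * ?L) powr p * ((2 * p * ?L) powr (- p) * torsion p \<Omega>)
      \<le> (2 * p * ?L) powr p * measure lebesgue \<Omega> powr (p - 1)" by (intro mult_left_mono) auto
  moreover have "(2 * p * ?L) powr p * (2 * p * ?L) powr (- p) = 1"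
    using p by (simp only: powr_add[symmetric]) simp
  ultimately show "torsion p \<Omega> \<le> (2 * p * ?L) powr p * measure lebesgue \<Omega> powr (p - 1)"
    by (simp add: mult.assoc[symmetric])
qed

text \<open>Dilation by 4 turns the inscribed unit ball into the ball of radius 4 in
  \<open>torsion_packing_lower\<close> and changes only the constant.\<close>

lemma normalized_torsion_lower:
  assumes p: "1 < p"
  obtains c where "0 < c" "\<And>\<Omega>::'a::euclidean_space set. normalized \<Omega> \<Longrightarrow>
    c * measure lebesgue \<Omega> powr (p - 1) \<le> torsion p \<Omega>"
proof -
  obtain c where c: "0 < c" "\<And>\<Omega>::'a set. \<Omega> \<in> convex_domains \<Longrightarrow> ball 0 4 \<subseteq> \<Omega> \<Longrightarrow>
      c * measure lebesgue \<Omega> powr (p - 1) \<le> torsion p \<Omega>"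
    using torsion_packing_lower[OF p] by metis
  let ?d = "real DIM('a)"
  let ?k = "4 powr (?d * (p - 1)) / 4 powr (p + ?d * (p - 1)) :: real"
  show thesis
  proof
    show "0 < c * ?k" using c by simp
    fix \<Omega> :: "'a set" assume n: "normalized \<Omega>"
    then have \<Omega>: "\<Omega> \<in> convex_domains" "ball 0 1 \<subseteq> \<Omega>" by (auto simp: normalized_def)
    have "ball 0 4 \<subseteq> (\<lambda>x. 4 *\<^sub>R x + 0) ` \<Omega>"
    proof
      fix z :: 'a assume "z \<in> ball 0 4"
      then have "(1 / 4) *\<^sub>R z \<in> \<Omega>" using \<Omega>(2) by auto
      then show "z \<in> (\<lambda>x. 4 *\<^sub>R x + 0) ` \<Omega>" by (intro image_eqI[of _ _ "(1 / 4) *\<^sub>R z"]) auto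
    qed
    then have "c * measure lebesgue ((\<lambda>x. 4 *\<^sub>R x + 0) ` \<Omega>) powr (p - 1) \<le> torsion p ((\<lambda>x. 4 *\<^sub>R x + 0) ` \<Omega>)"
      using \<Omega>(1) by (intro c(2) convex_domains_affine) auto
    then have "c * (4 powr ?d * measure lebesgue \<Omega>) powr (p - 1) \<le> 4 powr (p + ?d * (p - 1)) * torsion p \<Omega>"
      using torsion_affine[OF \<Omega>(1) _ p, of 4 0] measure_affine[of 4 0 \<Omega>] by simp
    moreover have "c * (4 powr ?d * measure lebesgue \<Omega>) powr (p - 1) = 4 powr (?d * (p - 1)) * (c * measure lebesgue \<Omega> powr (p - 1))"
      by (simp add: powr_mult powr_powr)
    ultimately have "4 powr (?d * (p - 1)) * (c * measure lebesgue \<Omega> powr (p - 1)) / 4 powr (p + ?d * (p - 1)) \<le> torsion p \<Omega>"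
      by (subst pos_divide_le_eq) (auto simp: mult.commute)
    then show "c * ?k * measure lebesgue \<Omega> powr (p - 1) \<le> torsion p \<Omega>" by (simp add: mult_ac)
  qed
qed

text \<open>The volume exponents combine to (p - 1) q - \<alpha> = p (1 - q) / d with \<alpha> the
  \<open>scaling_exponent\<close>. This is positive for q < 1, so F bounds the volume along
  minimising sequences.\<close>

lemma normalized_F_lower:
  assumes p: "1 < p" and q: "0 < q" "q < 1"
  obtains c where "0 < c" "\<And>\<Omega>::'a::euclidean_space set. normalized \<Omega> \<Longrightarrow>
    c * measure lebesgue \<Omega> powr (p * (1 - q) / real DIM('a)) \<le> F p q \<Omega>"
proof -
  obtain c where c: "0 < c" "\<And>\<Omega>::'a set. normalized \<Omega> \<Longrightarrow>
    c * measure lebesgue \<Omega> powr (p - 1) \<le> torsion p \<Omega>"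
    using normalized_torsion_lower[OF p] by metis
  define l where "l = (2 * p * 2 ^ (DIM('a) + 2)) powr (- p)"
  have l: "0 < l" using p by (simp add: l_def)
  show thesis
  proof
    show "0 < l * c powr q" using l c by simp
    fix \<Omega> :: "'a set" assume n: "normalized \<Omega>"
    then have \<Omega>: "\<Omega> \<in> convex_domains" by (simp add: normalized_def)
    let ?V = "measure lebesgue \<Omega>" and ?\<alpha> = "scaling_exponent p q DIM('a)"
    have V: "0 < ?V" by (rule convex_domainsD(6)[OF \<Omega>])
    have "l * c powr q * ?V powr (p * (1 - q) / real DIM('a)) = l * (c powr q * ?V powr ((p - 1) * q)) / ?V powr ?\<alpha>"
    proof -
      have "?V powr (p * (1 - q) / real DIM('a)) = ?V powr ((p - 1) * q - ?\<alpha>)"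
        by (rule arg_cong[where f="\<lambda>t. ?V powr t"]) (simp add: scaling_exponent_def field_simps)
      then show ?thesis by (simp add: powr_diff)
    qed
    also have "\<dots> = l * (c * ?V powr (p - 1)) powr q / ?V powr ?\<alpha>"
      using c V by (simp add: powr_mult powr_powr)
    also have "\<dots> \<le> F p q \<Omega>"
      unfolding F_def l_def using normalized_torsion_ratio_upper(2)[OF n p] c(2)[OF n] c(1) V q eigenvalue_pos[OF \<Omega> p]
      by (intro divide_right_mono mult_mono powr_mono2) auto
    finally show "l * c powr q * ?V powr (p * (1 - q) / real DIM('a)) \<le> F p q \<Omega>" .
  qed
qed

text \<open>By \<open>F_factor\<close> and \<open>F_one_le\<close> only the torsion ratio matters,
  and on normalized domains it is at most a multiple of |\<Omega>|^(-p/d). Large volume thus makes F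
  small, which maximising sequences cannot afford.\<close>

lemma normalized_F_upper:
  assumes p: "1 < p" and q: "1 < q"
  obtains c where "0 < c" "\<And>\<Omega>::'a::euclidean_space set. normalized \<Omega> \<Longrightarrow>
    F p q \<Omega> \<le> c * measure lebesgue \<Omega> powr (- (p * (q - 1) / real DIM('a)))"
proof -
  let ?d = "real DIM('a)"
  define C where "C = (2 * p * 2 ^ (DIM('a) + 2)) powr p"
  have C: "0 < C" using p by (simp add: C_def)
  show thesis
  proof
    show "0 < C powr (q - 1)" using C by simp
    fix \<Omega> :: "'a set" assume n: "normalized \<Omega>"
    then have \<Omega>: "\<Omega> \<in> convex_domains" by (simp add: normalized_def)
    let ?V = "measure lebesgue \<Omega>"
    have V: "0 < ?V" by (rule convex_domainsD(6)[OF \<Omega>])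
    note T = torsion_pos[OF \<Omega> p]
    have "torsion p \<Omega> / ?V powr (p - 1 + p / ?d) \<le> C * ?V powr (p - 1) / ?V powr (p - 1 + p / ?d)"
      using normalized_torsion_ratio_upper(1)[OF n p] by (intro divide_right_mono) (auto simp: C_def)
    also have "\<dots> = C * ?V powr (- (p / ?d))"       by (simp add: powr_diff[symmetric] flip: times_divide_eq_right)
    finally have "(torsion p \<Omega> / ?V powr (p - 1 + p / ?d)) powr (q - 1) \<le> (C * ?V powr (- (p / ?d))) powr (q - 1)"
      using T q by (intro powr_mono2) auto
    also have "\<dots> = C powr (q - 1) * ?V powr (- (p * (q - 1) / ?d))"
      using C by (simp add: powr_mult powr_powr)
    finally have "F p 1 \<Omega> * (torsion p \<Omega> / ?V powr (p - 1 + p / ?d)) powr (q - 1)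
        \<le> 1 * (C powr (q - 1) * ?V powr (- (p * (q - 1) / ?d)))"
      using F_one_le[OF \<Omega> p] by (intro mult_mono) auto
    then show "F p q \<Omega> \<le> C powr (q - 1) * ?V powr (- (p * (q - 1) / ?d))"
      unfolding F_factor[OF \<Omega> p, of q] by simp
  qed
qed

subsection \<open>Compactness and existence of optimal domains\<close>

definition Minkowski_gauge :: "'a::euclidean_space set \<Rightarrow> 'a \<Rightarrow> real" where
  "Minkowski_gauge \<Omega> x = Inf {s. 0 < s \<and> inverse s *\<^sub>R x \<in> \<Omega>}"

context
  fixes \<Omega> :: "'a::euclidean_space set" and D :: real
  assumes \<Omega>: "open \<Omega>" "convex \<Omega>" and inner: "ball 0 1 \<subseteq> \<Omega>" and outer: "\<Omega> \<subseteq> ball 0 D" and D: "0 < D"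
begin

lemma in_unit: "norm x < 1 \<Longrightarrow> x \<in> \<Omega>"
  using inner by (metis mem_ball_0 subsetD)

lemma scaled_in_unit: "norm x < s \<Longrightarrow> inverse s *\<^sub>R x \<in> \<Omega>"
proof (rule in_unit)
  assume "norm x < s"
  moreover from this have "0 < s" using norm_ge_zero[of x] by linarith
  ultimately show "norm (inverse s *\<^sub>R x) < 1"
    by (simp add: divide_less_eq flip: divide_inverse_commute)
qed

lemma gauge_set_nonempty: "{s. 0 < s \<and> inverse s *\<^sub>R x \<in> \<Omega>} \<noteq> {}"
proof -
  have "inverse (norm x + 1) *\<^sub>R x \<in> \<Omega>" by (rule scaled_in_unit) simp
  moreover have "0 < norm x + 1" by (simp add: add_nonneg_pos)
  ultimately show ?thesis by blast
qed

lemma gauge_le: "0 < s \<Longrightarrow> inverse s *\<^sub>R x \<in> \<Omega> \<Longrightarrow> Minkowski_gauge \<Omega> x \<le> s"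
  unfolding Minkowski_gauge_def by (intro cInf_lower bdd_belowI[of _ 0]) auto

text \<open>Every number above the infimum is admissible because \<Omega> is star-shaped about
  0.\<close>

lemma gauge_lessD:
  assumes "Minkowski_gauge \<Omega> x < s" shows "inverse s *\<^sub>R x \<in> \<Omega>"
proof -
  obtain t where t: "0 < t" "inverse t *\<^sub>R x \<in> \<Omega>" "t < s"
    using cInf_lessD[OF gauge_set_nonempty] assms unfolding Minkowski_gauge_def by blast
  have "(t / s) *\<^sub>R (inverse t *\<^sub>R x) + (1 - t / s) *\<^sub>R 0 \<in> \<Omega>"
    using t in_unit[of 0] by (intro convexD[OF \<Omega>(2)]) auto
  moreover have "t / s * inverse t = inverse s" using t by (simp add: field_simps)
  ultimately show ?thesis by (simp only: scaleR_scaleR scaleR_zero_right add_0_right)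
qed

lemma gauge_lower: "norm x / D \<le> Minkowski_gauge \<Omega> x"
  unfolding Minkowski_gauge_def
proof (rule cInf_greatest[OF gauge_set_nonempty])
  fix s assume "s \<in> {s. 0 < s \<and> inverse s *\<^sub>R x \<in> \<Omega>}"
  then have s: "0 < s" "norm (inverse s *\<^sub>R x) < D" using outer by auto
  have "norm x = s * norm (inverse s *\<^sub>R x)" using s(1) by simp
  also have "\<dots> \<le> s * D" using s by (intro mult_left_mono) auto
  finally show "norm x / D \<le> s" using D by (simp add: divide_le_eq)
qed

lemma gauge_nonneg: "0 \<le> Minkowski_gauge \<Omega> x"
  using gauge_lower[of x] D by (smt (verit) divide_nonneg_pos norm_ge_zero)

lemma gauge_upper: "Minkowski_gauge \<Omega> x \<le> norm x"
proof (rule dense_ge)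
  fix s assume s: "norm x < s"
  then have "0 < s" using norm_ge_zero[of x] by linarith
  then show "Minkowski_gauge \<Omega> x \<le> s" using scaled_in_unit[OF s] by (intro gauge_le)
qed

lemma gauge_add: "Minkowski_gauge \<Omega> (x + y) \<le> Minkowski_gauge \<Omega> x + Minkowski_gauge \<Omega> y"
proof (rule field_le_epsilon)
  fix e :: real assume e: "0 < e"
  define s t where "s = Minkowski_gauge \<Omega> x + e / 2" and "t = Minkowski_gauge \<Omega> y + e / 2"
  have st: "0 < s" "0 < t" using gauge_nonneg[of x] gauge_nonneg[of y] e by (auto simp: s_def t_def)
  have "inverse s *\<^sub>R x \<in> \<Omega>" "inverse t *\<^sub>R y \<in> \<Omega>"
    using e by (auto intro!: gauge_lessD simp: s_def t_def)
  then have "(s / (s + t)) *\<^sub>R (inverse s *\<^sub>R x) + (t / (s + t)) *\<^sub>R (inverse t *\<^sub>R y) \<in> \<Omega>"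
    using st by (intro convexD[OF \<Omega>(2)]) (auto simp: add_divide_distrib[symmetric])
  moreover have "(s / (s + t)) *\<^sub>R (inverse s *\<^sub>R x) = inverse (s + t) *\<^sub>R x"
    "(t / (s + t)) *\<^sub>R (inverse t *\<^sub>R y) = inverse (s + t) *\<^sub>R y"
    using st by (simp_all add: divide_inverse)
  ultimately have "inverse (s + t) *\<^sub>R (x + y) \<in> \<Omega>" by (simp only: scaleR_right_distrib)
  then have "Minkowski_gauge \<Omega> (x + y) \<le> s + t" using st by (intro gauge_le) auto
  then show "Minkowski_gauge \<Omega> (x + y) \<le> Minkowski_gauge \<Omega> x + Minkowski_gauge \<Omega> y + e"
    by (simp add: s_def t_def)
qed

lemma gauge_scale:
  assumes a: "0 < a" shows "Minkowski_gauge \<Omega> (a *\<^sub>R x) \<le> a * Minkowski_gauge \<Omega> x"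
proof -
  have "Minkowski_gauge \<Omega> (a *\<^sub>R x) / a \<le> Minkowski_gauge \<Omega> x"
  proof (rule dense_ge)
    fix s assume s: "Minkowski_gauge \<Omega> x < s"
    then have s0: "0 < s" using gauge_nonneg[of x] by linarith
    have "inverse (a * s) * a = inverse s" using a s0 by (simp add: field_simps)
    then have "inverse (a * s) *\<^sub>R (a *\<^sub>R x) \<in> \<Omega>"
      using gauge_lessD[OF s] by (simp only: scaleR_scaleR)
    then have "Minkowski_gauge \<Omega> (a *\<^sub>R x) \<le> a * s" using a s0 by (intro gauge_le) auto
    then show "Minkowski_gauge \<Omega> (a *\<^sub>R x) / a \<le> s" using a by (simp add: divide_le_eq mult.commute)
  qed
  then show ?thesis using a by (simp add: divide_le_eq mult.commute)
qed

text \<open>Subadditivity and the inscribed unit ball give the same constant 1 for all domains,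
  hence the equicontinuity needed for compactness.\<close>

lemma gauge_Lipschitz: "\<bar>Minkowski_gauge \<Omega> x - Minkowski_gauge \<Omega> y\<bar> \<le> norm (x - y)"
  using gauge_add[of y "x - y"] gauge_upper[of "x - y"] gauge_add[of x "y - x"] gauge_upper[of "y - x"]
  by (simp add: norm_minus_commute abs_le_iff)

lemma gauge_convex:
  assumes "0 \<le> u" "0 \<le> v" "u + v = 1"
  shows "Minkowski_gauge \<Omega> (u *\<^sub>R x + v *\<^sub>R y) \<le> u * Minkowski_gauge \<Omega> x + v * Minkowski_gauge \<Omega> y"
proof (cases "u = 0 \<or> v = 0")
  case True
  then show ?thesis using assms by auto
next
  case False
  then show ?thesis
    using assms gauge_add[of "u *\<^sub>R x" "v *\<^sub>R y"] gauge_scale[of u x] gauge_scale[of v y] by simp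
qed

end

text \<open>Blaschke selection through gauges: Arzela--Ascoli gives a uniform limit, and its
  sublevel set below 1 is the limit domain. Convergence is expressed by dilates because torsion,
  eigenvalue and volume are monotone and scale explicitly.\<close>

lemma convex_domains_compact:
  fixes \<Omega> :: "nat \<Rightarrow> 'a::euclidean_space set"
  assumes \<Omega>: "\<And>n. \<Omega> n \<in> convex_domains" and inner: "\<And>n. ball 0 1 \<subseteq> \<Omega> n" and outer: "\<And>n. \<Omega> n \<subseteq> ball 0 D"
    and D: "0 < D"
  obtains \<Omega>' k where "\<Omega>' \<in> convex_domains" "strict_mono (k :: nat \<Rightarrow> nat)"
    "\<And>s. 0 < s \<Longrightarrow> s < 1 \<Longrightarrow> \<forall>\<^sub>F n in sequentially.
      (\<lambda>x. (1 - s) *\<^sub>R x + 0) ` \<Omega>' \<subseteq> \<Omega> (k n) \<and> \<Omega> (k n) \<subseteq> (\<lambda>x. (1 + s) *\<^sub>R x + 0) ` \<Omega>'"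
proof -
  note cd = convex_domainsD(2,3)[OF \<Omega>]
  define j where "j n = Minkowski_gauge (\<Omega> n)" for n
  have jupper: "j n x \<le> norm x" for n x unfolding j_def by (rule gauge_upper[OF cd inner outer D])
  have jlower: "norm x / D \<le> j n x" for n x unfolding j_def by (rule gauge_lower[OF cd inner outer D])
  have jnn: "0 \<le> j n x" for n x unfolding j_def by (rule gauge_nonneg[OF cd inner outer D])
  have jconv: "j n (u *\<^sub>R x + v *\<^sub>R y) \<le> u * j n x + v * j n y" if "0 \<le> u" "0 \<le> v" "u + v = 1" for n x y u v
    unfolding j_def by (rule gauge_convex[OF cd inner outer D that])
  have jscale: "j n (a *\<^sub>R x) \<le> a * j n x" if "0 < a" for n a x
    unfolding j_def by (rule gauge_scale[OF cd inner outer D that])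
  have jle: "j n x \<le> s" if "0 < s" "inverse s *\<^sub>R x \<in> \<Omega> n" for n s x
    unfolding j_def by (rule gauge_le[OF cd inner outer D that])
  have jless: "inverse s *\<^sub>R x \<in> \<Omega> n" if "j n x < s" for n s x
    using that unfolding j_def by (rule gauge_lessD[OF cd inner outer D])
  let ?S = "cball (0::'a) (2 * D)"
  obtain g k where g: "continuous_on ?S g" "strict_mono (k :: nat \<Rightarrow> nat)"
    "\<And>e. 0 < e \<Longrightarrow> \<exists>N. \<forall>n x. n \<ge> N \<and> x \<in> ?S \<longrightarrow> norm (j (k n) x - g x) < e"
  proof (rule Arzela_Ascoli[of ?S j "2 * D"])
    show "compact ?S" by simp
    show "norm (j n x) \<le> 2 * D" if "x \<in> ?S" for n x
      using that jupper[of n x] jnn[of n x] by simp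
    show "\<exists>d. 0 < d \<and> (\<forall>n y. y \<in> ?S \<and> norm (x - y) < d \<longrightarrow> norm (j n x - j n y) < e)"
      if "x \<in> ?S" "0 < e" for x e
    proof (intro exI[of _ e] conjI allI impI)
      fix n y assume "y \<in> ?S \<and> norm (x - y) < e"
      then show "norm (j n x - j n y) < e"
        using gauge_Lipschitz[OF cd inner outer D, of n x y] by (simp add: j_def)
    qed (use that in auto)
  qed blast
  have glim: "(\<lambda>n. j (k n) x) \<longlonglongrightarrow> g x" if "x \<in> ?S" for x
    using g(3) that by (intro LIMSEQ_I) blast
  have gupper: "g x \<le> norm x" and glower: "norm x / D \<le> g x" if "x \<in> ?S" for x
    using jupper jlower by (auto intro!: LIMSEQ_le_const2[OF glim[OF that]] LIMSEQ_le_const[OF glim[OF that]])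
  define \<Omega>' where "\<Omega>' = ball 0 (2 * D) \<inter> g -` {..<1}"
  have small: "norm x < D" if "x \<in> \<Omega>'" for x
  proof -
    have "norm x / D < 1" using glower[of x] that by (auto simp: \<Omega>'_def)
    then show ?thesis using D by (simp add: divide_less_eq)
  qed
  have "\<Omega>' \<in> convex_domains"
    unfolding convex_domains_def
  proof (intro CollectI conjI)
    show "open \<Omega>'"
      unfolding \<Omega>'_def using g(1)
      by (intro continuous_open_preimage) (auto intro: continuous_on_subset)
    show "bounded \<Omega>'" unfolding \<Omega>'_def by (simp add: bounded_Int)
    have "g 0 \<le> 0" using gupper[of 0] D by simp
    then have "0 \<in> \<Omega>'" using D by (simp add: \<Omega>'_def)
    then show "\<Omega>' \<noteq> {}" by blast
    show "convex \<Omega>'"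
      unfolding convex_def
    proof (intro ballI allI impI)
      fix x y u v assume xy: "x \<in> \<Omega>'" "y \<in> \<Omega>'" and uv: "0 \<le> u" "0 \<le> v" "u + v = (1::real)"
      have b: "x \<in> ball 0 (2 * D)" "y \<in> ball 0 (2 * D)" "g x < 1" "g y < 1" using xy by (auto simp: \<Omega>'_def)
      have m: "u *\<^sub>R x + v *\<^sub>R y \<in> ball 0 (2 * D)" using b uv convex_ball by (intro convexD) auto
      have "g (u *\<^sub>R x + v *\<^sub>R y) \<le> u * g x + v * g y"
      proof (rule LIMSEQ_le)
        show "(\<lambda>n. j (k n) (u *\<^sub>R x + v *\<^sub>R y)) \<longlonglongrightarrow> g (u *\<^sub>R x + v *\<^sub>R y)" using m by (intro glim) auto
        show "(\<lambda>n. u * j (k n) x + v * j (k n) y) \<longlonglongrightarrow> u * g x + v * g y"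
          using b by (intro tendsto_intros glim) auto
      qed (use jconv[OF uv] in blast)
      also have "\<dots> < 1" using b(3,4) uv by (rule convex_bound_lt)
      finally show "u *\<^sub>R x + v *\<^sub>R y \<in> \<Omega>'" using m by (simp add: \<Omega>'_def)
    qed
  qed
  moreover have "\<forall>\<^sub>F n in sequentially.
      (\<lambda>x. (1 - s) *\<^sub>R x + 0) ` \<Omega>' \<subseteq> \<Omega> (k n) \<and> \<Omega> (k n) \<subseteq> (\<lambda>x. (1 + s) *\<^sub>R x + 0) ` \<Omega>'"
    if s: "0 < s" "s < 1" for s :: real
  proof -
    \<comment> \<open>Chosen with 1/(1 + s) + e = 1 for the second inclusion; the first one uses e <
      s, which gives (1 - s)(1 + e) \<le> 1.\<close>
    define e where "e = s / (1 + s)"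
    have e: "0 < e" "e < s" "1 / (1 + s) + e = 1"
      using s by (auto simp: e_def divide_less_eq add_divide_distrib[symmetric])
    obtain N where N: "\<And>n x. n \<ge> N \<Longrightarrow> x \<in> ?S \<Longrightarrow> norm (j (k n) x - g x) < e"
      using g(3)[OF e(1)] by blast
    have "(\<lambda>x. (1 - s) *\<^sub>R x + 0) ` \<Omega>' \<subseteq> \<Omega> (k n)" if n: "N \<le> n" for n
    proof
      fix z assume "z \<in> (\<lambda>x. (1 - s) *\<^sub>R x + 0) ` \<Omega>'"
      then obtain x where x: "x \<in> \<Omega>'" "z = (1 - s) *\<^sub>R x" by auto
      have xS: "x \<in> ?S" "g x < 1" using x by (auto simp: \<Omega>'_def)
      have "j (k n) z \<le> (1 - s) * j (k n) x" unfolding x(2) using s by (intro jscale) simp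
      also have "\<dots> \<le> (1 - s) * (g x + e)" using N[OF n xS(1)] s by (intro mult_left_mono) auto
      also have "\<dots> < (1 - s) * (1 + e)" using xS(2) s by (intro mult_strict_left_mono) auto
      also have "\<dots> \<le> 1"
      proof -
        have "(1 - s) * (1 + e) = 1 - s + e - s * e" by (simp add: algebra_simps)
        moreover have "0 \<le> s * e" using s e by simp
        ultimately show ?thesis using e(2) by linarith
      qed
      finally show "z \<in> \<Omega> (k n)" using jless[of "k n" z 1] by simp
    qed
    moreover have "\<Omega> (k n) \<subseteq> (\<lambda>x. (1 + s) *\<^sub>R x + 0) ` \<Omega>'" if n: "N \<le> n" for n
    proof
      fix x assume x: "x \<in> \<Omega> (k n)"
      define y where "y = inverse (1 + s) *\<^sub>R x"
      have "norm x < D" using x outer by (metis mem_ball_0 subsetD)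
      moreover have "norm y \<le> norm x"
      proof -
        have "inverse (1 + s) \<le> 1" using s by (simp add: field_simps)
        then have "inverse (1 + s) * norm x \<le> 1 * norm x" by (intro mult_right_mono) auto
        then show ?thesis using s by (simp add: y_def)
      qed
      ultimately have yS: "norm y < 2 * D" using D by linarith
      have "inverse (1 / (1 + s)) *\<^sub>R y = x" using s by (simp add: y_def)
      then have "j (k n) y \<le> 1 / (1 + s)" using s x by (intro jle) auto
      moreover have "norm (j (k n) y - g y) < e" using yS by (intro N[OF n]) auto
      ultimately have "g y < 1" using e(3) by (simp add: abs_less_iff)
      then have "y \<in> \<Omega>'" using yS by (simp add: \<Omega>'_def)
      moreover have "x = (1 + s) *\<^sub>R y + 0" using s by (simp add: y_def)
      ultimately show "x \<in> (\<lambda>x. (1 + s) *\<^sub>R x + 0) ` \<Omega>'" by blast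
    qed
    ultimately show ?thesis unfolding eventually_sequentially by blast
  qed
  ultimately show thesis using that g(2) by blast
qed

text \<open>For each s the bounds hold only from some index on, so n goes to infinity before s tends
  to 0.\<close>

lemma tendsto_sandwich_family:
  fixes X :: "nat \<Rightarrow> real" and lo hi :: "real \<Rightarrow> real"
  assumes lo: "(lo \<longlongrightarrow> x) (at_right 0)" and hi: "(hi \<longlongrightarrow> x) (at_right 0)"
    and ev: "\<And>s. 0 < s \<Longrightarrow> s < 1 \<Longrightarrow> \<forall>\<^sub>F n in sequentially. lo s \<le> X n \<and> X n \<le> hi s"
  shows "X \<longlonglongrightarrow> x"
proof (rule order_tendstoI)
  have I: "\<forall>\<^sub>F s in at_right (0::real). 0 < s \<and> s < 1"
    by (intro eventually_at_rightI[of 0 1]) auto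
  fix a
  {
    assume "a < x"
    with order_tendstoD(1)[OF lo] have "\<forall>\<^sub>F s in at_right 0. a < lo s \<and> 0 < s \<and> s < 1"
      using I by (auto intro: eventually_conj)
    then obtain s where s: "a < lo s" "0 < s" "s < 1"
      using eventually_happens trivial_limit_at_right_real by blast
    show "\<forall>\<^sub>F n in sequentially. a < X n"
      using ev[OF s(2,3)] by (rule eventually_mono) (use s(1) in linarith)
  next
    assume "x < a"
    with order_tendstoD(2)[OF hi] have "\<forall>\<^sub>F s in at_right 0. hi s < a \<and> 0 < s \<and> s < 1"
      using I by (auto intro: eventually_conj)
    then obtain s where s: "hi s < a" "0 < s" "s < 1"
      using eventually_happens trivial_limit_at_right_real by blast
    show "\<forall>\<^sub>F n in sequentially. X n < a"
      using ev[OF s(2,3)] by (rule eventually_mono) (use s(1) in linarith)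
  }
qed

lemma F_tendsto:
  fixes \<Omega> :: "nat \<Rightarrow> 'a::euclidean_space set"
  assumes \<Omega>: "\<And>n. \<Omega> n \<in> convex_domains" and \<Omega>': "\<Omega>' \<in> convex_domains" and p: "1 < p"
    and ev: "\<And>s. 0 < s \<Longrightarrow> s < 1 \<Longrightarrow> \<forall>\<^sub>F n in sequentially.
      (\<lambda>x. (1 - s) *\<^sub>R x + 0) ` \<Omega>' \<subseteq> \<Omega> n \<and> \<Omega> n \<subseteq> (\<lambda>x. (1 + s) *\<^sub>R x + 0) ` \<Omega>'"
  shows "(\<lambda>n. F p q (\<Omega> n)) \<longlonglongrightarrow> F p q \<Omega>'"
proof -
  have lim: "((\<lambda>s. (1 - s) powr b * y) \<longlongrightarrow> y) (at_right 0)" "((\<lambda>s. (1 + s) powr b * y) \<longlongrightarrow> y) (at_right 0)"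
    for b y :: real
  proof -
    have "((\<lambda>s. (1 - s) powr b * y) \<longlongrightarrow> (1 - 0) powr b * y) (at_right 0)" by (intro tendsto_intros) auto
    then show "((\<lambda>s. (1 - s) powr b * y) \<longlongrightarrow> y) (at_right 0)" by simp
    have "((\<lambda>s. (1 + s) powr b * y) \<longlongrightarrow> (1 + 0) powr b * y) (at_right 0)" by (intro tendsto_intros) auto
    then show "((\<lambda>s. (1 + s) powr b * y) \<longlongrightarrow> y) (at_right 0)" by simp
  qed
  have cd: "(\<lambda>x. a *\<^sub>R x + 0) ` \<Omega>' \<in> convex_domains" if "0 < a" for a
    using convex_domains_affine[OF \<Omega>' that] .
  let ?\<beta> = "p + real DIM('a) * (p - 1)"
  have T: "(\<lambda>n. torsion p (\<Omega> n)) \<longlonglongrightarrow> torsion p \<Omega>'"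
  proof (rule tendsto_sandwich_family[OF lim(1)[of ?\<beta>] lim(2)[of ?\<beta>]])
    fix s :: real assume s: "0 < s" "s < 1"
    show "\<forall>\<^sub>F n in sequentially. (1 - s) powr ?\<beta> * torsion p \<Omega>' \<le> torsion p (\<Omega> n)
        \<and> torsion p (\<Omega> n) \<le> (1 + s) powr ?\<beta> * torsion p \<Omega>'"
      using ev[OF s]
    proof eventually_elim
      case (elim n)
      then show ?case
        using torsion_mono[OF cd \<Omega> _ p, of "1 - s" n] torsion_mono[OF \<Omega> cd _ p, of "1 + s" n]
          torsion_affine[OF \<Omega>' _ p, of "1 - s" 0] torsion_affine[OF \<Omega>' _ p, of "1 + s" 0] s by simp
    qed
  qed
  have E: "(\<lambda>n. eigenvalue p (\<Omega> n)) \<longlonglongrightarrow> eigenvalue p \<Omega>'"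
  \<comment> \<open>The eigenvalue decreases under inclusion, so the larger dilate supplies the
    lower bound.\<close>
  proof (rule tendsto_sandwich_family[OF lim(2)[of "- p"] lim(1)[of "- p"]])
    fix s :: real assume s: "0 < s" "s < 1"
    show "\<forall>\<^sub>F n in sequentially. (1 + s) powr (- p) * eigenvalue p \<Omega>' \<le> eigenvalue p (\<Omega> n)
        \<and> eigenvalue p (\<Omega> n) \<le> (1 - s) powr (- p) * eigenvalue p \<Omega>'"
      using ev[OF s]
    proof eventually_elim
      case (elim n)
      then show ?case
        using eigenvalue_antimono[OF cd \<Omega> _ p, of "1 - s" n] eigenvalue_antimono[OF \<Omega> cd _ p, of "1 + s" n]
          eigenvalue_affine[OF \<Omega>' _ p, of "1 - s" 0] eigenvalue_affine[OF \<Omega>' _ p, of "1 + s" 0] s by simp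
    qed
  qed
  have V: "(\<lambda>n. measure lebesgue (\<Omega> n)) \<longlonglongrightarrow> measure lebesgue \<Omega>'"
  proof (rule tendsto_sandwich_family[OF lim(1)[of "real DIM('a)"] lim(2)[of "real DIM('a)"]])
    fix s :: real assume s: "0 < s" "s < 1"
    show "\<forall>\<^sub>F n in sequentially. (1 - s) powr real DIM('a) * measure lebesgue \<Omega>' \<le> measure lebesgue (\<Omega> n)
        \<and> measure lebesgue (\<Omega> n) \<le> (1 + s) powr real DIM('a) * measure lebesgue \<Omega>'"
      using ev[OF s]
    proof eventually_elim
      case (elim n)
      have pos: "0 < 1 - s" "0 < 1 + s" using s by auto
      have "measure lebesgue ((\<lambda>x. (1 - s) *\<^sub>R x + 0) ` \<Omega>') \<le> measure lebesgue (\<Omega> n)"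
        "measure lebesgue (\<Omega> n) \<le> measure lebesgue ((\<lambda>x. (1 + s) *\<^sub>R x + 0) ` \<Omega>')"
        using elim convex_domainsD(5)[OF cd[OF pos(1)]] convex_domainsD(5)[OF cd[OF pos(2)]] convex_domainsD(5)[OF \<Omega>]
        by (auto intro!: measure_mono_fmeasurable)
      then show ?case unfolding measure_affine[OF pos(1)] measure_affine[OF pos(2)] by blast
    qed
  qed
  show ?thesis
    unfolding F_def
    using torsion_pos[OF \<Omega>' p] convex_domainsD(6)[OF \<Omega>']
    by (intro tendsto_intros T E V) auto
qed

text \<open>By \<open>domain_diameter\<close> the volume bound and the inscribed unit ball confine
  all sets to one ball, so a subsequence converges. The same statement serves minimising and
  maximising sequences.\<close>

lemma limit_attained:
  fixes \<Omega> :: "nat \<Rightarrow> 'a::euclidean_space set"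
  assumes n: "\<And>n. normalized (\<Omega> n)" and V: "\<And>n. measure lebesgue (\<Omega> n) \<le> V" and p: "1 < p"
    and lim: "(\<lambda>n. F p q (\<Omega> n)) \<longlonglongrightarrow> v"
  obtains \<Omega>' :: "'a set" where "\<Omega>' \<in> convex_domains" "F p q \<Omega>' = v"
proof -
  have \<Omega>: "\<Omega> n \<in> convex_domains" "ball 0 1 \<subseteq> \<Omega> n" for n using n by (auto simp: normalized_def)
  let ?w = "measure lebesgue (ball (0::'a) (1 / 2))"
  have w: "0 < ?w" using convex_domainsD(6)[OF ball_convex_domain[of "1 / 2" "0::'a"]] by simp
  have V0: "0 \<le> V" using V[of 0] measure_nonneg order_trans by blast
  define D where "D = 2 * V / ?w + 1"
  have D: "0 < D" using V0 w by (simp add: D_def add_nonneg_pos)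
  have outer: "\<Omega> n \<subseteq> ball 0 D" for n
  proof
    fix x assume "x \<in> \<Omega> n"
    then have "norm x / 2 * ?w \<le> V" using domain_diameter[OF \<Omega>, of x n] V[of n] by linarith
    then have "norm x \<le> 2 * V / ?w" using w by (simp add: le_divide_eq)
    then show "x \<in> ball 0 D" by (simp add: D_def)
  qed
  obtain \<Omega>' k where k: "\<Omega>' \<in> convex_domains" "strict_mono (k :: nat \<Rightarrow> nat)"
    "\<And>s. 0 < s \<Longrightarrow> s < 1 \<Longrightarrow> \<forall>\<^sub>F n in sequentially.
      (\<lambda>x. (1 - s) *\<^sub>R x + 0) ` \<Omega>' \<subseteq> \<Omega> (k n) \<and> \<Omega> (k n) \<subseteq> (\<lambda>x. (1 + s) *\<^sub>R x + 0) ` \<Omega>'"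
    by (rule convex_domains_compact[of \<Omega> D, OF \<Omega> outer D]) (rule that)
  have "(\<lambda>n. F p q (\<Omega> (k n))) \<longlonglongrightarrow> F p q \<Omega>'"
    by (rule F_tendsto[OF \<Omega>(1) k(1) p k(3)])
  moreover have "(\<lambda>n. F p q (\<Omega> (k n))) \<longlonglongrightarrow> v"
    using LIMSEQ_subseq_LIMSEQ[OF lim k(2)] by (simp add: o_def)
  ultimately have "F p q \<Omega>' = v" by (rule LIMSEQ_unique)
  then show thesis using that k(1) by blast
qed

section \<open>Optimal domains and the two inequalities\<close>

lemma powr_le_imp_le:
  fixes x a y :: real
  assumes "x powr a \<le> y" "0 < x" "0 < a"
  shows "x \<le> y powr (1 / a)"
proof -
  have "(x powr a) powr (1 / a) \<le> y powr (1 / a)" using assms by (intro powr_mono2) auto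
  then show ?thesis using assms by (simp add: powr_powr)
qed

text \<open>The Saint-Venant inequality is raised to the power q - 1 and inserted in
  \<open>F_factor\<close>; for q < 1 this exponent is negative and the inequality turns
  round.\<close>

lemma F_le_isoperimetric:
  fixes \<Omega> :: "'a::euclidean_space set" and c :: 'a and q :: real
  assumes \<Omega>: "\<Omega> \<in> convex_domains" and p: "1 < p" and r: "0 < r"
  defines "A \<equiv> torsion p (ball c r) powr (q - 1)
    / measure lebesgue (ball c r) powr ((real DIM('a) * (p - 1) + p) * (q - 1) / real DIM('a))"
  shows "q < 1 \<Longrightarrow> F p 1 \<Omega> * A \<le> F p q \<Omega>" "1 < q \<Longrightarrow> F p q \<Omega> \<le> F p 1 \<Omega> * A" "0 < A"
proof -
  let ?k = "p - 1 + p / real DIM('a)"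
  let ?R = "\<lambda>X. torsion p X / measure lebesgue X powr ?k"
  note B = ball_convex_domain[OF r, of c]
  note T = torsion_pos[OF B p] and V = convex_domainsD(6)[OF B]
  have "(real DIM('a) * (p - 1) + p) * (q - 1) / real DIM('a) = ?k * (q - 1)" by (simp add: field_simps)
  then have A: "A = ?R (ball c r) powr (q - 1)"
    unfolding A_def using T by (simp add: powr_divide powr_powr)
  show "0 < A" unfolding A using T V by simp
  have pos: "0 < ?R \<Omega>" using torsion_pos[OF \<Omega> p] convex_domainsD(6)[OF \<Omega>] by simp
  note SV = Saint_Venant[OF \<Omega> p r, of c]
  show "F p 1 \<Omega> * A \<le> F p q \<Omega>" if "q < 1"
    unfolding F_factor[OF \<Omega> p, of q] A using pos SV that F_nonneg(1)[OF \<Omega> p]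
    by (intro mult_left_mono powr_mono2') auto
  show "F p q \<Omega> \<le> F p 1 \<Omega> * A" if "1 < q"
    unfolding F_factor[OF \<Omega> p, of q] A using pos SV that F_nonneg(1)[OF \<Omega> p]
    by (intro mult_left_mono powr_mono2) auto
qed

lemma unit_ball_domain: "ball (0::'a::euclidean_space) 1 \<in> convex_domains"
  by (rule ball_convex_domain) simp

lemma F_minimizer:
  assumes p: "1 < p" and q: "0 < q" "q < 1"
  obtains \<Omega>' :: "'a::euclidean_space set" where "\<Omega>' \<in> convex_domains"
    "\<And>\<Omega>::'a set. \<Omega> \<in> convex_domains \<Longrightarrow> F p q \<Omega>' \<le> F p q \<Omega>"
proof -
  let ?X = "F p q ` (convex_domains :: 'a set set)"
  define v where "v = Inf ?X"
  have ne: "?X \<noteq> {}" using unit_ball_domain by blast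
  have bdd: "bdd_below ?X" using F_nonneg(1)[OF _ p] by (intro bdd_belowI2[of _ 0])
  have v: "v \<le> F p q \<Omega>" if "\<Omega> \<in> convex_domains" for \<Omega> :: "'a set"
    unfolding v_def using that bdd by (intro cInf_lower) auto
  have "\<exists>\<Omega>::'a set. normalized \<Omega> \<and> F p q \<Omega> < v + inverse (real (Suc n))" for n
  proof -
    have "Inf ?X < v + inverse (real (Suc n))" by (simp add: v_def)
    then obtain \<Omega> :: "'a set" where "\<Omega> \<in> convex_domains" "F p q \<Omega> < v + inverse (real (Suc n))"
      using cInf_lessD[OF ne] by blast
    then show ?thesis using normalize[OF _ p, of \<Omega> q] by metis
  qed
  then obtain \<Omega> :: "nat \<Rightarrow> 'a set" where \<Omega>: "\<And>n. normalized (\<Omega> n)" "\<And>n. F p q (\<Omega> n) < v + inverse (real (Suc n))"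
    by metis
  have cd: "\<Omega> n \<in> convex_domains" for n using \<Omega>(1) by (simp add: normalized_def)
  have lim: "(\<lambda>n. F p q (\<Omega> n)) \<longlonglongrightarrow> v"
  proof (rule tendsto_sandwich[OF _ _ tendsto_const LIMSEQ_inverse_real_of_nat_add])
    show "\<forall>\<^sub>F n in sequentially. v \<le> F p q (\<Omega> n)" using v[OF cd] by simp
    show "\<forall>\<^sub>F n in sequentially. F p q (\<Omega> n) \<le> v + inverse (real (Suc n))"
      using \<Omega>(2) by (simp add: less_imp_le)
  qed
  obtain c where c: "0 < c" "\<And>\<Omega>::'a set. normalized \<Omega> \<Longrightarrow>
    c * measure lebesgue \<Omega> powr (p * (1 - q) / real DIM('a)) \<le> F p q \<Omega>"
    using normalized_F_lower[OF p q] by metis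
  have "measure lebesgue (\<Omega> n) \<le> ((v + 1) / c) powr (1 / (p * (1 - q) / real DIM('a)))" for n
  proof (rule powr_le_imp_le)
    have "inverse (real (Suc n)) \<le> 1" by (simp add: field_simps)
    then have "c * measure lebesgue (\<Omega> n) powr (p * (1 - q) / real DIM('a)) \<le> v + 1"
      using c(2)[OF \<Omega>(1), of n] \<Omega>(2)[of n] by linarith
    then show "measure lebesgue (\<Omega> n) powr (p * (1 - q) / real DIM('a)) \<le> (v + 1) / c"
      using c(1) by (simp add: le_divide_eq mult.commute)
    show "0 < measure lebesgue (\<Omega> n)" by (rule convex_domainsD(6)[OF cd])
    show "0 < p * (1 - q) / real DIM('a)" using p q by simp
  qed
  then obtain \<Omega>' :: "'a set" where "\<Omega>' \<in> convex_domains" "F p q \<Omega>' = v"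
    using limit_attained[OF \<Omega>(1) _ p lim] by metis
  then show thesis using that v by metis
qed

lemma F_maximizer:
  assumes p: "1 < p" and q: "1 < q"
  obtains \<Omega>' :: "'a::euclidean_space set" where "\<Omega>' \<in> convex_domains"
    "\<And>\<Omega>::'a set. \<Omega> \<in> convex_domains \<Longrightarrow> F p q \<Omega> \<le> F p q \<Omega>'"
proof -
  let ?X = "F p q ` (convex_domains :: 'a set set)"
  define v where "v = Sup ?X"
  have ne: "?X \<noteq> {}" using unit_ball_domain by blast
  have bdd: "bdd_above ?X"
  proof (rule bdd_aboveI2)
    fix \<Omega> :: "'a set" assume \<Omega>: "\<Omega> \<in> convex_domains"
    \<comment> \<open>The supremum is finite by comparison with the unit ball, since
      \<open>F p 1 \<Omega>\<close> is at most 1.\<close>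
    note A = F_le_isoperimetric[OF \<Omega> p zero_less_one, where c=0 and q=q]
    show "F p q \<Omega> \<le> 1 * (torsion p (ball (0::'a) 1) powr (q - 1)
      / measure lebesgue (ball (0::'a) 1) powr ((real DIM('a) * (p - 1) + p) * (q - 1) / real DIM('a)))"
      by (rule order_trans[OF A(2)[OF q] mult_right_mono[OF F_one_le[OF \<Omega> p] less_imp_le[OF A(3)]]])
  qed
  have v: "F p q \<Omega> \<le> v" if "\<Omega> \<in> convex_domains" for \<Omega> :: "'a set"
    unfolding v_def using that bdd by (intro cSup_upper) auto
  have v0: "0 < v" by (rule less_le_trans[OF F_nonneg(2)[OF unit_ball_domain p] v[OF unit_ball_domain]])
  \<comment> \<open>The error is a fraction of v so that F stays above v/2 along the sequence; such
    a positive lower bound is what turns \<open>normalized_F_upper\<close> into a bound on the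
    volume.\<close>
  define \<epsilon> where "\<epsilon> n = v / 2 * inverse (real (Suc n))" for n
  have \<epsilon>: "0 < \<epsilon> n" "\<epsilon> n \<le> v / 2" for n
  proof -
    have i: "0 < inverse (real (Suc n))" "inverse (real (Suc n)) \<le> 1" by (simp_all add: field_simps)
    show "0 < \<epsilon> n" unfolding \<epsilon>_def using i v0 by (intro mult_pos_pos) auto
    have "v / 2 * inverse (real (Suc n)) \<le> v / 2 * 1" using i v0 by (intro mult_left_mono) auto
    then show "\<epsilon> n \<le> v / 2" by (simp add: \<epsilon>_def)
  qed
  have "\<exists>\<Omega>::'a set. normalized \<Omega> \<and> v - \<epsilon> n < F p q \<Omega>" for n
  proof -
    have "v - \<epsilon> n < Sup ?X" using \<epsilon>(1)[of n] by (simp add: v_def)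
    then obtain \<Omega> :: "'a set" where "\<Omega> \<in> convex_domains" "v - \<epsilon> n < F p q \<Omega>"
      using less_cSupD[OF ne] by blast
    then show ?thesis using normalize[OF _ p, of \<Omega> q] by metis
  qed
  then obtain \<Omega> :: "nat \<Rightarrow> 'a set" where \<Omega>: "\<And>n. normalized (\<Omega> n)" "\<And>n. v - \<epsilon> n < F p q (\<Omega> n)"
    by metis
  have cd: "\<Omega> n \<in> convex_domains" for n using \<Omega>(1) by (simp add: normalized_def)
  have lim: "(\<lambda>n. F p q (\<Omega> n)) \<longlonglongrightarrow> v"
  proof (rule tendsto_sandwich[OF _ _ _ tendsto_const])
    show "\<forall>\<^sub>F n in sequentially. F p q (\<Omega> n) \<le> v" using v[OF cd] by simp
    show "\<forall>\<^sub>F n in sequentially. v - \<epsilon> n \<le> F p q (\<Omega> n)" using \<Omega>(2) by (simp add: less_imp_le)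
    have "(\<lambda>n. v - v / 2 * inverse (real (Suc n))) \<longlonglongrightarrow> v - v / 2 * 0"
      by (intro tendsto_intros LIMSEQ_inverse_real_of_nat)
    then show "(\<lambda>n. v - \<epsilon> n) \<longlonglongrightarrow> v" by (simp add: \<epsilon>_def)
  qed
  obtain c where c: "0 < c" "\<And>\<Omega>::'a set. normalized \<Omega> \<Longrightarrow>
    F p q \<Omega> \<le> c * measure lebesgue \<Omega> powr (- (p * (q - 1) / real DIM('a)))"
    using normalized_F_upper[OF p q] by metis
  let ?\<kappa> = "p * (q - 1) / real DIM('a)"
  have "measure lebesgue (\<Omega> n) \<le> (2 * c / v) powr (1 / ?\<kappa>)" for n
  proof (rule powr_le_imp_le)
    let ?V = "measure lebesgue (\<Omega> n)"
    show V: "0 < ?V" by (rule convex_domainsD(6)[OF cd])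
    have "v / 2 \<le> c * ?V powr (- ?\<kappa>)"
      using c(2)[OF \<Omega>(1), of n] \<Omega>(2)[of n] \<epsilon>(2)[of n] by linarith
    then have "v / 2 * ?V powr ?\<kappa> \<le> c * ?V powr (- ?\<kappa>) * ?V powr ?\<kappa>" by (intro mult_right_mono) auto
    also have "\<dots> = c" using V by (simp add: mult.assoc powr_add[symmetric])
    finally show "?V powr ?\<kappa> \<le> 2 * c / v" using v0 by (simp add: le_divide_eq mult.commute)
    show "0 < ?\<kappa>" using p q by simp
  qed
  then obtain \<Omega>' :: "'a set" where "\<Omega>' \<in> convex_domains" "F p q \<Omega>' = v"
    using limit_attained[OF \<Omega>(1) _ p lim] by metis
  then show thesis using that v by metis
qed

theorem theorem3p5:
  fixes p q r :: real and c :: "'a::euclidean_space" and B :: "'a set"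
  assumes "1 < p" and "0 < r" and "B = ball c r"
  shows "(0 < q \<and> q < 1 \<longrightarrow>
            m_inf TYPE('a) p q \<ge>
              m_inf TYPE('a) p 1 * ereal (torsion p B powr (q - 1)
                / measure lebesgue B powr
                    ((real DIM('a) * (p - 1) + p) * (q - 1) / real DIM('a)))) \<and>
         (1 < q \<longrightarrow>
            M_sup TYPE('a) p q \<le>
              M_sup TYPE('a) p 1 * ereal (torsion p B powr (q - 1)
                / measure lebesgue B powr
                    ((real DIM('a) * (p - 1) + p) * (q - 1) / real DIM('a)))) \<and>
         (0 < q \<and> q < 1 \<longrightarrow>
            (\<exists>\<Omega>\<in>(convex_domains :: 'a set set). ereal (F p q \<Omega>) = m_inf TYPE('a) p q)) \<and>
         (1 < q \<longrightarrow>
            (\<exists>\<Omega>\<in>(convex_domains :: 'a set set). ereal (F p q \<Omega>) = M_sup TYPE('a) p q))"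
proof (intro conjI impI; (elim conjE)?)
  note p = assms(1)
  let ?A = "torsion p B powr (q - 1)
    / measure lebesgue B powr ((real DIM('a) * (p - 1) + p) * (q - 1) / real DIM('a))"
  note A = F_le_isoperimetric[OF _ assms(1,2), where c=c and q=q, folded assms(3)]
  \<comment> \<open>Nonnegativity makes multiplication by this factor monotone in the extended
    reals, where the extrema for q = 1 are taken.\<close>
  have A0: "0 \<le> ereal ?A" using A(3)[OF unit_ball_domain] by simp
  {
    assume q: "0 < q" "q < 1"
    show "m_inf TYPE('a) p 1 * ereal ?A \<le> m_inf TYPE('a) p q"
      unfolding m_inf_def[of _ p q]
    proof (rule INF_greatest)
      fix \<Omega> :: "'a set" assume \<Omega>: "\<Omega> \<in> convex_domains"
      have "m_inf TYPE('a) p 1 * ereal ?A \<le> ereal (F p 1 \<Omega>) * ereal ?A"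
        unfolding m_inf_def by (intro ereal_mult_right_mono INF_lower \<Omega> A0)
      also have "\<dots> \<le> ereal (F p q \<Omega>)" using A(1)[OF \<Omega> q(2)] by simp
      finally show "m_inf TYPE('a) p 1 * ereal ?A \<le> ereal (F p q \<Omega>)" .
    qed
    obtain \<Omega>' :: "'a set" where "\<Omega>' \<in> convex_domains" "\<And>\<Omega>::'a set. \<Omega> \<in> convex_domains \<Longrightarrow> F p q \<Omega>' \<le> F p q \<Omega>"
      using F_minimizer[OF p q] by metis
    then show "\<exists>\<Omega>\<in>(convex_domains :: 'a set set). ereal (F p q \<Omega>) = m_inf TYPE('a) p q"
      unfolding m_inf_def by (intro bexI[of _ \<Omega>'] antisym INF_greatest INF_lower) auto
  }
  {
    assume q: "1 < q"
    show "M_sup TYPE('a) p q \<le> M_sup TYPE('a) p 1 * ereal ?A"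
      unfolding M_sup_def[of _ p q]
    proof (rule SUP_least)
      fix \<Omega> :: "'a set" assume \<Omega>: "\<Omega> \<in> convex_domains"
      have "ereal (F p q \<Omega>) \<le> ereal (F p 1 \<Omega>) * ereal ?A" using A(2)[OF \<Omega> q] by simp
      also have "\<dots> \<le> M_sup TYPE('a) p 1 * ereal ?A"
        unfolding M_sup_def by (intro ereal_mult_right_mono SUP_upper \<Omega> A0)
      finally show "ereal (F p q \<Omega>) \<le> M_sup TYPE('a) p 1 * ereal ?A" .
    qed
    obtain \<Omega>' :: "'a set" where "\<Omega>' \<in> convex_domains" "\<And>\<Omega>::'a set. \<Omega> \<in> convex_domains \<Longrightarrow> F p q \<Omega> \<le> F p q \<Omega>'"
      using F_maximizer[OF p q] by metis
    then show "\<exists>\<Omega>\<in>(convex_domains :: 'a set set). ereal (F p q \<Omega>) = M_sup TYPE('a) p q"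
      unfolding M_sup_def by (intro bexI[of _ \<Omega>'] antisym SUP_least SUP_upper) auto
  }
qed

end
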